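(* Let $0<\alpha_1,\alpha_2<1$. For $n\ge1$ let $\{N_{\alpha_1,\alpha_2}^{(n^2)}(t_1,t_2),\ (t_1,t_2)\in\mathbb{R}^2_+\}$ be the fractional Poisson random field with parameter $n^2$, independent of iid standard normal random variables $Z_1,Z_2,\dots$, and let $$\tilde{\mathscr{X}}_{\alpha_1,\alpha_2}^{(n)}(t_1,t_2)=n^{-1}\sum_{j=1}^{N_{\alpha_1,\alpha_2}^{(n^2)}(t_1,t_2)}Z_j .$$ Let $\{L_{\alpha_i}(t),\ t\ge0\}$, $i=1,2$, be two independent inverse $\alpha_i$-stable subordinators that are independent of the two parameter Brownian sheet $\{W(t_1,t_2),\ (t_1,t_2)\in\mathbb{R}^2_+\}$. Then, for each $(t_1,t_2)\in\mathbb{R}^2_+$, $\tilde{\mathscr{X}}_{\alpha_1,\alpha_2}^{(n)}(t_1,t_2)$ converges in distribution to $W(L_{\alpha_1}(t_1),L_{\alpha_2}(t_2))$ as $n\to\infty$.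
   Context: $\mathbb{R}_+=[0,\infty)$. An empty sum is $0$. Fractional Poisson random field with parameter $\lambda>0$ and indices $0<\alpha_1,\alpha_2\le1$: a nonnegative-integer-valued random field $\{N_{\alpha_1,\alpha_2}(t_1,t_2)\}$ on $\mathbb{R}^2_+$ whose one-point distribution $p_{\alpha_1,\alpha_2}(n,t_1,t_2)=\mathrm{Pr}\{N_{\alpha_1,\alpha_2}(t_1,t_2)=n\}$, $n\ge0$, solves $$\frac{\partial^{\alpha_1+\alpha_2}}{\partial t_2^{\alpha_2}\partial t_1^{\alpha_1}}p_{\alpha_1,\alpha_2}(n,t_1,t_2)=(n+1)\lambda p_{\alpha_1,\alpha_2}(n+1,t_1,t_2)-(2n+1)\lambda p_{\alpha_1,\alpha_2}(n,t_1,t_2)+n\lambda p_{\alpha_1,\alpha_2}(n-1,t_1,t_2)$$ with $p_{\alpha_1,\alpha_2}(0,0,0)=p_{\alpha_1,\alpha_2}(0,t_1,0)=p_{\alpha_1,\alpha_2}(0,0,t_2)=1$, the derivatives being Caputo: $\frac{1}{\Gamma(1-\alpha)}\int_0^t\frac{g'(s)}{(t-s)^\alpha}\,\mathrm{d}s$ for $0<\alpha<1$, and $g'(t)$ for $\alpha=1$. Brownian sheet: a process $\{W(t_1,t_2)\}$ with $W(0,t_2)=W(t_1,0)=0$ a.s., with independent and stationary rectangular increments, the increment $W(t_1,t_2)-W(s_1,t_2)-W(t_1,s_2)+W(s_1,s_2)$ being normal with mean zero and variance $(t_1-s_1)(t_2-s_2)$. Inverse stable subordinator: $L_\alpha(t)=\inf\{s\ge0:H_\alpha(s)\ge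 t\}$, where $\{H_\alpha(t),t\ge0\}$ is the non-decreasing Lévy process with $\mathbb{E}e^{-uH_\alpha(t)}=e^{-tu^\alpha}$, $u>0$.
   Formalization: The Brownian sheet is taken with a.s. continuous paths and W(L₁(t₁),L₂(t₂)) is assumed measurable (else W may be altered at the random point, making the claim false); "solves" means locally absolutely continuous in each time variable, with convergent Caputo integrals. *)

theory Defs
  imports "HOL-Probability.Probability"
begin

(* Half-line functions are total functions on the reals; only their values on [0,oo) matter. *)

(* Absolute continuity on every [0,T], in the form of the fundamental theorem of calculus for the
   Lebesgue integral. A function that is continuous on [0,oo), differentiable on (0,oo) and has a
   derivative integrable on every [0,T] is of this kind, even if the derivative blows up at 0. *)
definition locally_abs_cont :: "(real \<Rightarrow> real) \<Rightarrow> bool" where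
  "locally_abs_cont g \<longleftrightarrow>
     (AE s in lborel. 0 < s \<longrightarrow> g differentiable (at s)) \<and>
     (\<forall>t\<ge>0. set_integrable lborel {0..t} (deriv g) \<and> g t = g 0 + (LBINT s:{0..t}. deriv g s))"

definition caputo :: "real \<Rightarrow> (real \<Rightarrow> real) \<Rightarrow> real \<Rightarrow> real" where
  "caputo \<alpha> g t =
     (if \<alpha> = 1 then deriv g t
      else 1 / Gamma (1 - \<alpha>) * (LBINT s:{0..t}. deriv g s / (t - s) powr \<alpha>))"

(* deriv and the Lebesgue integral are total; this excludes their default values. *)
definition caputo_differentiable :: "real \<Rightarrow> (real \<Rightarrow> real) \<Rightarrow> bool" where
  "caputo_differentiable \<alpha> g \<longleftrightarrow>
     locally_abs_cont g \<and>
     (\<forall>t>0. if \<alpha> = 1 then g differentiable (at t)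
            else set_integrable lborel {0..t} (\<lambda>s. deriv g s / (t - s) powr \<alpha>))"

(* The inner derivative acts on t1, the outer one on t2. The equation is required for t1, t2 > 0
   only: on the axes the Caputo integral is empty while the right-hand side need not vanish
   (n = 0, t1 = 0 would give 0 = -lambda). For n = 0 the truncated index n - 1 has coefficient 0. *)
definition fractional_poisson_system ::
    "real \<Rightarrow> real \<Rightarrow> real \<Rightarrow> (nat \<Rightarrow> real \<Rightarrow> real \<Rightarrow> real) \<Rightarrow> bool" where
  "fractional_poisson_system \<alpha>\<^sub>1 \<alpha>\<^sub>2 lam p \<longleftrightarrow>
     (\<forall>n. \<forall>t\<^sub>2\<ge>0. caputo_differentiable \<alpha>\<^sub>1 (\<lambda>s\<^sub>1. p n s\<^sub>1 t\<^sub>2)) \<and>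
     (\<forall>n. \<forall>t\<^sub>1>0. caputo_differentiable \<alpha>\<^sub>2 (\<lambda>s\<^sub>2. caputo \<alpha>\<^sub>1 (\<lambda>s\<^sub>1. p n s\<^sub>1 s\<^sub>2) t\<^sub>1)) \<and>
     (\<forall>n. \<forall>t\<^sub>1>0. \<forall>t\<^sub>2>0.
        caputo \<alpha>\<^sub>2 (\<lambda>s\<^sub>2. caputo \<alpha>\<^sub>1 (\<lambda>s\<^sub>1. p n s\<^sub>1 s\<^sub>2) t\<^sub>1) t\<^sub>2 =
          (real n + 1) * lam * p (n + 1) t\<^sub>1 t\<^sub>2 - (2 * real n + 1) * lam * p n t\<^sub>1 t\<^sub>2
            + real n * lam * p (n - 1) t\<^sub>1 t\<^sub>2) \<and>
     p 0 0 0 = 1 \<and> (\<forall>t\<^sub>1\<ge>0. p 0 t\<^sub>1 0 = 1) \<and> (\<forall>t\<^sub>2\<ge>0. p 0 0 t\<^sub>2 = 1)"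

definition fractional_poisson_field ::
    "'a measure \<Rightarrow> real \<Rightarrow> real \<Rightarrow> real \<Rightarrow> (real \<Rightarrow> real \<Rightarrow> 'a \<Rightarrow> nat) \<Rightarrow> bool" where
  "fractional_poisson_field M \<alpha>\<^sub>1 \<alpha>\<^sub>2 lam N \<longleftrightarrow>
     prob_space M \<and> 0 < lam \<and> \<alpha>\<^sub>1 \<in> {0<..1} \<and> \<alpha>\<^sub>2 \<in> {0<..1} \<and>
     (\<forall>t\<^sub>1\<ge>0. \<forall>t\<^sub>2\<ge>0. N t\<^sub>1 t\<^sub>2 \<in> measurable M (count_space UNIV)) \<and>
     fractional_poisson_system \<alpha>\<^sub>1 \<alpha>\<^sub>2 lam (\<lambda>n t\<^sub>1 t\<^sub>2. measure M {\<omega> \<in> space M. N t\<^sub>1 t\<^sub>2 \<omega> = n})"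

definition rect_increment ::
    "(real \<Rightarrow> real \<Rightarrow> 'a \<Rightarrow> real) \<Rightarrow> (real \<times> real) \<times> (real \<times> real) \<Rightarrow> 'a \<Rightarrow> real" where
  "rect_increment W = (\<lambda>((s\<^sub>1, s\<^sub>2), (t\<^sub>1, t\<^sub>2)) \<omega>. W t\<^sub>1 t\<^sub>2 \<omega> - W s\<^sub>1 t\<^sub>2 \<omega> - W t\<^sub>1 s\<^sub>2 \<omega> + W s\<^sub>1 s\<^sub>2 \<omega>)"

(* Almost surely continuous version. Some path regularity is needed to evaluate W at random times:
   changing W only at the random point (L1, L2) leaves all finite-dimensional laws unchanged. *)
definition brownian_sheet :: "'a measure \<Rightarrow> (real \<Rightarrow> real \<Rightarrow> 'a \<Rightarrow> real) \<Rightarrow> bool" where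
  "brownian_sheet M W \<longleftrightarrow>
     prob_space M \<and>
     (\<forall>t\<^sub>1\<ge>0. \<forall>t\<^sub>2\<ge>0. W t\<^sub>1 t\<^sub>2 \<in> borel_measurable M) \<and>
     (\<forall>t\<ge>0. (AE \<omega> in M. W 0 t \<omega> = 0) \<and> (AE \<omega> in M. W t 0 \<omega> = 0)) \<and>
     (\<forall>(k::nat) s\<^sub>1 s\<^sub>2 t\<^sub>1 t\<^sub>2.
        (\<forall>i<k. 0 \<le> s\<^sub>1 i \<and> s\<^sub>1 i \<le> t\<^sub>1 i \<and> 0 \<le> s\<^sub>2 i \<and> s\<^sub>2 i \<le> t\<^sub>2 i) \<and>
        disjoint_family_on (\<lambda>i. {s\<^sub>1 i<..t\<^sub>1 i} \<times> {s\<^sub>2 i<..t\<^sub>2 i}) {..<k} \<longrightarrow>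
        prob_space.indep_vars M (\<lambda>_. borel)
          (\<lambda>i. rect_increment W ((s\<^sub>1 i, s\<^sub>2 i), (t\<^sub>1 i, t\<^sub>2 i))) {..<k}) \<and>
     (\<forall>s\<^sub>1\<ge>0. \<forall>s\<^sub>2\<ge>0. \<forall>h\<^sub>1\<ge>0. \<forall>h\<^sub>2\<ge>0.
        distr M borel (rect_increment W ((s\<^sub>1, s\<^sub>2), (s\<^sub>1 + h\<^sub>1, s\<^sub>2 + h\<^sub>2))) =
        distr M borel (rect_increment W ((0, 0), (h\<^sub>1, h\<^sub>2)))) \<and>
     (\<forall>s\<^sub>1\<ge>0. \<forall>s\<^sub>2\<ge>0. \<forall>t\<^sub>1>s\<^sub>1. \<forall>t\<^sub>2>s\<^sub>2.
        distributed M lborel (rect_increment W ((s\<^sub>1, s\<^sub>2), (t\<^sub>1, t\<^sub>2)))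
          (normal_density 0 (sqrt ((t\<^sub>1 - s\<^sub>1) * (t\<^sub>2 - s\<^sub>2))))) \<and>
     (AE \<omega> in M. continuous_on ({0..} \<times> {0..}) (\<lambda>(t\<^sub>1, t\<^sub>2). W t\<^sub>1 t\<^sub>2 \<omega>))"

(* Levy process on [0,oo), with stochastic continuity rather than cadlag paths. *)
definition levy_process :: "'a measure \<Rightarrow> (real \<Rightarrow> 'a \<Rightarrow> real) \<Rightarrow> bool" where
  "levy_process M H \<longleftrightarrow>
     prob_space M \<and>
     (\<forall>t\<ge>0. H t \<in> borel_measurable M) \<and>
     (AE \<omega> in M. H 0 \<omega> = 0) \<and>
     (\<forall>(k::nat) \<tau>. 0 \<le> \<tau> 0 \<and> mono_on {..k} \<tau> \<longrightarrow>
        prob_space.indep_vars M (\<lambda>_. borel) (\<lambda>i \<omega>. H (\<tau> (Suc i)) \<omega> - H (\<tau> i) \<omega>) {..<k}) \<and>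
     (\<forall>s\<ge>0. \<forall>h\<ge>0. distr M borel (\<lambda>\<omega>. H (s + h) \<omega> - H s \<omega>) =
                     distr M borel (\<lambda>\<omega>. H h \<omega> - H 0 \<omega>)) \<and>
     (\<forall>t\<ge>0. \<forall>\<epsilon>>0.
        ((\<lambda>s. measure M {\<omega> \<in> space M. \<epsilon> < \<bar>H s \<omega> - H t \<omega>\<bar>}) \<longlongrightarrow> 0) (at t within {0..}))"

definition stable_subordinator :: "'a measure \<Rightarrow> real \<Rightarrow> (real \<Rightarrow> 'a \<Rightarrow> real) \<Rightarrow> bool" where
  "stable_subordinator M \<alpha> H \<longleftrightarrow>
     levy_process M H \<and>
     (AE \<omega> in M. mono_on {0..} (\<lambda>t. H t \<omega>)) \<and>
     (\<forall>t\<ge>0. \<forall>u>0. prob_space.expectation M (\<lambda>\<omega>. exp (- u * H t \<omega>)) = exp (- t * u powr \<alpha>))"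

(* The infimum is over a non-empty set for almost every outcome, since H is a.s. unbounded. *)
definition inverse_stable_subordinator ::
    "'a measure \<Rightarrow> real \<Rightarrow> (real \<Rightarrow> 'a \<Rightarrow> real) \<Rightarrow> bool" where
  "inverse_stable_subordinator M \<alpha> L \<longleftrightarrow>
     (\<forall>t\<ge>0. L t \<in> borel_measurable M) \<and>
     (\<exists>H. stable_subordinator M \<alpha> H \<and>
          (\<forall>t\<ge>0. \<forall>\<omega>\<in>space M. L t \<omega> = Inf {s. 0 \<le> s \<and> t \<le> H s \<omega>}))"

(* Sigma-algebra generated by the family X i, i in I, of S-valued random variables; used because
   indep_var compares only random variables with a common value type. *)
definition process_events :: "'a measure \<Rightarrow> 'b measure \<Rightarrow> 'i set \<Rightarrow> ('i \<Rightarrow> 'a \<Rightarrow> 'b) \<Rightarrow> 'a set set" where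
  "process_events M S I X =
     sigma_sets (space M) {X i -` A \<inter> space M | i A. i \<in> I \<and> A \<in> sets S}"

end

theory Submission
  imports Defs
begin

text \<open>
  Laplace transforms in both time variables, normalised by integrating against exponential laws with
  rates \<open>a\<close> and \<open>b\<close>, turn the fractional system for the one-point laws into the three-term recurrence
  \<open>P n - [n = 0] = \<mu> ((n + 1) P (n + 1) - (2 n + 1) P n + n P (n - 1))\<close> with
  \<open>\<mu> = \<lambda> / (a powr \<alpha>\<^sub>1 * b powr \<alpha>\<^sub>2)\<close>, which has at most one solution tending to \<open>0\<close>. The Poisson weights with
  mean \<open>\<lambda> l m\<close> solve the same system in \<open>(l, m)\<close> with both indices equal to \<open>1\<close>, hence the same recurrence
  at the rates \<open>a powr \<alpha>\<^sub>1\<close> and \<open>b powr \<alpha>\<^sub>2\<close>. An inverse stable subordinator evaluated at an independent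
  exponential time of rate \<open>a\<close> is exponential of rate \<open>a powr \<alpha>\<close>; inverting the Laplace transforms one
  variable at a time therefore shows that \<open>N t\<^sub>1 t\<^sub>2\<close> is Poisson with the random mean \<open>\<lambda> L\<^sub>1(t\<^sub>1) L\<^sub>2(t\<^sub>2)\<close>.
  With \<open>\<lambda> = n\<^sup>2\<close> the characteristic function of the normalised sum at \<open>u\<close> is the expectation of
  \<open>exp (- n\<^sup>2 (1 - exp (- u\<^sup>2 / (2 n\<^sup>2))) L\<^sub>1 L\<^sub>2)\<close>, which tends to the expectation of
  \<open>exp (- u\<^sup>2 L\<^sub>1 L\<^sub>2 / 2)\<close>, the characteristic function of the subordinated sheet.
\<close>

section \<open>Fractional integrals and the Caputo derivative\<close>

text \<open>No derivative is ever Laplace transformed: two inversions of the Caputo operator turn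
  the system into a double fractional integral equation, for which Fubini suffices. Exponential laws
  are probability measures, so the initial value 1 is its own transform and bounded functions are
  integrable. In the recurrence the coefficient of \<open>P (n - 1)\<close> vanishes at
  \<open>n = 0\<close>, so a solution is fixed by \<open>P 0\<close> alone and decay in
  \<open>n\<close> removes this single degree of freedom; comparison with Poisson weights then
  replaces solving it. Laws are identified by uniqueness, so field and subordinators may live on
  different probability spaces. Two obstacles remain. Joint measurability of the inverse
  subordinators in time and outcome is not given, which is why their laws are handled as a kernel in
  time. And independence speaks of the sheet at fixed times, so random times are rounded to a grid
  and path continuity passes to the limit.\<close>

abbreviation exp_measure :: "real \<Rightarrow> real measure" where
  "exp_measure a \<equiv> density lborel (\<lambda>x. ennreal (exponential_density a x))"

text \<open>The Riemann-Liouville kernel of order \<alpha>. Being zero at \<open>u \<le> 0\<close>,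
  it cuts convolutions off at the current time by itself.\<close>

definition frac_kernel :: "real \<Rightarrow> real \<Rightarrow> real" where
  "frac_kernel \<alpha> u = (if 0 < u then u powr (\<alpha> - 1) / Gamma \<alpha> else 0)"

text \<open>The Riemann-Liouville integral; the fixed range \<open>{0..}\<close> makes it a
  convolution to which Fubini applies without moving limits.\<close>

definition frac_int :: "real \<Rightarrow> (real \<Rightarrow> real) \<Rightarrow> real \<Rightarrow> real" where
  "frac_int \<alpha> f t = (LBINT s:{0..}. frac_kernel \<alpha> (t - s) * f s)"

lemma frac_kernel_nonneg: "0 < \<alpha> \<Longrightarrow> 0 \<le> frac_kernel \<alpha> u"
  by (simp add: frac_kernel_def Gamma_real_pos less_imp_le)

lemma frac_kernel_measurable [measurable]: "frac_kernel \<alpha> \<in> borel_measurable borel"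
  unfolding frac_kernel_def by measurable

lemma frac_kernel_1: "frac_kernel 1 u = (if 0 < u then 1 else 0)"
  by (simp add: frac_kernel_def)

text \<open>The Gamma integral after scaling by \<open>a\<close>; stated in \<open>ennreal\<close>
  so that finiteness is a result and not a side condition.\<close>

lemma laplace_frac_kernel:
  assumes "0 < \<alpha>" "0 < a"
  shows "(\<integral>\<^sup>+u. ennreal (frac_kernel \<alpha> u * exp (- (a * u))) \<partial>lborel) = ennreal (a powr (-\<alpha>))"
proof -
  have G: "Gamma \<alpha> > 0" using assms by (simp add: Gamma_real_pos)
  have 1: "(\<integral>\<^sup>+u. ennreal (indicator {0..} u * (u powr (\<alpha> - 1) / exp u)) \<partial>lborel) = ennreal (Gamma \<alpha>)"
    using nn_integral_has_integral_lebesgue[OF _ Gamma_integral_real[OF assms(1)]]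
    by (simp add: nn_integral_completion)
  \<comment> \<open>\<open>0 + a * u\<close> is the form \<open>t + c * x\<close> produced by the
    affine substitution rule.\<close>
  have eq: "ennreal (indicator {0..} (0 + a * u) * ((0 + a * u) powr (\<alpha> - 1) / exp (0 + a * u)))
      = ennreal (Gamma \<alpha> * a powr (\<alpha> - 1)) * ennreal (frac_kernel \<alpha> u * exp (- (a * u)))" for u
    using assms G
    by (cases "u = 0")
       (auto simp: frac_kernel_def indicator_def powr_mult exp_minus zero_le_mult_iff field_simps
         less_imp_neq[OF G, symmetric] simp flip: ennreal_mult')
  have "ennreal (Gamma \<alpha>) = ennreal \<bar>a\<bar> * (\<integral>\<^sup>+u. ennreal (Gamma \<alpha> * a powr (\<alpha> - 1))
           * ennreal (frac_kernel \<alpha> u * exp (- (a * u))) \<partial>lborel)"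
    using assms unfolding 1[symmetric] eq[symmetric] by (intro nn_integral_real_affine) auto
  also have "\<dots> = ennreal (a * (Gamma \<alpha> * a powr (\<alpha> - 1))) * (\<integral>\<^sup>+u. ennreal (frac_kernel \<alpha> u * exp (- (a * u))) \<partial>lborel)"
    using assms G by (subst nn_integral_cmult) (auto simp: ennreal_mult mult.assoc)
  also have "a * (Gamma \<alpha> * a powr (\<alpha> - 1)) = Gamma \<alpha> * a powr \<alpha>"
    using assms by (simp add: powr_diff)
  finally have e: "ennreal (Gamma \<alpha> * a powr \<alpha>) * (\<integral>\<^sup>+u. ennreal (frac_kernel \<alpha> u * exp (- (a * u))) \<partial>lborel)
     = ennreal (Gamma \<alpha>)" ..
  have "ennreal (a powr (-\<alpha>)) = ennreal (a powr (-\<alpha>) / Gamma \<alpha>) * ennreal (Gamma \<alpha>)"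
    using G by (simp flip: ennreal_mult')
  also have "\<dots> = ennreal (a powr (-\<alpha>) / Gamma \<alpha>) * ennreal (Gamma \<alpha> * a powr \<alpha>)
      * (\<integral>\<^sup>+u. ennreal (frac_kernel \<alpha> u * exp (- (a * u))) \<partial>lborel)"
    by (simp only: e mult.assoc)
  also have "ennreal (a powr (-\<alpha>) / Gamma \<alpha>) * ennreal (Gamma \<alpha> * a powr \<alpha>)
     = ennreal (a powr (-\<alpha>) / Gamma \<alpha> * (Gamma \<alpha> * a powr \<alpha>))"
    using G by (intro ennreal_mult[symmetric]) auto
  also have "a powr (-\<alpha>) / Gamma \<alpha> * (Gamma \<alpha> * a powr \<alpha>) = 1"
    using less_imp_neq[OF G, symmetric] assms by (simp add: powr_minus field_simps)
  finally show ?thesis by simp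
qed

text \<open>Memorylessness: the exponential density at \<open>s + u\<close> is the density at
  \<open>s\<close> times \<open>exp (- (a * u))\<close>, so the shift by \<open>s\<close> comes out
  as a factor.\<close>

lemma laplace_frac_kernel_shift:
  assumes "0 < \<alpha>" "0 < a" "0 \<le> s"
  shows "(\<integral>\<^sup>+t. ennreal (frac_kernel \<alpha> (t - s)) \<partial>exp_measure a)
    = ennreal (a powr (-\<alpha>) * exponential_density a s)"
proof -
  have "(\<integral>\<^sup>+t. ennreal (frac_kernel \<alpha> (t - s)) \<partial>exp_measure a)
     = (\<integral>\<^sup>+t. ennreal (exponential_density a t * frac_kernel \<alpha> (t - s)) \<partial>lborel)"
    using assms by (subst nn_integral_density)
      (auto simp: ennreal_mult exponential_density_nonneg frac_kernel_nonneg)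
  also have "\<dots> = (\<integral>\<^sup>+u. ennreal (exponential_density a (s + 1 * u) * frac_kernel \<alpha> ((s + 1 * u) - s)) \<partial>lborel)"
    using nn_integral_real_affine[where c=1 and t=s, of "\<lambda>t. ennreal (exponential_density a t * frac_kernel \<alpha> (t - s))"] by simp
  also have "\<dots> = (\<integral>\<^sup>+u. ennreal (exponential_density a s) * ennreal (frac_kernel \<alpha> u * exp (- (a * u))) \<partial>lborel)"
    using assms
    by (intro nn_integral_cong)
       (auto simp: exponential_density_def frac_kernel_def mult_exp_exp algebra_simps simp flip: ennreal_mult')
  also have "\<dots> = ennreal (a powr (-\<alpha>) * exponential_density a s)"
    using assms
    by (subst nn_integral_cmult, measurable, subst laplace_frac_kernel)
       (auto simp: ennreal_mult exponential_density_nonneg mult.commute)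
  finally show ?thesis .
qed

text \<open>Tonelli for the convolution. Applied to \<open>norm (f s)\<close> it supplies the
  integrability for the signed case.\<close>

lemma laplace_frac_int_nn:
  assumes "0 < \<alpha>" "0 < a" and [measurable]: "f \<in> borel_measurable borel"
  shows "(\<integral>\<^sup>+t. (\<integral>\<^sup>+s. ennreal (indicator {0..} s * frac_kernel \<alpha> (t - s)) * f s \<partial>lborel) \<partial>exp_measure a)
      = ennreal (a powr (-\<alpha>)) * (\<integral>\<^sup>+s. f s \<partial>exp_measure a)"
proof -
  interpret E: prob_space "exp_measure a" using assms by (intro prob_space_exponential_density)
  interpret P: pair_sigma_finite lborel "exp_measure a" ..
  have "(\<integral>\<^sup>+t. (\<integral>\<^sup>+s. ennreal (indicator {0..} s * frac_kernel \<alpha> (t - s)) * f s \<partial>lborel) \<partial>exp_measure a)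
      = (\<integral>\<^sup>+s. (\<integral>\<^sup>+t. ennreal (indicator {0..} s * frac_kernel \<alpha> (t - s)) * f s \<partial>exp_measure a) \<partial>lborel)"
    by (rule P.Fubini') measurable
  also have "\<dots> = (\<integral>\<^sup>+s. ennreal (a powr (-\<alpha>)) * (ennreal (exponential_density a s) * f s) \<partial>lborel)"
  proof (intro nn_integral_cong)
    fix s :: real
    have "(\<integral>\<^sup>+t. ennreal (indicator {0..} s * frac_kernel \<alpha> (t - s)) * f s \<partial>exp_measure a)
       = (\<integral>\<^sup>+t. ennreal (indicator {0..} s) * ennreal (frac_kernel \<alpha> (t - s)) \<partial>exp_measure a) * f s"
      using assms by (subst nn_integral_multc) (auto simp: ennreal_mult frac_kernel_nonneg)
    also have "\<dots> = ennreal (indicator {0..} s) * (\<integral>\<^sup>+t. ennreal (frac_kernel \<alpha> (t - s)) \<partial>exp_measure a) * f s"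
      by (subst nn_integral_cmult) auto
    also have "\<dots> = ennreal (a powr (-\<alpha>)) * (ennreal (exponential_density a s) * f s)"
      using assms laplace_frac_kernel_shift[of \<alpha> a s]
      by (cases "0 \<le> s") (auto simp: ennreal_mult' exponential_density_def mult.assoc)
    finally show "(\<integral>\<^sup>+t. ennreal (indicator {0..} s * frac_kernel \<alpha> (t - s)) * f s \<partial>exp_measure a)
       = ennreal (a powr (-\<alpha>)) * (ennreal (exponential_density a s) * f s)" .
  qed
  also have "\<dots> = ennreal (a powr (-\<alpha>)) * (\<integral>\<^sup>+s. f s \<partial>exp_measure a)"
    by (subst nn_integral_cmult) (auto simp: nn_integral_density)
  finally show ?thesis .
qed

text \<open>The convolution theorem for Laplace transforms; the normalising factor of the
  exponential law appears on both sides and cancels.\<close>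

lemma laplace_frac_int:
  assumes "0 < \<alpha>" "0 < a" and f: "integrable (exp_measure a) f"
  shows "integrable (exp_measure a) (frac_int \<alpha> f)"
    and "(\<integral>t. frac_int \<alpha> f t \<partial>exp_measure a) = a powr (-\<alpha>) * (\<integral>s. f s \<partial>exp_measure a)"
proof -
  interpret E: prob_space "exp_measure a" using assms by (intro prob_space_exponential_density)
  interpret Q: pair_sigma_finite "exp_measure a" lborel ..
  have [measurable]: "f \<in> borel_measurable borel" using borel_measurable_integrable[OF f] by simp
  let ?g = "\<lambda>t s. (indicator {0..} s * frac_kernel \<alpha> (t - s)) * f s :: real"
  have fi: "(\<integral>\<^sup>+s. ennreal (norm (f s)) \<partial>exp_measure a) < \<infinity>"
    using f by (simp add: integrable_iff_bounded)
  have n: "(\<integral>\<^sup>+t. (\<integral>\<^sup>+s. ennreal (norm (?g t s)) \<partial>lborel) \<partial>exp_measure a) < \<infinity>"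
  proof -
    have "(\<integral>\<^sup>+t. (\<integral>\<^sup>+s. ennreal (norm (?g t s)) \<partial>lborel) \<partial>exp_measure a)
       = (\<integral>\<^sup>+t. (\<integral>\<^sup>+s. ennreal (indicator {0..} s * frac_kernel \<alpha> (t - s)) * ennreal (norm (f s)) \<partial>lborel) \<partial>exp_measure a)"
      using assms by (intro nn_integral_cong) (simp add: abs_mult frac_kernel_nonneg ennreal_mult)
    also have "\<dots> = ennreal (a powr (-\<alpha>)) * (\<integral>\<^sup>+s. ennreal (norm (f s)) \<partial>exp_measure a)"
      using assms by (intro laplace_frac_int_nn) auto
    finally show ?thesis using fi by (auto simp: ennreal_mult_less_top)
  qed
  have int: "integrable (exp_measure a \<Otimes>\<^sub>M lborel) (case_prod ?g)"
    using n by (intro integrableI_bounded)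
      (auto simp: lborel.nn_integral_fst[symmetric] case_prod_beta' cong: nn_integral_cong)
  have fe: "frac_int \<alpha> f t = (\<integral>s. ?g t s \<partial>lborel)" for t
    by (simp add: frac_int_def set_lebesgue_integral_def mult.assoc)
  show "integrable (exp_measure a) (frac_int \<alpha> f)"
    unfolding fe[abs_def] using Q.integrable_fst'[OF int] by simp
  have swap: "(\<integral>t. frac_int \<alpha> f t \<partial>exp_measure a) = (\<integral>s. (\<integral>t. ?g t s \<partial>exp_measure a) \<partial>lborel)"
    unfolding fe by (rule Q.Fubini_integral[OF int, symmetric])
  also have "\<dots> = (\<integral>s. a powr (-\<alpha>) * (exponential_density a s * f s) \<partial>lborel)"
  proof (intro Bochner_Integration.integral_cong refl)
    fix s :: real
    have k: "0 \<le> s \<Longrightarrow> (\<integral>t. frac_kernel \<alpha> (t - s) \<partial>exp_measure a) = a powr (-\<alpha>) * exponential_density a s"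
      using assms laplace_frac_kernel_shift[of \<alpha> a s]
      by (subst integral_eq_nn_integral) (auto simp: frac_kernel_nonneg exponential_density_nonneg)
    show "(\<integral>t. ?g t s \<partial>exp_measure a) = a powr (-\<alpha>) * (exponential_density a s * f s)"
      using k by (cases "0 \<le> s") (auto simp: exponential_density_def)
  qed
  also have "\<dots> = a powr (-\<alpha>) * (\<integral>s. f s \<partial>exp_measure a)"
    using assms by (subst integral_real_density) (auto simp: exponential_density_nonneg)
  finally show "(\<integral>t. frac_int \<alpha> f t \<partial>exp_measure a) = a powr (-\<alpha>) * (\<integral>s. f s \<partial>exp_measure a)" .
qed

section \<open>Bounds, limits and measurability of fractional integrals\<close>

lemma frac_int_altdef:
  "frac_int \<alpha> f t = (\<integral>s. (indicator {0..} s * frac_kernel \<alpha> (t - s)) * f s \<partial>lborel)"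
  by (simp add: frac_int_def set_lebesgue_integral_def mult.assoc)

lemma frac_int_measurable:
  assumes "set_borel_measurable lborel {0..} f"
  shows "frac_int \<alpha> f \<in> borel_measurable borel"
proof -
  have [measurable]: "(\<lambda>s. indicator {0..} s * f s) \<in> borel_measurable borel"
    using assms by (simp add: set_borel_measurable_def)
  have "frac_int \<alpha> f = (\<lambda>t. \<integral>s. frac_kernel \<alpha> (t - s) * (indicator {0..} s * f s) \<partial>lborel)"
    by (rule ext) (auto simp: frac_int_altdef ac_simps intro!: Bochner_Integration.integral_cong)
  then show ?thesis by simp
qed

text \<open>On \<open>u \<le> t\<close> one has \<open>1 \<le> exp (t - u)\<close>, and the Laplace
  transform of the kernel at rate 1 equals 1; the resulting crude bound is uniform in
  \<alpha>.\<close>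

lemma frac_kernel_tail:
  assumes "0 < \<alpha>"
  shows "(\<integral>\<^sup>+s. ennreal (indicator {0..} s * frac_kernel \<alpha> (t - s)) \<partial>lborel) \<le> ennreal (exp t)"
proof -
  have "(\<integral>\<^sup>+s. ennreal (indicator {0..} s * frac_kernel \<alpha> (t - s)) \<partial>lborel)
      = (\<integral>\<^sup>+u. ennreal (indicator {0..} (t - u) * frac_kernel \<alpha> u) \<partial>lborel)"
    using nn_integral_real_affine[where c="-1" and t=t, of "\<lambda>s. ennreal (indicator {0..} s * frac_kernel \<alpha> (t - s))"] by simp
  also have "\<dots> \<le> (\<integral>\<^sup>+u. ennreal (exp t) * ennreal (frac_kernel \<alpha> u * exp (- (1 * u))) \<partial>lborel)"
  proof (intro nn_integral_mono)
    fix u :: real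
    have "1 \<le> exp t * exp (- u)" if "u \<le> t" using that by (simp add: mult_exp_exp)
    then have "indicator {0..} (t - u) * frac_kernel \<alpha> u \<le> exp t * exp (- u) * frac_kernel \<alpha> u"
      using assms by (intro mult_right_mono) (auto simp: frac_kernel_nonneg indicator_def)
    then show "ennreal (indicator {0..} (t - u) * frac_kernel \<alpha> u) \<le> ennreal (exp t) * ennreal (frac_kernel \<alpha> u * exp (- (1 * u)))"
      using assms by (auto simp flip: ennreal_mult' intro!: ennreal_leI simp: mult_ac)
  qed
  also have "\<dots> = ennreal (exp t)"
    using assms by (subst nn_integral_cmult, measurable, subst laplace_frac_kernel) auto
  finally show ?thesis .
qed

lemma integrable_frac_kernel:
  assumes "0 < \<alpha>"
  shows "integrable lborel (\<lambda>s. indicator {0..} s * frac_kernel \<alpha> (t - s))"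
proof (rule integrableI_bounded)
  have "(\<integral>\<^sup>+s. ennreal (norm (indicator {0..} s * frac_kernel \<alpha> (t - s))) \<partial>lborel)
      = (\<integral>\<^sup>+s. ennreal (indicator {0..} s * frac_kernel \<alpha> (t - s)) \<partial>lborel)"
    using assms by (simp add: abs_mult frac_kernel_nonneg)
  also have "\<dots> < \<infinity>" using frac_kernel_tail[OF assms, of t] by (simp add: le_less_trans)
  finally show "(\<integral>\<^sup>+s. ennreal (norm (indicator {0..} s * frac_kernel \<alpha> (t - s))) \<partial>lborel) < \<infinity>" .
qed measurable

text \<open>The integrand is dominated by \<open>C\<close> times the kernel, whose mass is at most
  \<open>exp t\<close>.\<close>

lemma frac_int_bound:
  assumes "0 < \<alpha>" and C: "\<And>s. 0 < s \<Longrightarrow> \<bar>f s\<bar> \<le> C"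
  shows "\<bar>frac_int \<alpha> f t\<bar> \<le> C * exp t"
proof -
  have C0: "0 \<le> C" using C[of 1] by linarith
  have K: "(\<integral>s. indicator {0..} s * frac_kernel \<alpha> (t - s) \<partial>lborel) \<le> exp t"
    using assms frac_kernel_tail[of \<alpha> t]
    by (subst integral_eq_nn_integral) (auto simp: frac_kernel_nonneg intro!: enn2real_leI)
  have ae: "AE s in lborel. norm ((indicator {0..} s * frac_kernel \<alpha> (t - s)) * f s)
         \<le> C * (indicator {0..} s * frac_kernel \<alpha> (t - s))"
    using AE_lborel_singleton[of "0::real"]
  proof eventually_elim
    case (elim s)
    then show ?case using C[of s] assms
      by (auto simp: indicator_def abs_mult frac_kernel_nonneg mult.commute intro!: mult_right_mono)
  qed
  have "\<bar>frac_int \<alpha> f t\<bar> \<le> (\<integral>s. C * (indicator {0..} s * frac_kernel \<alpha> (t - s)) \<partial>lborel)"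
  proof (cases "integrable lborel (\<lambda>s. (indicator {0..} s * frac_kernel \<alpha> (t - s)) * f s)")
    case True
    have "\<bar>frac_int \<alpha> f t\<bar> \<le> (\<integral>s. norm ((indicator {0..} s * frac_kernel \<alpha> (t - s)) * f s) \<partial>lborel)"
      unfolding frac_int_altdef using integral_norm_bound[of lborel "\<lambda>s. (indicator {0..} s * frac_kernel \<alpha> (t - s)) * f s"]
      by simp
    also have "\<dots> \<le> (\<integral>s. C * (indicator {0..} s * frac_kernel \<alpha> (t - s)) \<partial>lborel)"
      by (rule integral_mono_AE[OF integrable_norm[OF True] integrable_mult_right[OF integrable_frac_kernel[OF assms(1)]] ae])
    finally show ?thesis .
  next
    \<comment> \<open>A non-integrable function has Bochner integral 0, so the bound is
      trivial.\<close>
    case False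
    then show ?thesis unfolding frac_int_altdef using C0 assms
      by (auto simp: not_integrable_integral_eq frac_kernel_nonneg intro!: mult_nonneg_nonneg integral_nonneg_AE)
  qed
  also have "\<dots> \<le> C * exp t" using K C0 by (simp add: mult_left_mono)
  finally show ?thesis .
qed

text \<open>Dominated convergence with the kernel as majorant. Bound and limit are asked for at
  \<open>s > 0\<close> only, which is where the inner Caputo derivative, the intended
  \<open>f\<close>, is controlled.\<close>

lemma frac_int_tendsto:
  assumes "0 < \<alpha>" and C: "\<And>n s. 0 < s \<Longrightarrow> \<bar>f n s\<bar> \<le> C"
    and meas: "\<And>n. set_borel_measurable lborel {0..} (f n)" "set_borel_measurable lborel {0..} g"
    and lim: "\<And>s. 0 < s \<Longrightarrow> (\<lambda>n. f n s) \<longlonglongrightarrow> g s"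
  shows "(\<lambda>n. frac_int \<alpha> (f n) t) \<longlonglongrightarrow> frac_int \<alpha> g t"
proof -
  have m: "(\<lambda>s. (indicator {0..} s * frac_kernel \<alpha> (t - s)) * h s) \<in> borel_measurable lborel"
    if "set_borel_measurable lborel {0..} h" for h :: "real \<Rightarrow> real"
  proof -
    have [measurable]: "(\<lambda>s. indicator {0..} s * h s) \<in> borel_measurable borel"
      using that by (simp add: set_borel_measurable_def)
    have "(\<lambda>s. frac_kernel \<alpha> (t - s) * (indicator {0..} s * h s)) \<in> borel_measurable lborel" by measurable
    then show ?thesis by (simp add: mult_ac)
  qed
  show ?thesis unfolding frac_int_altdef
  proof (rule integral_dominated_convergence[where w="\<lambda>s. C * (indicator {0..} s * frac_kernel \<alpha> (t - s))"])
    show "integrable lborel (\<lambda>s. C * (indicator {0..} s * frac_kernel \<alpha> (t - s)))"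
      using integrable_frac_kernel[OF assms(1)] by simp
    show "AE s in lborel. (\<lambda>n. (indicator {0..} s * frac_kernel \<alpha> (t - s)) * f n s)
            \<longlonglongrightarrow> (indicator {0..} s * frac_kernel \<alpha> (t - s)) * g s"
      using AE_lborel_singleton[of "0::real"]
    proof eventually_elim
      case (elim s)
      then show ?case using lim[of s] by (cases "0 < s") (auto intro!: tendsto_intros)
    qed
    show "AE s in lborel. norm ((indicator {0..} s * frac_kernel \<alpha> (t - s)) * f n s)
       \<le> C * (indicator {0..} s * frac_kernel \<alpha> (t - s))" for n
      using AE_lborel_singleton[of "0::real"]
    proof eventually_elim
      case (elim s)
      then show ?case using C[of s n] assms(1)
        by (auto simp: indicator_def abs_mult frac_kernel_nonneg mult.commute intro!: mult_right_mono)
    qed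
  qed (use m meas in auto)
qed

text \<open>Substituting \<open>s = r + (t - r) * v\<close> gives a Beta integral. Its value cancels
  the two Gamma factors of the kernels, and the powers of \<open>t - r\<close> add up to -1, the
  inverse of the Jacobian.\<close>

lemma frac_kernel_convolution:
  assumes "0 < \<alpha>" "\<alpha> < 1" "r < t"
  shows "(\<integral>\<^sup>+s. ennreal (frac_kernel \<alpha> (t - s) * frac_kernel (1 - \<alpha>) (s - r)) \<partial>lborel) = 1"
proof -
  have G: "Gamma \<alpha> > 0" "Gamma (1 - \<alpha>) > 0" using assms by (auto simp: Gamma_real_pos)
  \<comment> \<open>First argument \<open>1 - \<alpha>\<close>: the factor that is singular at
    \<open>r\<close>, hence at \<open>v = 0\<close>, has exponent -\<alpha>.\<close>
  define B where "B = Beta (1 - \<alpha>) \<alpha>"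
  have B: "B = Gamma \<alpha> * Gamma (1 - \<alpha>)" by (simp add: Beta_def B_def)
  have 1: "(\<integral>\<^sup>+v. ennreal (indicator {0..1} v * (v powr - \<alpha> * (1 - v) powr (\<alpha> - 1))) \<partial>lborel) = ennreal B"
    using nn_integral_has_integral_lebesgue[OF _ has_integral_Beta_real[of "1 - \<alpha>" \<alpha>]] assms
    by (simp add: nn_integral_completion B_def)
  have "(\<integral>\<^sup>+s. ennreal (frac_kernel \<alpha> (t - s) * frac_kernel (1 - \<alpha>) (s - r)) \<partial>lborel)
     = ennreal \<bar>t - r\<bar> * (\<integral>\<^sup>+v. ennreal (frac_kernel \<alpha> (t - (r + (t - r) * v)) * frac_kernel (1 - \<alpha>) ((r + (t - r) * v) - r)) \<partial>lborel)"
    using assms by (intro nn_integral_real_affine) auto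
  also have "\<dots> = ennreal (t - r) * (\<integral>\<^sup>+v. ennreal (1 / ((t - r) * B)) * ennreal (indicator {0..1} v * (v powr - \<alpha> * (1 - v) powr (\<alpha> - 1))) \<partial>lborel)"
  proof -
    have "AE v in lborel. ennreal (frac_kernel \<alpha> (t - (r + (t - r) * v)) * frac_kernel (1 - \<alpha>) ((r + (t - r) * v) - r))
       = ennreal (1 / ((t - r) * B)) * ennreal (indicator {0..1} v * (v powr - \<alpha> * (1 - v) powr (\<alpha> - 1)))"
      using AE_lborel_singleton[of "0::real"] AE_lborel_singleton[of "1::real"]
    proof eventually_elim
      case (elim v)
      have e: "t - (r + (t - r) * v) = (t - r) * (1 - v)" "(r + (t - r) * v) - r = (t - r) * v"
        by (simp_all add: algebra_simps)
      have p: "(t - r) powr (\<alpha> - 1) * (t - r) powr (- \<alpha>) = 1 / (t - r)"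
        using assms by (simp add: powr_minus_divide powr_diff)
      have i: "(t - r) * (1 - v) > 0 \<longleftrightarrow> v < 1" "(t - r) * v > 0 \<longleftrightarrow> v > 0"
        using assms by (auto simp: zero_less_mult_iff)
      show ?case
      proof (cases "0 < v \<and> v < 1")
        case True
        have "frac_kernel \<alpha> ((t - r) * (1 - v)) * frac_kernel (1 - \<alpha>) ((t - r) * v)
            = ((t - r) powr (\<alpha> - 1) * (t - r) powr (- \<alpha>)) * (v powr - \<alpha> * (1 - v) powr (\<alpha> - 1)) / B"
          using True assms i by (simp add: frac_kernel_def powr_mult B)
        also have "\<dots> = 1 / ((t - r) * B) * (indicator {0..1} v * (v powr - \<alpha> * (1 - v) powr (\<alpha> - 1)))"
          unfolding p using True by simp
        finally show ?thesis unfolding e using assms G by (simp flip: ennreal_mult' add: B)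
      next
        case False
        then show ?thesis using elim i unfolding e by (auto simp: frac_kernel_def indicator_def)
      qed
    qed
    then show ?thesis using assms by (subst nn_integral_cong_AE) auto
  qed
  also have "\<dots> = ennreal (t - r) * (ennreal (1 / ((t - r) * B)) * ennreal B)"
    by (subst nn_integral_cmult) (auto simp: 1)
  also have "\<dots> = ennreal ((t - r) * (1 / ((t - r) * B) * B))"
    using assms G by (simp add: B flip: ennreal_mult')
  also have "\<dots> = 1" using assms less_imp_neq[OF G(1)] less_imp_neq[OF G(2)] by (simp add: B)
  finally show ?thesis .
qed

text \<open>Orders \<alpha> and \<open>1 - \<alpha>\<close> compose to ordinary integration; Fubini
  is licensed by the convolved kernels having mass at most 1.\<close>

lemma frac_int_frac_int:
  assumes "0 < \<alpha>" "\<alpha> < 1" and d: "set_integrable lborel {0..t} d"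
  shows "frac_int \<alpha> (frac_int (1 - \<alpha>) d) t = (LBINT r:{0..t}. d r)"
proof -
  \<comment> \<open>Integrability of \<open>d\<close> is known on \<open>{0..t}\<close> only; beyond
    \<open>t\<close> the product of the kernels vanishes, so the cut-off changes nothing.\<close>
  define d' where "d' = (\<lambda>r. indicator {0..t} r * d r)"
  have d': "integrable lborel d'" using d by (simp add: d'_def set_integrable_def)
  have [measurable]: "d' \<in> borel_measurable borel" using borel_measurable_integrable[OF d'] by simp
  let ?g = "\<lambda>s r. (frac_kernel \<alpha> (t - s) * frac_kernel (1 - \<alpha>) (s - r)) * d' r"
  have k: "(\<integral>\<^sup>+s. ennreal (norm (?g s r)) \<partial>lborel) \<le> ennreal (norm (d' r))" for r
  proof -
    have "(\<integral>\<^sup>+s. ennreal (norm (?g s r)) \<partial>lborel)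
       = (\<integral>\<^sup>+s. ennreal (frac_kernel \<alpha> (t - s) * frac_kernel (1 - \<alpha>) (s - r)) * ennreal (norm (d' r)) \<partial>lborel)"
      using assms by (intro nn_integral_cong) (simp add: abs_mult frac_kernel_nonneg ennreal_mult)
    also have "\<dots> = (\<integral>\<^sup>+s. ennreal (frac_kernel \<alpha> (t - s) * frac_kernel (1 - \<alpha>) (s - r)) \<partial>lborel) * ennreal (norm (d' r))"
      by (rule nn_integral_multc) measurable
    also have "\<dots> \<le> ennreal (norm (d' r))"
    proof (cases "r < t")
      case False
      then have z: "frac_kernel \<alpha> (t - s) * frac_kernel (1 - \<alpha>) (s - r) = 0" for s
        by (auto simp: frac_kernel_def)
      show ?thesis unfolding z by simp
    qed (simp add: frac_kernel_convolution assms)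
    finally show ?thesis .
  qed
  have "(\<integral>\<^sup>+r. (\<integral>\<^sup>+s. ennreal (norm (?g s r)) \<partial>lborel) \<partial>lborel) \<le> (\<integral>\<^sup>+r. ennreal (norm (d' r)) \<partial>lborel)"
    by (intro nn_integral_mono k)
  also have "\<dots> < \<infinity>" using d' by (simp add: integrable_iff_bounded)
  finally have "(\<integral>\<^sup>+s. (\<integral>\<^sup>+r. ennreal (norm (?g s r)) \<partial>lborel) \<partial>lborel) < \<infinity>"
    by (subst lborel_pair.Fubini') auto
  then have int: "integrable (lborel \<Otimes>\<^sub>M lborel) (case_prod ?g)"
    by (intro integrableI_bounded)
      (auto simp: lborel.nn_integral_fst[symmetric] case_prod_beta' cong: nn_integral_cong)
  have "frac_int \<alpha> (frac_int (1 - \<alpha>) d) t = (\<integral>s. (\<integral>r. ?g s r \<partial>lborel) \<partial>lborel)"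
    unfolding frac_int_altdef[of \<alpha>]
  proof (intro Bochner_Integration.integral_cong refl)
    fix s :: real
    have "(indicator {0..} s * frac_kernel \<alpha> (t - s)) * frac_int (1 - \<alpha>) d s =
       (\<integral>r. (indicator {0..} s * frac_kernel \<alpha> (t - s)) * (indicator {0..} r * frac_kernel (1 - \<alpha>) (s - r) * d r) \<partial>lborel)"
      unfolding frac_int_altdef[of "1 - \<alpha>"] by simp
    also have "\<dots> = (\<integral>r. ?g s r \<partial>lborel)"
      by (intro Bochner_Integration.integral_cong) (auto simp: d'_def indicator_def frac_kernel_def)
    finally show "(indicator {0..} s * frac_kernel \<alpha> (t - s)) * frac_int (1 - \<alpha>) d s = (\<integral>r. ?g s r \<partial>lborel)" .
  qed
  also have "\<dots> = (\<integral>r. (\<integral>s. ?g s r \<partial>lborel) \<partial>lborel)"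
    by (rule lborel_pair.Fubini_integral[OF int, symmetric])
  also have "\<dots> = (\<integral>r. d' r \<partial>lborel)"
  proof (intro integral_cong_AE)
    show "AE r in lborel. (\<integral>s. ?g s r \<partial>lborel) = d' r"
      using AE_lborel_singleton[of t]
    proof eventually_elim
      case (elim r)
      show ?case
      proof (cases "r < t")
        case True
        then have "(\<integral>s. frac_kernel \<alpha> (t - s) * frac_kernel (1 - \<alpha>) (s - r) \<partial>lborel) = 1"
          using assms frac_kernel_convolution[of \<alpha> r t]
          by (subst integral_eq_nn_integral) (auto simp: frac_kernel_nonneg)
        then show ?thesis by simp
      qed (use elim in \<open>simp add: d'_def\<close>)
    qed
  qed measurable
  finally show ?thesis by (simp add: d'_def set_lebesgue_integral_def)
qed

section \<open>Inversion of the Caputo derivative\<close>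

lemma caputo_eq_frac_int:
  assumes "0 < \<alpha>" "\<alpha> < 1"
  shows "caputo \<alpha> g = frac_int (1 - \<alpha>) (deriv g)"
proof
  fix t
  have "caputo \<alpha> g t = (\<integral>s. 1 / Gamma (1 - \<alpha>) * (indicator {0..t} s * (deriv g s / (t - s) powr \<alpha>)) \<partial>lborel)"
    using assms unfolding integral_mult_right_zero by (simp add: caputo_def set_lebesgue_integral_def)
  \<comment> \<open>The integrands agree everywhere: at \<open>s = t\<close> both are 0, on the left
    through division by \<open>0 powr \<alpha> = 0\<close>.\<close>
  also have "\<dots> = frac_int (1 - \<alpha>) (deriv g) t"
    unfolding frac_int_altdef
    by (intro Bochner_Integration.integral_cong)
       (auto simp: frac_kernel_def indicator_def powr_minus divide_inverse ac_simps)
  finally show "caputo \<alpha> g t = frac_int (1 - \<alpha>) (deriv g) t" .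
qed

text \<open>The Caputo derivative is the fractional integral of order \<open>1 - \<alpha>\<close> of
  \<open>deriv g\<close>, so integrating it to order \<alpha> leaves the ordinary integral of
  \<open>deriv g\<close>.\<close>

lemma frac_int_caputo:
  assumes "0 < \<alpha>" "\<alpha> < 1" "locally_abs_cont g" "0 \<le> t"
  shows "frac_int \<alpha> (caputo \<alpha> g) t = g t - g 0"
proof -
  have "set_integrable lborel {0..t} (deriv g)" and g: "g t = g 0 + (LBINT s:{0..t}. deriv g s)"
    using assms(3,4) unfolding locally_abs_cont_def by blast+
  from frac_int_frac_int[OF assms(1,2) this(1)] g show ?thesis
    unfolding caputo_eq_frac_int[OF assms(1,2)] by linarith
qed

text \<open>\<open>deriv g\<close> has unspecified values where \<open>g\<close> is not
  differentiable, so measurability is extracted from integrability on the intervals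
  \<open>{0..n}\<close>.\<close>

lemma locally_abs_cont_deriv_measurable:
  assumes "locally_abs_cont g"
  shows "set_borel_measurable lborel {0..} (deriv g)"
proof -
  have "(\<lambda>s. indicator {0..real n} s * deriv g s) \<in> borel_measurable lborel" for n
  proof -
    have "set_integrable lborel {0..real n} (deriv g)"
      using assms unfolding locally_abs_cont_def by simp
    then show ?thesis unfolding set_integrable_def by (auto dest: borel_measurable_integrable)
  qed
  moreover have "(\<lambda>n. indicator {0..real n} s * deriv g s) \<longlonglongrightarrow> indicator {0..} s * deriv g s" for s
  proof (rule tendsto_eventually)
    show "\<forall>\<^sub>F n in sequentially. indicator {0..real n} s * deriv g s = indicator {0..} s * deriv g s"
      using eventually_ge_at_top[of "nat \<lceil>s\<rceil>"]
    proof eventually_elim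
      case (elim n)
      then have "s \<le> real n" by linarith
      then show ?case by (simp add: indicator_def)
    qed
  qed
  ultimately have "(\<lambda>s. indicator {0..} s * deriv g s) \<in> borel_measurable lborel"
    by (rule borel_measurable_LIMSEQ_real[rotated])
  then show ?thesis by (simp add: set_borel_measurable_def)
qed

lemma caputo_measurable:
  assumes "0 < \<alpha>" "\<alpha> < 1" "locally_abs_cont g"
  shows "caputo \<alpha> g \<in> borel_measurable borel"
  using assms by (simp add: caputo_eq_frac_int frac_int_measurable locally_abs_cont_deriv_measurable)

lemma locally_abs_cont_continuous:
  assumes "locally_abs_cont g"
  shows "continuous_on {0..} g"
proof -
  have "continuous_on {0..T} g" if "0 \<le> T" for T
  proof -
    have s: "set_integrable lborel {0..t} (deriv g)" "g t = g 0 + (LBINT s:{0..t}. deriv g s)" if "0 \<le> t" for t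
      using assms that unfolding locally_abs_cont_def by blast+
    have "continuous_on {0..T} (\<lambda>t. g 0 + integral {0..t} (deriv g))"
      by (intro continuous_intros indefinite_integral_continuous_1 set_borel_integral_eq_integral s that)
    moreover have "g 0 + integral {0..t} (deriv g) = g t" if "t \<in> {0..T}" for t
      using s[of t] that by (simp add: set_borel_integral_eq_integral)
    ultimately show ?thesis by (rule continuous_on_eq)
  qed
  then have c: "continuous (at t within {0..t+1}) g" if "0 \<le> t" for t
    using that by (auto simp: continuous_on_eq_continuous_within)
  have "at t within {0..t+1} = at t within {0..}" for t :: real
    by (rule at_within_nhd[of _ "{..<t+1}"]) auto
  with c show ?thesis
    by (auto simp: continuous_on_eq_continuous_within continuous_within)
qed

text \<open>The kernel vanishes from \<open>t\<close> on and 0 is a null point; equations that hold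
  only off the axes can thus be inserted under the integral.\<close>

lemma frac_int_cong:
  assumes "\<And>s. 0 < s \<Longrightarrow> s < t \<Longrightarrow> f s = g s"
  shows "frac_int \<alpha> f t = frac_int \<alpha> g t"
  unfolding frac_int_altdef
proof (rule integral_discrete_difference[of "{0}"])
  fix s :: real assume "s \<notin> {0}"
  then show "indicator {0..} s * frac_kernel \<alpha> (t - s) * f s = indicator {0..} s * frac_kernel \<alpha> (t - s) * g s"
    using assms[of s] by (auto simp: indicator_def frac_kernel_def)
qed auto

text \<open>Order 1 is ordinary integration, which puts the explicit Poisson solution under the same
  operators as the fractional one.\<close>

lemma frac_int_1_FTC:
  assumes "0 \<le> t" and F: "\<And>s. 0 \<le> s \<Longrightarrow> s \<le> t \<Longrightarrow> (F has_real_derivative f s) (at s)"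
    and c: "continuous_on {0..t} f"
  shows "frac_int 1 f t = F t - F 0"
proof -
  have "frac_int 1 f t = (\<integral>s. indicator {0..t} s *\<^sub>R f s \<partial>lborel)"
    unfolding frac_int_altdef
    by (rule integral_discrete_difference[of "{t}"]) (auto simp: frac_kernel_1 indicator_def)
  also have "\<dots> = F t - F 0"
    using assms by (intro integral_FTC_Icc)
      (auto simp: has_real_derivative_iff_has_vector_derivative intro: has_vector_derivative_at_within)
  finally show ?thesis .
qed

lemma AE_exp_measure_pos: "AE x in exp_measure a. 0 < x"
proof -
  have "AE x in lborel. 0 < ennreal (exponential_density a x) \<longrightarrow> 0 < x"
    using AE_lborel_singleton[of "0::real"]
    by eventually_elim (auto simp: exponential_density_def split: if_splits)
  then show ?thesis by (simp add: AE_density)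
qed

section \<open>Laplace transform of the master equation\<close>

text \<open>\<open>lam\<close> times the forward operator of the birth-death chain with birth rate
  \<open>n + 1\<close> and death rate \<open>n\<close>.\<close>

definition rate :: "real \<Rightarrow> (nat \<Rightarrow> real) \<Rightarrow> nat \<Rightarrow> real" where
  "rate lam u n = (real n + 1) * lam * u (n + 1) - (2 * real n + 1) * lam * u n + real n * lam * u (n - 1)"

lemma rate_diff: "rate lam (\<lambda>k. u k - v k) n = rate lam u n - rate lam v n"
  by (simp add: rate_def algebra_simps)

lemma rate_bound:
  assumes "0 < lam" "\<And>k. \<bar>u k\<bar> \<le> 1"
  shows "\<bar>rate lam u n\<bar> \<le> lam * (4 * real n + 2)"
proof -
  have "\<bar>rate lam u n\<bar> \<le> \<bar>(real n + 1) * lam * u (n + 1)\<bar> + \<bar>(2 * real n + 1) * lam * u n\<bar> + \<bar>real n * lam * u (n - 1)\<bar>"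
    unfolding rate_def by linarith
  also have "\<dots> \<le> (real n + 1) * lam * 1 + (2 * real n + 1) * lam * 1 + real n * lam * 1"
    unfolding abs_mult using assms by (intro add_mono mult_mono) auto
  finally show ?thesis by (simp add: algebra_simps)
qed

text \<open>
  The recurrence says that \<open>n (D n - D (n - 1))\<close> grows by \<open>D n / \<mu>\<close>, so a nonnegative start propagates.
\<close>

lemma rate_recurrence_increasing:
  assumes "0 < \<mu>" and rec: "\<And>n. D n = rate \<mu> D n" and "0 \<le> D 0"
  shows "D 0 \<le> D n \<and> 0 \<le> real n * (D n - D (n - 1))"
proof (induction n)
  case (Suc n)
  have "(real n + 1) * (D (Suc n) - D n) = real n * (D n - D (n - 1)) + D n / \<mu>"
    using assms(1) rec[of n] unfolding rate_def by (simp add: field_simps)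
  moreover have "0 \<le> D n / \<mu>" using Suc assms by simp
  ultimately have "0 \<le> (real n + 1) * (D (Suc n) - D n)" using Suc by linarith
  moreover from this have "0 \<le> D (Suc n) - D n" by (simp add: zero_le_mult_iff)
  ultimately show ?case using Suc by (auto simp: add.commute)
qed (use assms in auto)

text \<open>A positive \<open>D 0\<close> would keep every \<open>D n\<close> above it, against the
  decay; the same holds for \<open>- D\<close>. With \<open>D 0 = 0\<close> the recurrence
  propagates zero upwards.\<close>

lemma rate_recurrence_zero:
  assumes "0 < \<mu>" and rec: "\<And>n. D n = rate \<mu> D n" and lim: "D \<longlonglongrightarrow> 0"
  shows "D n = 0"
proof -
  have le: "E 0 \<le> 0" if "\<And>n. E n = rate \<mu> E n" "E \<longlonglongrightarrow> 0" for E
  proof (rule ccontr)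
    assume *: "\<not> E 0 \<le> 0"
    then have "E 0 \<le> E n" for n
      using rate_recurrence_increasing[OF assms(1) that(1)] by auto
    then show False using LIMSEQ_le_const[OF that(2), of "E 0"] * by auto
  qed
  have "rate \<mu> (\<lambda>k. - D k) n = - rate \<mu> D n" for n
    by (simp add: rate_def algebra_simps)
  then have "- D n = rate \<mu> (\<lambda>k. - D k) n" for n
    by (subst \<open>\<And>n. rate \<mu> (\<lambda>k. - D k) n = - rate \<mu> D n\<close>) (rule arg_cong[OF rec])
  from le[of "\<lambda>k. - D k", OF this] tendsto_minus[OF lim] have "0 \<le> D 0" by simp
  with le[OF rec lim] have D0: "D 0 = 0" by simp
  \<comment> \<open>The weighted difference is carried along because the recurrence is of second
    order.\<close>
  have "D n = 0 \<and> real n * (D n - D (n - 1)) = 0" for n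
  proof (induction n)
    case (Suc n)
    have "(real n + 1) * (D (Suc n) - D n) = real n * (D n - D (n - 1)) + D n / \<mu>"
      using assms(1) rec[of n] unfolding rate_def by (simp add: field_simps)
    with Suc show ?case by auto
  qed (use D0 in auto)
  then show ?thesis by simp
qed

lemma rate_recurrence_unique:
  assumes "0 < \<mu>" and "\<And>n. P n - c n = rate \<mu> P n" "\<And>n. Q n - c n = rate \<mu> Q n" "P \<longlonglongrightarrow> 0" "Q \<longlonglongrightarrow> 0"
  shows "P = Q"
proof
  fix n
  have "P n - Q n = 0"
  proof (rule rate_recurrence_zero[OF assms(1), of "\<lambda>n. P n - Q n"])
    show "P n - Q n = rate \<mu> (\<lambda>n. P n - Q n) n" for n
      using assms(2,3)[of n] unfolding rate_diff by linarith
    show "(\<lambda>n. P n - Q n) \<longlonglongrightarrow> 0" using tendsto_diff[OF assms(4,5)] by simp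
  qed
  then show "P n = Q n" by simp
qed

text \<open>The variables are transformed one at a time: the outer operator for fixed
  \<open>y\<close>, the inner one for fixed \<open>x\<close>, with an exchange of the integrals
  before and after the second.\<close>

lemma laplace_frac_int2:
  assumes pos: "0 < \<alpha>" "0 < \<beta>" "0 < a" "0 < b"
    and r[measurable]: "case_prod r \<in> borel_measurable (borel \<Otimes>\<^sub>M borel)"
    and C: "\<And>x y. \<bar>r x y\<bar> \<le> C"
  shows "(\<integral>y. (\<integral>x. frac_int \<alpha> (\<lambda>s. frac_int \<beta> (r s) y) x \<partial>exp_measure a) \<partial>exp_measure b)
    = a powr (-\<alpha>) * b powr (-\<beta>) * (\<integral>y. (\<integral>x. r x y \<partial>exp_measure a) \<partial>exp_measure b)"
proof -
  interpret A: prob_space "exp_measure a" using pos by (intro prob_space_exponential_density)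
  interpret B: prob_space "exp_measure b" using pos by (intro prob_space_exponential_density)
  interpret P: pair_sigma_finite "exp_measure a" "exp_measure b" ..
  interpret PP: pair_prob_space "exp_measure a" "exp_measure b" ..
  have r1: "(\<lambda>y. r x y) \<in> borel_measurable borel" for x
    by measurable
  have ir: "integrable (exp_measure b) (r x)" for x
    by (rule B.integrable_const_bound[of _ C]) (use C r1 in auto)
  have irp: "integrable (exp_measure a \<Otimes>\<^sub>M exp_measure b) (case_prod r)"
    by (rule PP.integrable_const_bound[of _ C]) (use C in \<open>auto simp: case_prod_beta'\<close>)
  define c where "c = (\<lambda>x y. frac_int \<beta> (r x) y)"
  have [measurable]: "case_prod c \<in> borel_measurable (borel \<Otimes>\<^sub>M borel)"
    unfolding c_def frac_int_altdef by measurable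
  have cb: "\<bar>c x y\<bar> \<le> C * exp y" for x y
    unfolding c_def using pos C by (intro frac_int_bound) auto
  \<comment> \<open>\<open>C * exp y\<close> need not be integrable under rates
    \<open>b \<le> 1\<close>; this majorant is integrable for every \<open>b\<close> and does not
    depend on \<open>x\<close>.\<close>
  have cw: "\<bar>c x y\<bar> \<le> C * frac_int \<beta> (\<lambda>_. 1) y" for x y
  proof -
    have b: "norm ((indicator {0..} s * frac_kernel \<beta> (y - s)) * r x s) \<le> C * (indicator {0..} s * frac_kernel \<beta> (y - s))" for s
      using mult_right_mono[OF C[of x s], of "indicator {0..} s * frac_kernel \<beta> (y - s)"] pos
      by (simp add: abs_mult frac_kernel_nonneg mult.commute)
    have K: "integrable lborel (\<lambda>s. C * (indicator {0..} s * frac_kernel \<beta> (y - s)))"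
      using pos by (intro integrable_mult_right integrable_frac_kernel)
    have i: "integrable lborel (\<lambda>s. (indicator {0..} s * frac_kernel \<beta> (y - s)) * r x s)"
    proof (rule Bochner_Integration.integrable_bound[OF K])
      have [measurable]: "r x \<in> borel_measurable borel" using r1[of x] .
      show "(\<lambda>s. (indicator {0..} s * frac_kernel \<beta> (y - s)) * r x s) \<in> borel_measurable lborel" by measurable
      show "AE s in lborel. norm ((indicator {0..} s * frac_kernel \<beta> (y - s)) * r x s)
          \<le> norm (C * (indicator {0..} s * frac_kernel \<beta> (y - s)))"
        by (intro AE_I2 order.trans[OF b]) (simp only: real_norm_def abs_ge_self)
    qed
    have "\<bar>c x y\<bar> \<le> (\<integral>s. norm ((indicator {0..} s * frac_kernel \<beta> (y - s)) * r x s) \<partial>lborel)"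
      unfolding c_def frac_int_altdef
      using integral_norm_bound[of lborel "\<lambda>s. (indicator {0..} s * frac_kernel \<beta> (y - s)) * r x s"] by simp
    also have "\<dots> \<le> (\<integral>s. C * (indicator {0..} s * frac_kernel \<beta> (y - s)) \<partial>lborel)"
      by (rule integral_mono[OF integrable_norm[OF i] K b])
    finally show ?thesis by (simp add: frac_int_altdef)
  qed
  have wint: "integrable (exp_measure b) (\<lambda>y. C * frac_int \<beta> (\<lambda>_. 1) y)"
    using laplace_frac_int(1)[of \<beta> b "\<lambda>_. 1"] pos by simp
  have ic: "integrable (exp_measure a \<Otimes>\<^sub>M exp_measure b) (case_prod c)"
  proof (rule P.Fubini_integrable)
    show "case_prod c \<in> borel_measurable (exp_measure a \<Otimes>\<^sub>M exp_measure b)" by measurable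
    have icx: "integrable (exp_measure b) (c x)" for x
      unfolding c_def using pos by (intro laplace_frac_int(1) ir)
    show "AE x in exp_measure a. integrable (exp_measure b) (\<lambda>y. case (x, y) of (x, y) \<Rightarrow> c x y)"
      using icx by simp
    have "(\<integral>y. \<bar>c x y\<bar> \<partial>exp_measure b) \<le> (\<integral>y. C * frac_int \<beta> (\<lambda>_. 1) y \<partial>exp_measure b)" for x
      using icx wint cw by (intro integral_mono) auto
    then show "integrable (exp_measure a) (\<lambda>x. \<integral>y. norm (case (x, y) of (x, y) \<Rightarrow> c x y) \<partial>exp_measure b)"
      by (intro A.integrable_const_bound[of _ "\<integral>y. C * frac_int \<beta> (\<lambda>_. 1) y \<partial>exp_measure b"]) auto
  qed
  have "(\<integral>y. (\<integral>x. frac_int \<alpha> (\<lambda>s. c s y) x \<partial>exp_measure a) \<partial>exp_measure b)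
      = (\<integral>y. a powr (-\<alpha>) * (\<integral>x. c x y \<partial>exp_measure a) \<partial>exp_measure b)"
  proof (intro Bochner_Integration.integral_cong refl laplace_frac_int(2) pos)
    show "integrable (exp_measure a) (\<lambda>s. c s y)" for y
      by (rule A.integrable_const_bound[of _ "C * exp y"]) (use cb in auto)
  qed
  also have "\<dots> = a powr (-\<alpha>) * (\<integral>x. (\<integral>y. c x y \<partial>exp_measure b) \<partial>exp_measure a)"
    using P.Fubini_integral[OF ic] by simp
  also have "\<dots> = a powr (-\<alpha>) * (\<integral>x. b powr (-\<beta>) * (\<integral>y. r x y \<partial>exp_measure b) \<partial>exp_measure a)"
    unfolding c_def using pos ir by (simp add: laplace_frac_int(2))
  also have "\<dots> = a powr (-\<alpha>) * b powr (-\<beta>) * (\<integral>y. (\<integral>x. r x y \<partial>exp_measure a) \<partial>exp_measure b)"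
    using P.Fubini_integral[OF irp] by simp
  finally show ?thesis unfolding c_def .
qed

lemma laplace_master_equation:
  assumes pos: "0 < \<alpha>" "0 < \<beta>" "0 < a" "0 < b" "0 < lam"
    and u[measurable]: "\<And>n. case_prod (u n) \<in> borel_measurable (borel \<Otimes>\<^sub>M borel)"
    and u01: "\<And>n x y. 0 \<le> u n x y" "\<And>n x y. u n x y \<le> 1"
    and lim: "\<And>x y. (\<lambda>n. u n x y) \<longlonglongrightarrow> 0"
    and eq: "\<And>n x y. 0 < x \<Longrightarrow> 0 < y \<Longrightarrow>
      u n x y - (if n = 0 then 1 else 0) = frac_int \<alpha> (\<lambda>s. frac_int \<beta> (\<lambda>r. rate lam (\<lambda>k. u k s r) n) y) x"
  defines "P \<equiv> \<lambda>n. \<integral>y. (\<integral>x. u n x y \<partial>exp_measure a) \<partial>exp_measure b"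
  shows "P n - (if n = 0 then 1 else 0) = rate (lam * (a powr (-\<alpha>) * b powr (-\<beta>))) P n"
    and "P \<longlonglongrightarrow> 0"
proof -
  interpret A: prob_space "exp_measure a" using pos by (intro prob_space_exponential_density)
  interpret B: prob_space "exp_measure b" using pos by (intro prob_space_exponential_density)
  have ix: "integrable (exp_measure a) (\<lambda>x. u n x y)" for n y
    by (rule A.integrable_const_bound[of _ 1]) (use u01 in auto)
  have um: "(\<lambda>y. \<integral>x. u n x y \<partial>exp_measure a) \<in> borel_measurable borel" for n
    by measurable
  have ub: "\<bar>\<integral>x. u n x y \<partial>exp_measure a\<bar> \<le> 1" for n y
  proof -
    have "0 \<le> (\<integral>x. u n x y \<partial>exp_measure a)" using u01 by (intro integral_nonneg_AE) auto
    moreover have "(\<integral>x. u n x y \<partial>exp_measure a) \<le> 1" using u01 ix by (intro A.integral_le_const) auto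
    ultimately show ?thesis by simp
  qed
  have iy: "integrable (exp_measure b) (\<lambda>y. \<integral>x. u n x y \<partial>exp_measure a)" for n
    by (rule B.integrable_const_bound[of _ 1]) (use ub um in auto)
  have rm: "case_prod (\<lambda>s r. rate lam (\<lambda>k. u k s r) n) \<in> borel_measurable (borel \<Otimes>\<^sub>M borel)"
    unfolding rate_def by measurable
  have rb: "\<bar>rate lam (\<lambda>k. u k s r) n\<bar> \<le> lam * (4 * real n + 2)" for s r
    using u01 pos by (intro rate_bound) auto
  have "P n - (if n = 0 then 1 else 0)
      = (\<integral>y. (\<integral>x. u n x y - (if n = 0 then 1 else 0) \<partial>exp_measure a) \<partial>exp_measure b)"
    unfolding P_def using ix iy A.prob_space B.prob_space by simp
  also have "\<dots> = (\<integral>y. (\<integral>x. frac_int \<alpha> (\<lambda>s. frac_int \<beta> (\<lambda>r. rate lam (\<lambda>k. u k s r) n) y) x \<partial>exp_measure a) \<partial>exp_measure b)"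
  proof (rule integral_cong_AE)
    have [measurable]: "case_prod (\<lambda>s r. rate lam (\<lambda>k. u k s r) n) \<in> borel_measurable (borel \<Otimes>\<^sub>M borel)"
      by (rule rm)
    show m: "(\<lambda>y. \<integral>x. frac_int \<alpha> (\<lambda>s. frac_int \<beta> (\<lambda>r. rate lam (\<lambda>k. u k s r) n) y) x \<partial>exp_measure a)
        \<in> borel_measurable (exp_measure b)"
      unfolding frac_int_altdef by measurable
    have m': "(\<lambda>x. frac_int \<alpha> (\<lambda>s. frac_int \<beta> (\<lambda>r. rate lam (\<lambda>k. u k s r) n) y) x) \<in> borel_measurable borel" for y
      unfolding frac_int_altdef by measurable
    show "AE y in exp_measure b. (\<integral>x. u n x y - (if n = 0 then 1 else 0) \<partial>exp_measure a) =
       (\<integral>x. frac_int \<alpha> (\<lambda>s. frac_int \<beta> (\<lambda>r. rate lam (\<lambda>k. u k s r) n) y) x \<partial>exp_measure a)"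
      using AE_exp_measure_pos[of b]
    proof eventually_elim
      case (elim y)
      show ?case
      proof (rule integral_cong_AE)
        show "AE x in exp_measure a. u n x y - (if n = 0 then 1 else 0) =
            frac_int \<alpha> (\<lambda>s. frac_int \<beta> (\<lambda>r. rate lam (\<lambda>k. u k s r) n) y) x"
          using AE_exp_measure_pos[of a] by eventually_elim (use elim eq in auto)
      qed (use m' in auto)
    qed
  qed measurable
  also have "\<dots> = a powr (-\<alpha>) * b powr (-\<beta>) * (\<integral>y. (\<integral>x. rate lam (\<lambda>k. u k x y) n \<partial>exp_measure a) \<partial>exp_measure b)"
    by (rule laplace_frac_int2[OF pos(1-4) rm rb])
  also have "(\<integral>y. (\<integral>x. rate lam (\<lambda>k. u k x y) n \<partial>exp_measure a) \<partial>exp_measure b) = rate lam P n"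
    unfolding rate_def P_def using ix iy by simp
  finally show "P n - (if n = 0 then 1 else 0) = rate (lam * (a powr (-\<alpha>) * b powr (-\<beta>))) P n"
    by (simp add: rate_def algebra_simps)
  have "(\<lambda>n. \<integral>x. u n x y \<partial>exp_measure a) \<longlonglongrightarrow> (\<integral>x. 0 \<partial>exp_measure a)" for y
    by (rule integral_dominated_convergence[where w="\<lambda>_. 1"]) (use u01 lim in auto)
  then have "P \<longlonglongrightarrow> (\<integral>y. 0 \<partial>exp_measure b)"
    unfolding P_def
    by (intro integral_dominated_convergence[where w="\<lambda>_. 1"]) (use ub um in auto)
  then show "P \<longlonglongrightarrow> 0" by simp
qed

section \<open>Poisson weights\<close>

definition pois :: "nat \<Rightarrow> real \<Rightarrow> real" where
  "pois n x = exp (- x) * x ^ n / fact n"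

definition pois' :: "nat \<Rightarrow> real \<Rightarrow> real" where
  "pois' n x = (if n = 0 then 0 else pois (n - 1) x) - pois n x"

lemma pois_Suc: "real (Suc n) * pois (Suc n) x = x * pois n x"
proof -
  have "real (Suc n) * (exp (- x) * x ^ Suc n / (real (Suc n) * fact n)) = x * (exp (- x) * x ^ n / fact n)"
    by (simp del: of_nat_Suc)
  then show ?thesis by (simp add: pois_def)
qed

lemma pois_deriv: "(pois n has_real_derivative pois' n x) (at x)"
proof (cases n)
  case 0
  show ?thesis unfolding pois_def pois'_def 0 by (auto intro!: derivative_eq_intros)
next
  case (Suc m)
  have "((\<lambda>x. exp (- x) * x ^ Suc m / fact (Suc m)) has_real_derivative
      (- exp (- x) * x ^ Suc m + exp (- x) * (real (Suc m) * x ^ m)) / fact (Suc m)) (at x)"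
    by (auto intro!: derivative_eq_intros simp del: fact_Suc power_Suc of_nat_Suc simp: field_simps)
  also have "(- exp (- x) * x ^ Suc m + exp (- x) * (real (Suc m) * x ^ m)) / fact (Suc m) = pois' n x"
  proof -
    have "(real (Suc m) * (exp (- x) * x ^ m)) / (real (Suc m) * fact m) = exp (- x) * x ^ m / fact m"
      by (simp del: of_nat_Suc)
    then show ?thesis
      by (simp add: pois'_def pois_def Suc add_divide_distrib diff_divide_distrib mult_ac del: of_nat_Suc)
  qed
  finally show ?thesis by (simp add: pois_def[abs_def] Suc)
qed

lemma pois_mult: "x * pois' n x = real n * pois n x - (real n + 1) * pois (n + 1) x"
proof -
  have "(real n + 1) * pois (n + 1) x = x * pois n x"
    using pois_Suc[of n x] by (simp add: add.commute)
  moreover have "x * (if n = 0 then 0 else pois (n - 1) x) = real n * pois n x"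
    using pois_Suc[of "n - 1" x] by (cases n) auto
  ultimately show ?thesis by (simp add: pois'_def algebra_simps)
qed

text \<open>For \<open>z = lam * x * y\<close> the mixed derivative of a function \<open>f\<close>
  of \<open>z\<close> in \<open>x\<close> and \<open>y\<close> is \<open>lam\<close> times the
  derivative of \<open>z * f' z\<close>. By \<open>pois_mult\<close> the function differentiated
  here is \<open>x * pois' n x\<close>, so this is the master equation with both orders 1.\<close>

lemma pois_master:
  "((\<lambda>x. real n * pois n x - (real n + 1) * pois (n + 1) x) has_real_derivative rate 1 (\<lambda>k. pois k x) n) (at x)"
  by (auto intro!: derivative_eq_intros pois_deriv simp: rate_def pois'_def algebra_simps)

lemma pois_0: "pois n 0 = (if n = 0 then 1 else 0)"
  by (simp add: pois_def)

lemma pois_sums: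
  "(\<lambda>n. pois n x * z ^ n) sums exp (- x * (1 - z))"
proof -
  have "(\<lambda>n. exp (- x) * ((x * z) ^ n /\<^sub>R fact n)) sums (exp (- x) * exp (x * z))"
    by (intro sums_mult exp_converges)
  then show ?thesis by (simp add: pois_def mult_exp_exp algebra_simps power_mult_distrib divide_inverse)
qed

lemma pois_nonneg: "0 \<le> x \<Longrightarrow> 0 \<le> pois n x"
  by (simp add: pois_def)

lemma pois_sums_1: "(\<lambda>n. pois n x) sums 1"
  using pois_sums[of x 1] by simp

lemma pois_le_1: "0 \<le> x \<Longrightarrow> pois n x \<le> 1"
  using sum_le_suminf[OF sums_summable[OF pois_sums_1[of x]], of "{n}"] pois_nonneg[of x]
    sums_unique[OF pois_sums_1[of x]] by auto

lemma pois_tendsto: "(\<lambda>n. pois n x) \<longlonglongrightarrow> 0"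
  using sums_summable[OF pois_sums_1] by (rule summable_LIMSEQ_zero)

lemma pois_continuous [continuous_intros]:
  "continuous_on S f \<Longrightarrow> continuous_on S (\<lambda>x. pois n (f x))"
  unfolding pois_def by (intro continuous_intros) auto

lemma pois_measurable [measurable]: "pois n \<in> borel_measurable borel"
  by (intro borel_measurable_continuous_onI continuous_intros)

lemma rate_scale: "rate lam u n = lam * rate 1 u n"
  by (simp add: rate_def algebra_simps)

text \<open>Integrates \<open>pois_master\<close> in \<open>r\<close> with \<open>s\<close> fixed
  and then in \<open>s\<close>; clipping at 0 keeps the weights in the unit interval on the whole
  plane.\<close>

lemma pois_field_equation:
  assumes "0 < lam" "0 < x" "0 < y"
  defines "F \<equiv> \<lambda>n l m. pois n (lam * max 0 l * max 0 m)"
  shows "F n x y - (if n = 0 then 1 else 0) = frac_int 1 (\<lambda>s. frac_int 1 (\<lambda>r. rate lam (\<lambda>k. F k s r) n) y) x"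
proof -
  let ?k = "\<lambda>x. real n * pois n x - (real n + 1) * pois (n + 1) x"
  \<comment> \<open>The chain rule in \<open>r\<close> produces \<open>lam * s\<close>, hence the
    antiderivative with a quotient by the positive \<open>s\<close>; its value at
    \<open>r = 0\<close> is 0.\<close>
  have inner: "frac_int 1 (\<lambda>r. rate lam (\<lambda>k. F k s r) n) y = lam * y * pois' n (lam * s * y)" if "0 < s" for s
  proof -
    have "frac_int 1 (\<lambda>r. rate lam (\<lambda>k. F k s r) n) y = frac_int 1 (\<lambda>r. rate lam (\<lambda>k. pois k (lam * s * r)) n) y"
      using that by (intro frac_int_cong) (simp add: F_def max_absorb2)
    also have "\<dots> = ?k (lam * s * y) / s - ?k (lam * s * 0) / s"
    proof (rule frac_int_1_FTC)
      show "((\<lambda>r. ?k (lam * s * r) / s) has_real_derivative rate lam (\<lambda>k. pois k (lam * s * r)) n) (at r)" for r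
      proof -
        have "((\<lambda>r. ?k (lam * s * r)) has_real_derivative rate 1 (\<lambda>k. pois k (lam * s * r)) n * (lam * s)) (at r)"
          by (rule DERIV_chain2[OF pois_master]) (auto intro!: derivative_eq_intros)
        from DERIV_cdivide[OF this, of s] show ?thesis
          using that by (simp add: rate_scale[of lam] mult_ac)
      qed
      show "continuous_on {0..y} (\<lambda>r. rate lam (\<lambda>k. pois k (lam * s * r)) n)"
        unfolding rate_def by (intro continuous_intros)
    qed (use assms in auto)
    also have "\<dots> = lam * y * pois' n (lam * s * y)"
    proof -
      have "?k (lam * s * 0) = 0" by (simp add: pois_0)
      moreover have "?k (lam * s * y) = s * (lam * y * pois' n (lam * s * y))"
        unfolding pois_mult[symmetric] by (simp add: mult_ac)
      ultimately show ?thesis using that by simp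
    qed
    finally show ?thesis .
  qed
  have "frac_int 1 (\<lambda>s. frac_int 1 (\<lambda>r. rate lam (\<lambda>k. F k s r) n) y) x = frac_int 1 (\<lambda>s. lam * y * pois' n (lam * s * y)) x"
    by (intro frac_int_cong inner)
  also have "\<dots> = pois n (lam * x * y) - pois n (lam * 0 * y)"
  proof (rule frac_int_1_FTC)
    show "((\<lambda>s. pois n (lam * s * y)) has_real_derivative lam * y * pois' n (lam * s * y)) (at s)" for s
      by (subst mult.commute[of "lam * y"], rule DERIV_chain2[OF pois_deriv]) (auto intro!: derivative_eq_intros)
    show "continuous_on {0..x} (\<lambda>s. lam * y * pois' n (lam * s * y))"
      unfolding pois'_def by (cases "n = 0") (auto intro!: continuous_intros)
  qed (use assms in auto)
  finally show ?thesis using assms by (simp add: F_def pois_0)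
qed

section \<open>Uniqueness for the Laplace transform\<close>

text \<open>Exponential tilting: the weight only raises the rate, and \<open>a / (a + b)\<close> is
  the quotient of the two normalising constants.\<close>

lemma integral_exp_measure_shift:
  assumes "0 < a" "0 < b" and [measurable]: "h \<in> borel_measurable borel"
  shows "(\<integral>t. exp (- (b * t)) * h t \<partial>exp_measure a) = a / (a + b) * (\<integral>t. h t \<partial>exp_measure (a + b))"
proof -
  have "(\<integral>t. exp (- (b * t)) * h t \<partial>exp_measure a) = (\<integral>t. exponential_density a t * (exp (- (b * t)) * h t) \<partial>lborel)"
    using assms by (subst integral_real_density) (auto simp: exponential_density_nonneg)
  also have "\<dots> = (\<integral>t. a / (a + b) * (exponential_density (a + b) t * h t) \<partial>lborel)"
  proof (intro Bochner_Integration.integral_cong refl)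
    fix t :: real
    have "exp (- t * a) * exp (- (b * t)) = exp (- t * (a + b))"
      by (simp add: mult_exp_exp algebra_simps)
    moreover have "a + b \<noteq> 0" using assms by simp
    ultimately show "exponential_density a t * (exp (- (b * t)) * h t) = a / (a + b) * (exponential_density (a + b) t * h t)"
      by (auto simp: exponential_density_def mult.assoc[symmetric])
  qed
  also have "\<dots> = a / (a + b) * (\<integral>t. exponential_density (a + b) t * h t \<partial>lborel)"
    by (rule integral_mult_right_zero)
  also have "(\<integral>t. exponential_density (a + b) t * h t \<partial>lborel) = (\<integral>t. h t \<partial>exp_measure (a + b))"
    using assms by (subst integral_real_density) (auto simp: exponential_density_nonneg)
  finally show ?thesis .
qed

text \<open>Integrals against powers of \<open>exp (- t)\<close> are Laplace transforms at shifted
  rates, so they vanish; by Weierstrass on \<open>{0..1}\<close> polynomials approximate \<phi>, and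
  the error is at most \<open>e * C\<close>.\<close>

lemma laplace_zero_imp_weighted_zero:
  fixes h :: "real \<Rightarrow> real"
  assumes [measurable]: "h \<in> borel_measurable borel" and C: "\<And>t. \<bar>h t\<bar> \<le> C"
    and zero: "\<And>a. 0 < a \<Longrightarrow> (\<integral>t. h t \<partial>exp_measure a) = 0"
    and c: "continuous_on UNIV \<phi>"
  shows "(\<integral>t. \<phi> (exp (- t)) * h t \<partial>exp_measure 1) = 0"
proof -
  interpret E: prob_space "exp_measure 1" by (intro prob_space_exponential_density) simp
  have C0: "0 \<le> C" using C[of 0] by linarith
  have [measurable]: "\<phi> \<in> borel_measurable borel" using c by (rule borel_measurable_continuous_onI)
  \<comment> \<open>The case \<open>k = 0\<close> is apart because the tilting lemma wants a
    positive shift.\<close>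
  have pw: "(\<integral>t. exp (- t) ^ k * h t \<partial>exp_measure 1) = 0" for k
  proof (cases "k = 0")
    case False
    then show ?thesis using integral_exp_measure_shift[of 1 "real k" h] zero[of "1 + real k"]
      by (simp flip: exp_of_nat_mult)
  qed (use zero[of 1] in simp)
  have ipw: "integrable (exp_measure 1) (\<lambda>t. exp (- t) ^ k * h t)" for k
  proof (rule E.integrable_const_bound[of _ C])
    show "AE t in exp_measure 1. norm (exp (- t) ^ k * h t) \<le> C"
      using AE_exp_measure_pos[of 1]
    proof eventually_elim
      case (elim t)
      then have "exp (- t) ^ k \<le> 1" by (intro power_le_one) auto
      then show ?case using mult_mono[of "exp (- t) ^ k" 1 "\<bar>h t\<bar>" C] C[of t] by (simp add: abs_mult)
    qed
  qed measurable
  have small: "\<bar>\<integral>t. \<phi> (exp (- t)) * h t \<partial>exp_measure 1\<bar> \<le> e * C" if e: "0 < e" for e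
  proof -
    obtain g where "real_polynomial_function g" and g: "\<And>x. x \<in> {0..1} \<Longrightarrow> \<bar>\<phi> x - g x\<bar> < e"
      using Stone_Weierstrass_real_polynomial_function[of "{0..1::real}" \<phi> e] e continuous_on_subset[OF c] by auto
    then obtain q n where q: "g = (\<lambda>x. \<Sum>i\<le>n. q i * x ^ i)"
      by (auto simp: real_polynomial_function_iff_sum)
    have gh: "g (exp (- t)) * h t = (\<Sum>i\<le>n. q i * (exp (- t) ^ i * h t))" for t
      by (simp add: q sum_distrib_right mult.assoc)
    have ig: "integrable (exp_measure 1) (\<lambda>t. g (exp (- t)) * h t)"
      unfolding gh by (intro Bochner_Integration.integrable_sum integrable_mult_right ipw)
    have g0: "(\<integral>t. g (exp (- t)) * h t \<partial>exp_measure 1) = 0"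
      unfolding gh using ipw pw by (subst Bochner_Integration.integral_sum) auto
    have b: "AE t in exp_measure 1. norm (\<phi> (exp (- t)) * h t - g (exp (- t)) * h t) \<le> e * C"
      using AE_exp_measure_pos[of 1]
    proof eventually_elim
      case (elim t)
      then have "\<bar>\<phi> (exp (- t)) - g (exp (- t))\<bar> \<le> e" using g[of "exp (- t)"] by auto
      from mult_mono[OF this C[of t]] show ?case using e by (simp add: abs_mult left_diff_distrib[symmetric])
    qed
    have [measurable]: "g \<in> borel_measurable borel" unfolding q by measurable
    have id: "integrable (exp_measure 1) (\<lambda>t. \<phi> (exp (- t)) * h t - g (exp (- t)) * h t)"
      by (rule E.integrable_const_bound[OF b]) measurable
    have "(\<integral>t. \<phi> (exp (- t)) * h t \<partial>exp_measure 1)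
       = (\<integral>t. (\<phi> (exp (- t)) * h t - g (exp (- t)) * h t) + g (exp (- t)) * h t \<partial>exp_measure 1)"
      by simp
    also have "\<dots> = (\<integral>t. \<phi> (exp (- t)) * h t - g (exp (- t)) * h t \<partial>exp_measure 1)"
      using id ig g0 by (subst Bochner_Integration.integral_add) auto
    also have "\<bar>\<dots>\<bar> \<le> (\<integral>t. norm (\<phi> (exp (- t)) * h t - g (exp (- t)) * h t) \<partial>exp_measure 1)"
      unfolding real_norm_def[symmetric] by (rule integral_norm_bound)
    also have "\<dots> \<le> e * C"
      using b id by (intro E.integral_le_const) auto
    finally show ?thesis .
  qed
  have "\<bar>\<integral>t. \<phi> (exp (- t)) * h t \<partial>exp_measure 1\<bar> \<le> 0"
  proof (rule field_le_epsilon)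
    fix e :: real assume "0 < e"
    \<comment> \<open>\<open>C + 1\<close> because \<open>C\<close> may be 0.\<close>
    have "e / (C + 1) * C \<le> e" using C0 \<open>0 < e\<close> by (simp add: field_simps)
    with small[of "e / (C + 1)"] C0 \<open>0 < e\<close> show "\<bar>\<integral>t. \<phi> (exp (- t)) * h t \<partial>exp_measure 1\<bar> \<le> 0 + e" by simp
  qed
  then show ?thesis by simp
qed

text \<open>
  Substituting \<open>x = exp (- t)\<close> makes the Laplace transform at the integers a moment sequence on the unit
  interval. Left continuity of the paths of an inverse subordinator is immediate from the infimum,
  whereas continuity would need strict monotonicity of the subordinator.
\<close>

lemma laplace_zero_left_continuous:
  fixes h :: "real \<Rightarrow> real"
  assumes [measurable]: "h \<in> borel_measurable borel" and C: "\<And>t. \<bar>h t\<bar> \<le> C"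
    and zero: "\<And>a. 0 < a \<Longrightarrow> (\<integral>t. h t \<partial>exp_measure a) = 0"
    and left: "(h \<longlongrightarrow> h t) (at_left t)" and "0 < t"
  shows "h t = 0"
proof -
  interpret E: prob_space "exp_measure 1" by (intro prob_space_exponential_density) simp
  \<comment> \<open>Stated for general \<open>g\<close> so that it applies to \<open>h\<close> and
    to \<open>- h\<close>: a positive value at \<open>t\<close> would persist on an interval to the
    left of \<open>t\<close>.\<close>
  have le: "g t \<le> 0" if [measurable]: "g \<in> borel_measurable borel" and C: "\<And>t. \<bar>g t\<bar> \<le> C"
    and zero: "\<And>a. 0 < a \<Longrightarrow> (\<integral>t. g t \<partial>exp_measure a) = 0"
    and left: "(g \<longlongrightarrow> g t) (at_left t)" for g :: "real \<Rightarrow> real"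
  proof (rule ccontr)
    assume "\<not> g t \<le> 0"
    then have "\<forall>\<^sub>F x in at_left t. 0 < g x" using left by (intro order_tendstoD) auto
    then obtain b where b: "b < t" "\<And>y. b < y \<Longrightarrow> y < t \<Longrightarrow> 0 < g y"
      unfolding eventually_at_left_field by blast
    \<comment> \<open>Raised to at least 0, so that the exponential density is positive on the whole
      interval from \<open>r\<close> to \<open>t\<close>.\<close>
    define r where "r = max b 0"
    have r: "0 \<le> r" "r < t" "\<And>y. r < y \<Longrightarrow> y < t \<Longrightarrow> 0 < g y"
      using b assms by (auto simp: r_def)
    \<comment> \<open>A bump in the variable \<open>exp (- y)\<close>, positive exactly for
      \<open>y\<close> strictly between \<open>r\<close> and \<open>t\<close>.\<close>
    define \<phi> where "\<phi> = (\<lambda>x. max 0 ((x - exp (- t)) * (exp (- r) - x)))"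
    have c: "continuous_on UNIV \<phi>" unfolding \<phi>_def by (intro continuous_intros)
    have [measurable]: "\<phi> \<in> borel_measurable borel" using c by (rule borel_measurable_continuous_onI)
    have pos: "0 < \<phi> (exp (- y))" if "r < y" "y < t" for y
      using that by (simp add: \<phi>_def)
    have nul: "\<phi> (exp (- y)) = 0" if "\<not> (r < y \<and> y < t)" for y
    proof -
      have "(exp (- y) - exp (- t)) * (exp (- r) - exp (- y)) \<le> 0"
        using that r by (auto simp: mult_le_0_iff not_less)
      then show ?thesis by (simp add: \<phi>_def)
    qed
    have nn: "0 \<le> \<phi> (exp (- y)) * g y" for y
      using pos[of y] nul[of y] r(3)[of y] by (cases "r < y \<and> y < t") auto
    have b1: "\<phi> x \<le> 1" if "x \<in> {0..1}" for x
    proof -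
      have "\<bar>x - exp (- t)\<bar> * \<bar>exp (- r) - x\<bar> \<le> 1 * 1"
      proof (intro mult_mono)
        have "exp (- t) \<le> 1" "exp (- r) \<le> 1" "0 < exp (- t)" "0 < exp (- r)" using r by auto
        then show "\<bar>x - exp (- t)\<bar> \<le> 1" "\<bar>exp (- r) - x\<bar> \<le> 1"
          using that unfolding atLeastAtMost_iff by linarith+
      qed auto
      then show ?thesis by (auto simp: \<phi>_def abs_mult[symmetric])
    qed
    have int: "integrable (exp_measure 1) (\<lambda>y. \<phi> (exp (- y)) * g y)"
    proof (rule E.integrable_const_bound[of _ C])
      show "AE y in exp_measure 1. norm (\<phi> (exp (- y)) * g y) \<le> C"
        using AE_exp_measure_pos[of 1]
      proof eventually_elim
        case (elim y)
        then have "\<phi> (exp (- y)) \<le> 1" using b1[of "exp (- y)"] by simp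
        moreover have "0 \<le> \<phi> (exp (- y))" by (simp add: \<phi>_def)
        ultimately show ?case using mult_mono[of "\<phi> (exp (- y))" 1 "\<bar>g y\<bar>" C] C[of y] by (simp add: abs_mult)
      qed
    qed measurable
    have "(\<integral>y. \<phi> (exp (- y)) * g y \<partial>exp_measure 1) = 0"
      by (rule laplace_zero_imp_weighted_zero[OF _ C zero c]) auto
    then have "AE y in exp_measure 1. \<phi> (exp (- y)) * g y = 0"
      using int nn by (subst (asm) integral_nonneg_eq_0_iff_AE) auto
    then have "AE y in lborel. 0 < ennreal (exponential_density 1 y) \<longrightarrow> \<phi> (exp (- y)) * g y = 0"
      by (subst (asm) AE_density) auto
    then have "AE y in lborel. y \<notin> {r<..<t}"
    proof eventually_elim
      case (elim y)
      then show ?case using pos[of y] r(3)[of y] r(1) by (auto simp: exponential_density_def)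
    qed
    then have "{r<..<t} \<in> null_sets lborel"
      by (subst AE_iff_null_sets) auto
    then show False using r by (simp add: null_sets_def)
  qed
  have "h t \<le> 0" by (rule le) (use assms in auto)
  moreover have "- h t \<le> 0"
    by (rule le[of "\<lambda>t. - h t"]) (use assms in \<open>auto intro: tendsto_minus\<close>)
  ultimately show ?thesis by simp
qed

section \<open>Inverse stable subordinators at exponential times\<close>

lemma emeasure_exp_measure_greaterThan:
  assumes "0 < a" "0 \<le> h"
  shows "emeasure (exp_measure a) {h<..} = ennreal (exp (- (a * h)))"
proof -
  interpret E: prob_space "exp_measure a" using assms by (intro prob_space_exponential_density)
  have "{h<..} = space (exp_measure a) - {..h}" by auto
  then have "emeasure (exp_measure a) {h<..} = emeasure (exp_measure a) (space (exp_measure a) - {..h})" by simp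
  also have "\<dots> = 1 - emeasure (exp_measure a) {..h}"
    by (subst emeasure_compl) (use E.emeasure_space_1 in auto)
  also have "\<dots> = ennreal 1 - ennreal (1 - exp (- (a * h)))"
    using assms by (simp add: emeasure_erlang_density erlang_CDF_0)
  also have "\<dots> = ennreal (1 - (1 - exp (- (a * h))))"
    using assms by (subst ennreal_minus) auto
  finally show ?thesis by simp
qed

lemma inverse_stable_subordinator_measurable:
  "inverse_stable_subordinator M \<alpha> L \<Longrightarrow> 0 \<le> t \<Longrightarrow> L t \<in> borel_measurable M"
  unfolding inverse_stable_subordinator_def by blast

text \<open>The infimum is informative only over a non-empty set, so \<open>H\<close> must be
  unbounded almost surely: Chernoff's bound at \<open>u = 1\<close> makes the probability of
  \<open>H k < n\<close> at most \<open>exp (n - k)\<close>. The two implications then express the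
  infimum without reference to it.\<close>

lemma inverse_stable_subordinator_paths:
  assumes "inverse_stable_subordinator M \<alpha> L"
  obtains H where "stable_subordinator M \<alpha> H"
    and "\<And>t. 0 \<le> t \<Longrightarrow> L t \<in> borel_measurable M"
    and "AE \<omega> in M. H 0 \<omega> = 0 \<and> mono_on {0..} (\<lambda>t. H t \<omega>) \<and>
          (\<forall>t\<ge>0. 0 \<le> L t \<omega> \<and> (\<forall>s\<ge>0. (s < L t \<omega> \<longrightarrow> H s \<omega> < t) \<and> (H s \<omega> < t \<longrightarrow> s \<le> L t \<omega>)))"
proof -
  obtain H where H: "stable_subordinator M \<alpha> H"
    and L: "\<And>t \<omega>. 0 \<le> t \<Longrightarrow> \<omega> \<in> space M \<Longrightarrow> L t \<omega> = Inf {s. 0 \<le> s \<and> t \<le> H s \<omega>}"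
    using assms unfolding inverse_stable_subordinator_def by blast
  have Lm: "L t \<in> borel_measurable M" if "0 \<le> t" for t
    using assms that by (rule inverse_stable_subordinator_measurable)
  interpret prob_space M using H unfolding stable_subordinator_def levy_process_def by blast
  have Hm[measurable]: "H t \<in> borel_measurable M" if "0 \<le> t" for t
    using H that unfolding stable_subordinator_def levy_process_def by blast
  have lap: "expectation (\<lambda>\<omega>. exp (- u * H t \<omega>)) = exp (- t * u powr \<alpha>)" if "0 \<le> t" "0 < u" for t u
    using H that unfolding stable_subordinator_def by blast
  have small: "prob {\<omega> \<in> space M. H (real k) \<omega> < real n} \<le> exp (real n - real k)" for n k
  proof -
    \<comment> \<open>Otherwise the Bochner integral would be 0, against the strictly positive
      Laplace transform.\<close>
    have i: "integrable M (\<lambda>\<omega>. exp (- 1 * H (real k) \<omega>))"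
    proof (rule ccontr)
      assume "\<not> ?thesis"
      from not_integrable_integral_eq[OF this] lap[of "real k" 1] show False by simp
    qed
    have "prob {\<omega> \<in> space M. H (real k) \<omega> < real n} = expectation (indicator {\<omega> \<in> space M. H (real k) \<omega> < real n})"
      by simp
    also have "\<dots> \<le> expectation (\<lambda>\<omega>. exp (real n) * exp (- 1 * H (real k) \<omega>))"
    proof (rule integral_mono)
      have [measurable]: "H (real k) \<in> borel_measurable M" by (rule Hm) simp
      show "integrable M (indicator {\<omega> \<in> space M. H (real k) \<omega> < real n} :: _ \<Rightarrow> real)"
        by (rule integrable_const_bound[of _ 1]) (auto simp: indicator_def)
      show "integrable M (\<lambda>\<omega>. exp (real n) * exp (- 1 * H (real k) \<omega>))"
        using i by (rule integrable_mult_right)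
    qed (auto simp: indicator_def mult_exp_exp)
    also have "\<dots> = exp (real n) * expectation (\<lambda>\<omega>. exp (- 1 * H (real k) \<omega>))"
      by (rule integral_mult_right_zero)
    also have "\<dots> = exp (real n - real k)"
      using lap[of "real k" 1] by (simp add: mult_exp_exp)
    finally show ?thesis .
  qed
  have unb: "AE \<omega> in M. \<exists>k. real n \<le> H (real k) \<omega>" for n
  proof -
    let ?A = "{\<omega> \<in> space M. \<forall>k. H (real k) \<omega> < real n}"
    have le: "prob ?A \<le> exp (real n - real k)" for k
      by (rule order.trans[OF finite_measure_mono small[of k n]]) auto
    have "(\<lambda>k. exp (real n) * exp (- 1) ^ k) \<longlonglongrightarrow> exp (real n) * 0"
      by (intro tendsto_intros LIMSEQ_realpow_zero) auto
    moreover have "exp (real n) * exp (- 1) ^ k = exp (real n - real k)" for k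
      by (simp add: mult_exp_exp flip: exp_of_nat_mult)
    ultimately have "(\<lambda>k. exp (real n - real k)) \<longlonglongrightarrow> 0" by simp
    then have "prob ?A \<le> 0" by (rule LIMSEQ_le_const) (use le in auto)
    then have "prob ?A = 0" by (simp add: measure_le_0_iff)
    then have "AE \<omega> in M. \<not> (\<forall>k. H (real k) \<omega> < real n)"
      by (subst AE_iff_measurable[OF _ refl]) (auto simp: emeasure_eq_measure)
    then show ?thesis by (auto simp: not_less)
  qed
  have good: "AE \<omega> in M. H 0 \<omega> = 0 \<and> mono_on {0..} (\<lambda>t. H t \<omega>) \<and>
          (\<forall>t\<ge>0. 0 \<le> L t \<omega> \<and> (\<forall>s\<ge>0. (s < L t \<omega> \<longrightarrow> H s \<omega> < t) \<and> (H s \<omega> < t \<longrightarrow> s \<le> L t \<omega>)))"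
  proof -
    have "AE \<omega> in M. H 0 \<omega> = 0" "AE \<omega> in M. mono_on {0..} (\<lambda>t. H t \<omega>)"
      using H unfolding stable_subordinator_def levy_process_def by blast+
    moreover have "AE \<omega> in M. \<forall>n. \<exists>k. real n \<le> H (real k) \<omega>"
      using unb by (simp add: AE_all_countable)
    ultimately show ?thesis using AE_space
    proof eventually_elim
      case (elim \<omega>)
      have "0 \<le> L t \<omega> \<and> (\<forall>s\<ge>0. (s < L t \<omega> \<longrightarrow> H s \<omega> < t) \<and> (H s \<omega> < t \<longrightarrow> s \<le> L t \<omega>))" if t: "0 \<le> t" for t
      proof -
        let ?S = "{s. 0 \<le> s \<and> t \<le> H s \<omega>}"
        obtain n where "t \<le> real n" using real_arch_simple by blast
        moreover obtain k where "real n \<le> H (real k) \<omega>" using elim by blast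
        ultimately have ne: "?S \<noteq> {}" by (auto intro!: exI[of _ "real k"])
        have bd: "bdd_below ?S" by (intro bdd_belowI[of _ 0]) auto
        have "0 \<le> L t \<omega>" unfolding L[OF t elim(4)] using ne by (intro cInf_greatest) auto
        moreover have "H s \<omega> < t" if "0 \<le> s" "s < L t \<omega>" for s
          using that cInf_lower[OF _ bd, of s] unfolding L[OF t elim(4)] by force
        moreover have "s \<le> L t \<omega>" if "0 \<le> s" "H s \<omega> < t" for s
          unfolding L[OF t elim(4)]
        proof (rule cInf_greatest[OF ne])
          fix x assume x: "x \<in> ?S"
          show "s \<le> x"
          proof (rule ccontr)
            assume "\<not> s \<le> x"
            then have "H x \<omega> \<le> H s \<omega>" using mono_onD[OF elim(2), of x s] x that by simp
            with x that show False by auto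
          qed
        qed
        ultimately show ?thesis by auto
      qed
      then show ?case using elim by blast
    qed
  qed
  show ?thesis by (rule that[OF H Lm good])
qed

text \<open>Purely deterministic: the two implications form a weak Galois connection between
  \<open>h\<close> and \<open>l\<close>. For left continuity, a level \<open>s\<close> just below
  \<open>l t\<close> has \<open>h s < t\<close>, so every positive \<open>x\<close> between
  \<open>h s\<close> and \<open>t\<close> satisfies \<open>s \<le> l x\<close>.\<close>

lemma first_passage_path:
  fixes l h :: "real \<Rightarrow> real"
  assumes h0: "h 0 = 0" and nn: "\<And>t. 0 \<le> t \<Longrightarrow> 0 \<le> l t"
    and less: "\<And>s t. 0 \<le> t \<Longrightarrow> 0 \<le> s \<Longrightarrow> s < l t \<Longrightarrow> h s < t"
    and ge: "\<And>s t. 0 \<le> t \<Longrightarrow> 0 \<le> s \<Longrightarrow> h s < t \<Longrightarrow> s \<le> l t"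
  shows first_passage_0: "l 0 = 0"
    and first_passage_mono: "mono_on {0..} l"
    and first_passage_left: "0 < t \<Longrightarrow> (l \<longlongrightarrow> l t) (at_left t)"
proof -
  show "l 0 = 0" using less[of 0 0] nn[of 0] h0 by fastforce
  show mono: "mono_on {0..} l"
  proof (rule mono_onI)
    fix t t' :: real assume t: "t \<in> {0..}" "t' \<in> {0..}" "t \<le> t'"
    show "l t \<le> l t'"
    proof (rule dense_le)
      fix s assume s: "s < l t"
      show "s \<le> l t'"
      proof (cases "0 \<le> s")
        case True
        then have "h s < t'" using less[of t s] s t by auto
        then show ?thesis using ge[of t' s] True t by auto
      next
        case False
        then show ?thesis using nn[of t'] t by auto
      qed
    qed
  qed
  assume t: "0 < t"
  have ev0: "\<forall>\<^sub>F x in at_left t. 0 < x \<and> x < t"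
    unfolding eventually_at_left_field using t by auto
  show "(l \<longlongrightarrow> l t) (at_left t)"
  proof (rule order_tendstoI)
    fix y assume y: "y < l t"
    show "\<forall>\<^sub>F x in at_left t. y < l x"
    proof (cases "0 \<le> y")
      case True
      \<comment> \<open>Strictly between \<open>y\<close> and \<open>l t\<close>, since the
        connection yields only \<open>s \<le> l x\<close> while \<open>y < l x\<close> is
        wanted.\<close>
      define s where "s = (y + l t) / 2"
      have s: "y < s" "s < l t" "0 \<le> s" using y True by (auto simp: s_def)
      then have "h s < t" using less[of t s] t by auto
      then have "\<forall>\<^sub>F x in at_left t. h s < x" unfolding eventually_at_left_field by auto
      with ev0 show ?thesis
      proof eventually_elim
        case (elim x)
        then show ?case using ge[of x s] s by auto
      qed
    next
      case False
      from ev0 show ?thesis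
      proof eventually_elim
        case (elim x)
        then show ?case using nn[of x] False by auto
      qed
    qed
  next
    fix y assume y: "l t < y"
    from ev0 show "\<forall>\<^sub>F x in at_left t. l x < y"
    proof eventually_elim
      case (elim x)
      then show ?case using mono_onD[OF mono, of x t] y t by auto
    qed
  qed
qed

lemma inverse_stable_subordinator_facts:
  assumes "inverse_stable_subordinator M \<alpha> L"
  shows inverse_stable_subordinator_nonneg: "AE \<omega> in M. \<forall>t\<ge>0. 0 \<le> L t \<omega>"
    and inverse_stable_subordinator_0: "AE \<omega> in M. L 0 \<omega> = 0"
    and inverse_stable_subordinator_mono: "AE \<omega> in M. mono_on {0..} (\<lambda>t. L t \<omega>)"
    and inverse_stable_subordinator_left: "AE \<omega> in M. \<forall>t>0. ((\<lambda>t. L t \<omega>) \<longlongrightarrow> L t \<omega>) (at_left t)"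
proof -
  obtain H where good: "AE \<omega> in M. H 0 \<omega> = 0 \<and> mono_on {0..} (\<lambda>t. H t \<omega>) \<and>
          (\<forall>t\<ge>0. 0 \<le> L t \<omega> \<and> (\<forall>s\<ge>0. (s < L t \<omega> \<longrightarrow> H s \<omega> < t) \<and> (H s \<omega> < t \<longrightarrow> s \<le> L t \<omega>)))"
    by (rule inverse_stable_subordinator_paths[OF assms])
  show "AE \<omega> in M. \<forall>t\<ge>0. 0 \<le> L t \<omega>" using good by eventually_elim blast
  show "AE \<omega> in M. L 0 \<omega> = 0"
    using good by eventually_elim (rule first_passage_0[where h="\<lambda>s. H s _" and l="\<lambda>s. L s _"]; blast)
  show "AE \<omega> in M. mono_on {0..} (\<lambda>t. L t \<omega>)"
    using good by eventually_elim (rule first_passage_mono[where h="\<lambda>s. H s _"]; blast)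
  show "AE \<omega> in M. \<forall>t>0. ((\<lambda>t. L t \<omega>) \<longlongrightarrow> L t \<omega>) (at_left t)"
    using good
  proof eventually_elim
    case (elim \<omega>)
    show ?case
    proof (intro allI impI)
      fix t :: real assume "0 < t"
      then show "((\<lambda>t. L t \<omega>) \<longlongrightarrow> L t \<omega>) (at_left t)"
        by (rule first_passage_left[where h="\<lambda>s. H s \<omega>", rotated -1]) (use elim in blast)+
    qed
  qed
qed

text \<open>\<open>L\<close> is unspecified at negative times, so the kernel clips the time at \<open>0\<close>.\<close>

definition law_kernel :: "'b measure \<Rightarrow> (real \<Rightarrow> 'b \<Rightarrow> real) \<Rightarrow> real \<Rightarrow> real measure" where
  "law_kernel M L t = distr M borel (L (max 0 t))"

text \<open>It is enough to test the half-lines \<open>{s<..}\<close>, and their probabilities are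
  monotone in time because the paths are.\<close>

lemma law_kernel_measurable:
  assumes "inverse_stable_subordinator M \<alpha> L" "prob_space M"
  shows "law_kernel M L \<in> borel \<rightarrow>\<^sub>M prob_algebra borel"
proof -
  interpret prob_space M by fact
  have Lm[measurable]: "L (max 0 t) \<in> borel_measurable M" for t
    using assms(1) by (rule inverse_stable_subordinator_measurable) simp
  show ?thesis
  proof (rule measurable_prob_algebra_generated[where G="range greaterThan" and \<Omega>=UNIV])
    show "sets borel = sigma_sets UNIV (range greaterThan :: real set set)"
      by (subst borel_Ioi) (simp add: sets_measure_of)
    show "Int_stable (range greaterThan :: real set set)"
    proof (rule Int_stableI)
      fix a b :: "real set" assume "a \<in> range greaterThan" "b \<in> range greaterThan"
      then obtain x y where "a = {x<..}" "b = {y<..}" by blast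
      then have "a \<inter> b = {max x y<..}" by auto
      then show "a \<inter> b \<in> range greaterThan" by (rule range_eqI)
    qed
    show "prob_space (law_kernel M L t)" for t
      unfolding law_kernel_def by (intro prob_space_distr) measurable
    show "sets (law_kernel M L t) = sets borel" for t by (simp add: law_kernel_def)
    fix A :: "real set" assume "A \<in> range greaterThan"
    then obtain s where A: "A = {s<..}" by auto
    have e: "emeasure (law_kernel M L t) A = ennreal (prob {\<omega> \<in> space M. s < L (max 0 t) \<omega>})" for t
    proof -
      have "L (max 0 t) -` {s<..} \<inter> space M = {\<omega> \<in> space M. s < L (max 0 t) \<omega>}" by auto
      then show ?thesis unfolding law_kernel_def A by (subst emeasure_distr) (auto simp: emeasure_eq_measure)
    qed
    have "mono (\<lambda>t. prob {\<omega> \<in> space M. s < L (max 0 t) \<omega>})"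
    proof (rule monoI)
      fix t t' :: real assume "t \<le> t'"
      show "prob {\<omega> \<in> space M. s < L (max 0 t) \<omega>} \<le> prob {\<omega> \<in> space M. s < L (max 0 t') \<omega>}"
      proof (rule finite_measure_mono_AE)
        show "AE \<omega> in M. \<omega> \<in> {\<omega> \<in> space M. s < L (max 0 t) \<omega>} \<longrightarrow> \<omega> \<in> {\<omega> \<in> space M. s < L (max 0 t') \<omega>}"
          using inverse_stable_subordinator_mono[OF assms(1)]
        proof eventually_elim
          case (elim \<omega>)
          have "L (max 0 t) \<omega> \<le> L (max 0 t') \<omega>" using \<open>t \<le> t'\<close> by (intro mono_onD[OF elim]) auto
          then show ?case by auto
        qed
      qed measurable
    qed
    then have [measurable]: "(\<lambda>t. prob {\<omega> \<in> space M. s < L (max 0 t) \<omega>}) \<in> borel_measurable borel"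
      by (rule borel_measurable_mono)
    show "(\<lambda>t. emeasure (law_kernel M L t) A) \<in> borel_measurable borel"
      unfolding e by measurable
  qed (simp_all)
qed

text \<open>
  Only \<open>{s < L t} \<subseteq> {H s < t} \<subseteq> {s \<le> L t}\<close> holds almost surely, since \<open>H\<close> need not be right continuous; the
  continuity of the exponential tail closes the gap.
\<close>

lemma law_kernel_bind:
  assumes inv: "inverse_stable_subordinator M \<alpha> L" and "prob_space M" and a: "0 < a"
  shows "exp_measure a \<bind> law_kernel M L = exp_measure (a powr \<alpha>)"
proof -
  interpret prob_space M by fact
  interpret E: prob_space "exp_measure a" using a by (intro prob_space_exponential_density)
  define A where "A = a powr \<alpha>"
  have A: "0 < A" using a by (simp add: A_def)
  interpret EA: prob_space "exp_measure A" using A by (intro prob_space_exponential_density)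
  obtain H where H: "stable_subordinator M \<alpha> H"
    and good: "AE \<omega> in M. H 0 \<omega> = 0 \<and> mono_on {0..} (\<lambda>t. H t \<omega>) \<and>
          (\<forall>t\<ge>0. 0 \<le> L t \<omega> \<and> (\<forall>s\<ge>0. (s < L t \<omega> \<longrightarrow> H s \<omega> < t) \<and> (H s \<omega> < t \<longrightarrow> s \<le> L t \<omega>)))"
    by (rule inverse_stable_subordinator_paths[OF inv])
  have Lm[measurable]: "L (max 0 t) \<in> borel_measurable M" for t
    using inv by (rule inverse_stable_subordinator_measurable) simp
  have Hm: "H t \<in> borel_measurable M" if "0 \<le> t" for t
    using H that unfolding stable_subordinator_def levy_process_def by blast
  have lap: "expectation (\<lambda>\<omega>. exp (- u * H t \<omega>)) = exp (- t * u powr \<alpha>)" if "0 \<le> t" "0 < u" for t u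
    using H that unfolding stable_subordinator_def by blast
  note K[measurable] = law_kernel_measurable[OF inv assms(2)]
  have Ea: "exp_measure a \<in> space (prob_algebra borel)"
    using E.prob_space_axioms by (simp add: space_prob_algebra)
  define B where "B = exp_measure a \<bind> law_kernel M L"
  interpret B: prob_space B unfolding B_def by (rule prob_space_bind'[OF Ea K])
  have setsB[measurable_cong]: "sets B = sets borel" unfolding B_def by (rule sets_bind'[OF Ea K])
  have spB: "space B = UNIV" using sets_eq_imp_space_eq[OF setsB] by simp
  have Ke: "emeasure (law_kernel M L t) S = emeasure M {\<omega> \<in> space M. L (max 0 t) \<omega> \<in> S}" if "S \<in> sets borel" for t S
  proof -
    have "L (max 0 t) -` S \<inter> space M = {\<omega> \<in> space M. L (max 0 t) \<omega> \<in> S}" by auto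
    then show ?thesis unfolding law_kernel_def using that by (subst emeasure_distr) auto
  qed
  have Be: "emeasure B S = (\<integral>\<^sup>+t. emeasure M {\<omega> \<in> space M. L (max 0 t) \<omega> \<in> S} \<partial>exp_measure a)" if "S \<in> sets borel" for S
    unfolding B_def using emeasure_bind_prob_algebra[OF Ea K that] by (simp add: Ke that)
  \<comment> \<open>By Fubini this is the probability that an independent exponential time of rate
    \<open>a\<close> exceeds \<open>H s\<close>, that is, the Laplace transform of
    \<open>H s\<close> at \<open>a\<close>.\<close>
  have mid: "(\<integral>\<^sup>+t. emeasure M {\<omega> \<in> space M. H s \<omega> < t} \<partial>exp_measure a) = ennreal (exp (- (s * A)))" if s: "0 \<le> s" for s
  proof -
    interpret P: pair_sigma_finite "exp_measure a" M ..
    have [measurable]: "H s \<in> borel_measurable M" using Hm s by simp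
    have "(\<integral>\<^sup>+t. emeasure M {\<omega> \<in> space M. H s \<omega> < t} \<partial>exp_measure a)
       = (\<integral>\<^sup>+t. (\<integral>\<^sup>+\<omega>. indicator {H s \<omega><..} t \<partial>M) \<partial>exp_measure a)"
    proof (rule nn_integral_cong)
      fix t :: real
      have "emeasure M {\<omega> \<in> space M. H s \<omega> < t} = (\<integral>\<^sup>+\<omega>. indicator {\<omega> \<in> space M. H s \<omega> < t} \<omega> \<partial>M)"
        by (rule nn_integral_indicator[symmetric]) measurable
      also have "\<dots> = (\<integral>\<^sup>+\<omega>. indicator {H s \<omega><..} t \<partial>M)"
        by (intro nn_integral_cong) (auto simp: indicator_def)
      finally show "emeasure M {\<omega> \<in> space M. H s \<omega> < t} = (\<integral>\<^sup>+\<omega>. indicator {H s \<omega><..} t \<partial>M)" .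
    qed
    also have "\<dots> = (\<integral>\<^sup>+\<omega>. (\<integral>\<^sup>+t. indicator {H s \<omega><..} t \<partial>exp_measure a) \<partial>M)"
      unfolding indicator_def greaterThan_iff by (rule P.Fubini'[symmetric]) measurable
    also have "\<dots> = (\<integral>\<^sup>+\<omega>. ennreal (exp (- a * H s \<omega>)) \<partial>M)"
    proof (rule nn_integral_cong_AE)
      show "AE \<omega> in M. (\<integral>\<^sup>+t. indicator {H s \<omega><..} t \<partial>exp_measure a) = ennreal (exp (- a * H s \<omega>))"
        using good
      proof eventually_elim
        case (elim \<omega>)
        have "H 0 \<omega> \<le> H s \<omega>" using mono_onD[of "{0..}" "\<lambda>t. H t \<omega>" 0 s] elim s by simp
        then show ?case using elim a emeasure_exp_measure_greaterThan[of a "H s \<omega>"] by simp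
      qed
    qed
    also have "\<dots> = ennreal (expectation (\<lambda>\<omega>. exp (- a * H s \<omega>)))"
    proof (rule nn_integral_eq_integral)
      show "integrable M (\<lambda>\<omega>. exp (- a * H s \<omega>))"
      proof (rule ccontr)
        assume "\<not> ?thesis"
        from not_integrable_integral_eq[OF this] lap[OF s a] show False by simp
      qed
    qed simp
    also have "\<dots> = ennreal (exp (- (s * A)))" using lap[OF s a] by (simp add: A_def)
    finally show ?thesis .
  qed
  have up: "emeasure B {s<..} \<le> ennreal (exp (- (s * A)))" if s: "0 \<le> s" for s
    unfolding mid[OF s, symmetric] Be[OF greaterThan_borel]
  proof (rule nn_integral_mono_AE)
    have [measurable]: "H s \<in> borel_measurable M" using Hm s by simp
    show "AE t in exp_measure a. emeasure M {\<omega> \<in> space M. L (max 0 t) \<omega> \<in> {s<..}} \<le> emeasure M {\<omega> \<in> space M. H s \<omega> < t}"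
      using AE_exp_measure_pos[of a]
    proof eventually_elim
      case (elim t)
      show ?case
      proof (rule emeasure_mono_AE)
        show "AE \<omega> in M. \<omega> \<in> {\<omega> \<in> space M. L (max 0 t) \<omega> \<in> {s<..}} \<longrightarrow> \<omega> \<in> {\<omega> \<in> space M. H s \<omega> < t}"
          using good by eventually_elim (use elim s in \<open>auto simp: max_absorb2\<close>)
      qed measurable
    qed
  qed
  have low: "ennreal (exp (- (s * A))) \<le> emeasure B {s..}" if s: "0 \<le> s" for s
    unfolding mid[OF s, symmetric] Be[OF borel_closed[OF closed_atLeast]]
  proof (rule nn_integral_mono_AE)
    have [measurable]: "H s \<in> borel_measurable M" using Hm s by simp
    show "AE t in exp_measure a. emeasure M {\<omega> \<in> space M. H s \<omega> < t} \<le> emeasure M {\<omega> \<in> space M. L (max 0 t) \<omega> \<in> {s..}}"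
      using AE_exp_measure_pos[of a]
    proof eventually_elim
      case (elim t)
      show ?case
      proof (rule emeasure_mono_AE)
        show "AE \<omega> in M. \<omega> \<in> {\<omega> \<in> space M. H s \<omega> < t} \<longrightarrow> \<omega> \<in> {\<omega> \<in> space M. L (max 0 t) \<omega> \<in> {s..}}"
          using good by eventually_elim (use elim s in \<open>auto simp: max_absorb2\<close>)
      qed measurable
    qed
  qed
  have eqB: "measure B {s<..} = exp (- (s * A))" if s: "0 \<le> s" for s
  proof (rule antisym)
    show "measure B {s<..} \<le> exp (- (s * A))"
      using up[OF s] by (simp add: B.emeasure_eq_measure)
    \<comment> \<open>The lower bound is available for closed half-lines; those starting at
      \<open>s + 1 / real (Suc n)\<close> lie inside the open one.\<close>
    have lim: "(\<lambda>n. exp (- ((s + 1 / real (Suc n)) * A))) \<longlonglongrightarrow> exp (- ((s + 0) * A))"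
      using LIMSEQ_Suc[OF lim_1_over_n[where 'a=real]] by (intro tendsto_intros) simp
    have "exp (- ((s + 1 / real (Suc n)) * A)) \<le> measure B {s<..}" for n
    proof -
      have "exp (- ((s + 1 / real (Suc n)) * A)) \<le> measure B {s + 1 / real (Suc n)..}"
        using low[of "s + 1 / real (Suc n)"] s by (simp add: B.emeasure_eq_measure)
      also have "\<dots> \<le> measure B {s<..}"
      proof (rule B.finite_measure_mono)
        have "0 < 1 / real (Suc n)" by simp
        then show "{s + 1 / real (Suc n)..} \<subseteq> {s<..}" unfolding atLeast_def greaterThan_def by (auto simp del: of_nat_Suc elim!: less_le_trans[rotated])
      qed measurable
      finally show ?thesis .
    qed
    then have "exp (- ((s + 0) * A)) \<le> measure B {s<..}"
      by (intro LIMSEQ_le_const2[OF lim]) auto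
    then show "exp (- (s * A)) \<le> measure B {s<..}" by simp
  qed
  have eqB1: "measure B {s<..} = 1" if s: "s < 0" for s
  proof -
    have "emeasure B {s<..} = (\<integral>\<^sup>+t. 1 \<partial>exp_measure a)"
      unfolding Be[OF greaterThan_borel]
    proof (rule nn_integral_cong)
      fix t :: real
      have "AE \<omega> in M. s < L (max 0 t) \<omega>"
        using inverse_stable_subordinator_nonneg[OF inv]
      proof eventually_elim
        case (elim \<omega>)
        have "0 \<le> L (max 0 t) \<omega>" using elim by simp
        then show ?case using s by simp
      qed
      then show "emeasure M {\<omega> \<in> space M. L (max 0 t) \<omega> \<in> {s<..}} = 1"
        by (intro emeasure_eq_1_AE) auto
    qed
    also have "\<dots> = 1" using E.emeasure_space_1 by simp
    finally show ?thesis by (simp add: B.emeasure_eq_measure)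
  qed
  have "cdf B = cdf (exp_measure A)"
  proof
    fix s
    have "measure B {..s} = 1 - measure B {s<..}"
      using B.prob_compl[of "{s<..}"] by (simp add: spB Compl_eq_Diff_UNIV[symmetric] not_less_iff_gr_or_eq)
    also have "\<dots> = erlang_CDF 0 A s"
      using eqB[of s] eqB1[of s] by (simp add: erlang_CDF_0 mult.commute)
    also have "\<dots> = measure (exp_measure A) {..s}"
      using emeasure_erlang_density[OF A, of 0 s] A by (simp add: measure_def erlang_CDF_0 mult_le_0_iff)
    finally show "cdf B s = cdf (exp_measure A) s" by (simp add: cdf_def)
  qed
  then have "B = exp_measure A"
    by (intro cdf_unique) (auto simp: real_distribution_def real_distribution_axioms_def setsB
        B.prob_space_axioms EA.prob_space_axioms)
  then show ?thesis by (simp add: B_def A_def)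
qed

text \<open>The average of \<psi> along \<open>L\<close> has the Laplace transform of
  \<open>f\<close> by \<open>law_kernel_bind\<close>. Both functions are bounded and left
  continuous, so they agree at every positive time and not just almost everywhere.\<close>

lemma laplace_determines_subordinated:
  fixes f \<psi> :: "real \<Rightarrow> real"
  assumes inv: "inverse_stable_subordinator M \<alpha> L" and "prob_space M"
    and f[measurable]: "f \<in> borel_measurable borel" and fb: "\<And>t. \<bar>f t\<bar> \<le> 1"
    and left: "\<And>t. 0 < t \<Longrightarrow> (f \<longlongrightarrow> f t) (at_left t)"
    and \<psi>: "continuous_on UNIV \<psi>" and \<psi>b: "\<And>l. \<bar>\<psi> l\<bar> \<le> 1"
    and eq: "\<And>a. 0 < a \<Longrightarrow> (\<integral>t. f t \<partial>exp_measure a) = (\<integral>l. \<psi> l \<partial>exp_measure (a powr \<alpha>))"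
    and t: "0 < t"
  shows "f t = (\<integral>\<omega>. \<psi> (L t \<omega>) \<partial>M)"
proof -
  interpret prob_space M by fact
  have Lm[measurable]: "L (max 0 t) \<in> borel_measurable M" for t
    using inv by (rule inverse_stable_subordinator_measurable) simp
  have [measurable]: "\<psi> \<in> borel_measurable borel" using \<psi> by (rule borel_measurable_continuous_onI)
  note K[measurable] = law_kernel_measurable[OF inv assms(2)]
  define g where "g = (\<lambda>t. \<integral>\<omega>. \<psi> (L (max 0 t) \<omega>) \<partial>M)"
  have gK: "g t = (\<integral>l. \<psi> l \<partial>law_kernel M L t)" for t
    unfolding g_def law_kernel_def by (rule integral_distr[OF Lm, symmetric]) measurable
  have gm[measurable]: "g \<in> borel_measurable borel"
    unfolding gK[abs_def]
    by (rule measurable_compose[OF measurable_prob_algebraD[OF K] integral_measurable_subprob_algebra]) measurable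
  have ib: "integrable M (\<lambda>\<omega>. \<psi> (L (max 0 t) \<omega>))" for t
    by (rule integrable_const_bound[of _ 1]) (use \<psi>b in auto)
  have gb: "\<bar>g t\<bar> \<le> 1" for t
  proof -
    have "\<bar>g t\<bar> \<le> (\<integral>\<omega>. norm (\<psi> (L (max 0 t) \<omega>)) \<partial>M)"
      unfolding g_def real_norm_def[symmetric] by (rule integral_norm_bound)
    also have "\<dots> \<le> 1" using ib \<psi>b by (intro integral_le_const) auto
    finally show ?thesis .
  qed
  have lap: "(\<integral>t. g t \<partial>exp_measure a) = (\<integral>l. \<psi> l \<partial>exp_measure (a powr \<alpha>))" if "0 < a" for a
  proof -
    interpret E: prob_space "exp_measure a" using that by (intro prob_space_exponential_density)
    have "(\<integral>l. \<psi> l \<partial>(exp_measure a \<bind> law_kernel M L)) = (\<integral>t. (\<integral>l. \<psi> l \<partial>law_kernel M L t) \<partial>exp_measure a)"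
    proof (rule integral_bind[where K=borel and B=1 and B'=1])
      show "law_kernel M L \<in> exp_measure a \<rightarrow>\<^sub>M subprob_algebra borel"
        using measurable_prob_algebraD[OF K] by simp
      show "finite_measure (exp_measure a)" by (rule E.finite_measure_axioms)
      show "AE x in exp_measure a. emeasure (law_kernel M L x) (space (law_kernel M L x)) \<le> ennreal 1"
        unfolding law_kernel_def
        by (intro AE_I2) (auto simp: emeasure_space_1 emeasure_distr simp del: space_distr intro!: prob_space.emeasure_le_1 prob_space_distr)
    qed (use \<psi>b in auto)
    then show ?thesis using law_kernel_bind[OF inv assms(2) that] by (simp add: gK)
  qed
  have gleft: "(g \<longlongrightarrow> g t) (at_left t)"
  proof (rule tendsto_at_left_sequentially[OF t])
    fix S assume S: "\<And>n. S n < t" "\<And>n. 0 < S n" "S \<longlonglongrightarrow> t"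
    have "filterlim S (at_left t) sequentially"
      using S less_imp_neq[OF S(1)] by (auto simp: filterlim_at)
    then have c: "AE \<omega> in M. (\<lambda>n. L (S n) \<omega>) \<longlonglongrightarrow> L t \<omega>"
      using inverse_stable_subordinator_left[OF inv] t
      by (auto elim!: eventually_mono intro: filterlim_compose)
    have "AE \<omega> in M. (\<lambda>n. \<psi> (L (S n) \<omega>)) \<longlonglongrightarrow> \<psi> (L t \<omega>)"
      using c by eventually_elim (auto intro: continuous_on_tendsto_compose[OF \<psi>])
    moreover have [measurable]: "L t \<in> borel_measurable M" "L (S n) \<in> borel_measurable M" for n
      using S(2)[of n] t by (auto intro!: inverse_stable_subordinator_measurable[OF inv])
    ultimately have "(\<lambda>n. \<integral>\<omega>. \<psi> (L (max 0 (S n)) \<omega>) \<partial>M) \<longlonglongrightarrow> (\<integral>\<omega>. \<psi> (L (max 0 t) \<omega>) \<partial>M)"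
      using S(2) t \<psi>b
      by (intro integral_dominated_convergence[where w="\<lambda>_. 1"]) (auto simp: max_absorb2 less_imp_le)
    then show "(\<lambda>n. g (S n)) \<longlonglongrightarrow> g t" by (simp add: g_def)
  qed
  have "f t - g t = 0"
  proof (rule laplace_zero_left_continuous[where h="\<lambda>t. f t - g t" and C=2])
    show "\<bar>f t - g t\<bar> \<le> 2" for t using fb[of t] gb[of t] by linarith
    show "(\<integral>t. f t - g t \<partial>exp_measure a) = 0" if "0 < a" for a
    proof -
      interpret E: prob_space "exp_measure a" using that by (intro prob_space_exponential_density)
      have "integrable (exp_measure a) f" "integrable (exp_measure a) g"
        by (rule E.integrable_const_bound[of _ 1]; use fb gb in auto)+
      then show ?thesis using eq lap that by simp
    qed
  qed (use left[OF t] gleft t in \<open>auto intro!: tendsto_diff\<close>)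
  then show ?thesis using t by (simp add: g_def max_absorb2)
qed

section \<open>One-point laws of the field\<close>

text \<open>Rounding the first argument down to a grid leaves countably many sections, each
  measurable in the second argument; continuity in the first gives the pointwise limit.\<close>

lemma borel_measurable_Caratheodory:
  fixes f :: "real \<Rightarrow> real \<Rightarrow> real"
  assumes c: "\<And>y. continuous_on UNIV (\<lambda>x. f x y)" and m: "\<And>x. f x \<in> borel_measurable borel"
  shows "case_prod f \<in> borel_measurable (borel \<Otimes>\<^sub>M borel)"
proof (rule borel_measurable_LIMSEQ_real)
  fix k :: nat
  show "(\<lambda>z. f (real_of_int \<lfloor>real (Suc k) * fst z\<rfloor> / real (Suc k)) (snd z)) \<in> borel_measurable (borel \<Otimes>\<^sub>M borel)"
  proof (rule measurable_compose_countable[where g="\<lambda>z. \<lfloor>real (Suc k) * fst z\<rfloor>"])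
    fix i :: int
    show "(\<lambda>z. f (real_of_int i / real (Suc k)) (snd z)) \<in> borel_measurable (borel \<Otimes>\<^sub>M borel)"
      by (rule measurable_compose[OF measurable_snd m])
  qed measurable
next
  fix z :: "real \<times> real"
  have "(\<lambda>k. real_of_int \<lfloor>real (Suc k) * fst z\<rfloor> / real (Suc k)) \<longlonglongrightarrow> fst z"
  proof (rule tendsto_sandwich)
    show "\<forall>\<^sub>F k in sequentially. fst z - 1 / real (Suc k) \<le> real_of_int \<lfloor>real (Suc k) * fst z\<rfloor> / real (Suc k)"
    proof (rule always_eventually, rule allI)
      fix k
      have "real (Suc k) * fst z - 1 \<le> real_of_int \<lfloor>real (Suc k) * fst z\<rfloor>" by linarith
      then have "(real (Suc k) * fst z - 1) / real (Suc k) \<le> real_of_int \<lfloor>real (Suc k) * fst z\<rfloor> / real (Suc k)"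
        by (intro divide_right_mono) auto
      then show "fst z - 1 / real (Suc k) \<le> real_of_int \<lfloor>real (Suc k) * fst z\<rfloor> / real (Suc k)"
        by (simp add: diff_divide_distrib del: of_nat_Suc)
    qed
    show "\<forall>\<^sub>F k in sequentially. real_of_int \<lfloor>real (Suc k) * fst z\<rfloor> / real (Suc k) \<le> fst z"
    proof (rule always_eventually, rule allI)
      fix k
      have "real_of_int \<lfloor>real (Suc k) * fst z\<rfloor> \<le> real (Suc k) * fst z" by linarith
      then have "real_of_int \<lfloor>real (Suc k) * fst z\<rfloor> / real (Suc k) \<le> (real (Suc k) * fst z) / real (Suc k)"
        by (intro divide_right_mono) auto
      then show "real_of_int \<lfloor>real (Suc k) * fst z\<rfloor> / real (Suc k) \<le> fst z"
        by (simp del: of_nat_Suc)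
    qed
    show "(\<lambda>k. fst z - 1 / real (Suc k)) \<longlonglongrightarrow> fst z"
      using tendsto_diff[OF tendsto_const[of "fst z"] LIMSEQ_Suc[OF lim_1_over_n[where 'a=real]]] by simp
  qed auto
  then have "(\<lambda>k. f (real_of_int \<lfloor>real (Suc k) * fst z\<rfloor> / real (Suc k)) (snd z)) \<longlonglongrightarrow> f (fst z) (snd z)"
    by (rule continuous_on_tendsto_compose[OF c]) auto
  then show "(\<lambda>k. f (real_of_int \<lfloor>real (Suc k) * fst z\<rfloor> / real (Suc k)) (snd z)) \<longlonglongrightarrow> case_prod f z"
    by (simp add: case_prod_beta)
qed

lemma continuous_on_integral_bounded:
  fixes g :: "'a \<Rightarrow> real \<Rightarrow> real"
  assumes "prob_space M" and c: "\<And>x. continuous_on UNIV (g x)" and b: "\<And>x y. \<bar>g x y\<bar> \<le> 1"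
    and m: "\<And>y. (\<lambda>x. g x y) \<in> borel_measurable M"
  shows "continuous_on UNIV (\<lambda>y. \<integral>x. g x y \<partial>M)"
proof (rule continuous_on_sequentiallyI)
  fix S :: "nat \<Rightarrow> real" and y assume S: "S \<longlonglongrightarrow> y"
  interpret prob_space M by fact
  show "(\<lambda>n. \<integral>x. g x (S n) \<partial>M) \<longlonglongrightarrow> (\<integral>x. g x y \<partial>M)"
    using m b S by (intro integral_dominated_convergence[where w="\<lambda>_. 1"])
      (auto intro!: continuous_on_tendsto_compose[OF c])
qed

lemma abs_integral_le_1:
  fixes g :: "'a \<Rightarrow> real"
  assumes "prob_space M" and b: "\<And>x. \<bar>g x\<bar> \<le> 1"
  shows "\<bar>\<integral>x. g x \<partial>M\<bar> \<le> 1"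
proof (cases "integrable M g")
  case True
  interpret prob_space M by fact
  have "\<bar>\<integral>x. g x \<partial>M\<bar> \<le> (\<integral>x. norm (g x) \<partial>M)"
    unfolding real_norm_def[symmetric] by (rule integral_norm_bound)
  also have "\<dots> \<le> 1" using True b by (intro integral_le_const) auto
  finally show ?thesis .
qed (simp add: not_integrable_integral_eq)

text \<open>Isolates the analysis: the field enters only through each
  \<open>\<lambda>n. p n x y\<close> being a probability distribution. The indices stay below 1
  because at 1 \<open>caputo\<close> is an ordinary derivative instead of a fractional
  integral.\<close>

locale fractional_poisson_solution =
  fixes \<alpha>\<^sub>1 \<alpha>\<^sub>2 lam :: real and p :: "nat \<Rightarrow> real \<Rightarrow> real \<Rightarrow> real"
  assumes \<alpha>\<^sub>1: "0 < \<alpha>\<^sub>1" "\<alpha>\<^sub>1 < 1" and \<alpha>\<^sub>2: "0 < \<alpha>\<^sub>2" "\<alpha>\<^sub>2 < 1" and lam: "0 < lam"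
    and system: "fractional_poisson_system \<alpha>\<^sub>1 \<alpha>\<^sub>2 lam p"
    and nonneg: "\<And>n x y. 0 \<le> x \<Longrightarrow> 0 \<le> y \<Longrightarrow> 0 \<le> p n x y"
    and sums: "\<And>x y. 0 \<le> x \<Longrightarrow> 0 \<le> y \<Longrightarrow> (\<lambda>n. p n x y) sums 1"
begin

lemma le_1: "0 \<le> x \<Longrightarrow> 0 \<le> y \<Longrightarrow> p n x y \<le> 1"
  using sum_le_suminf[OF sums_summable[OF sums], of x y "{n}"] nonneg sums_unique[OF sums, of x y]
  by auto

text \<open>Initial conditions are prescribed for \<open>n = 0\<close> only; mass 1 at 0 leaves none
  for the other values.\<close>

lemma concentrated:
  assumes "0 \<le> x" "0 \<le> y" "p 0 x y = 1"
  shows "p n x y = (if n = 0 then 1 else 0)"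
proof (cases "n = 0")
  case False
  have "p 0 x y + p n x y = (\<Sum>k\<in>{0,n}. p k x y)" using False by simp
  also have "\<dots> \<le> 1"
    using sum_le_suminf[OF sums_summable[OF sums[OF assms(1,2)]], of "{0,n}"] nonneg assms(1,2)
      sums_unique[OF sums[OF assms(1,2)]] by auto
  finally show ?thesis using False assms nonneg[of x y n] by simp
qed (simp add: assms)

lemma axis1: "0 \<le> y \<Longrightarrow> p n 0 y = (if n = 0 then 1 else 0)"
  using system by (intro concentrated) (auto simp: fractional_poisson_system_def)

lemma axis2: "0 \<le> x \<Longrightarrow> p n x 0 = (if n = 0 then 1 else 0)"
  using system by (intro concentrated) (auto simp: fractional_poisson_system_def)

definition c :: "nat \<Rightarrow> real \<Rightarrow> real \<Rightarrow> real" where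
  "c n x y = caputo \<alpha>\<^sub>1 (\<lambda>s. p n s y) x"

lemma ac1: "0 \<le> y \<Longrightarrow> locally_abs_cont (\<lambda>s. p n s y)"
  using system unfolding fractional_poisson_system_def caputo_differentiable_def by blast

lemma ac2: "0 < x \<Longrightarrow> locally_abs_cont (c n x)"
  using system unfolding fractional_poisson_system_def caputo_differentiable_def c_def by blast

lemma caputo2: "0 < x \<Longrightarrow> 0 < y \<Longrightarrow> caputo \<alpha>\<^sub>2 (c n x) y = rate lam (\<lambda>k. p k x y) n"
  using system unfolding fractional_poisson_system_def c_def rate_def by blast

text \<open>On the axis \<open>p n\<close> is constant at positive \<open>s\<close>, so its
  derivative vanishes there. This is the initial value for inverting the second Caputo
  derivative.\<close>

lemma c_axis:
  assumes "0 < x"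
  shows "c n x 0 = 0"
proof -
  have "deriv (\<lambda>s. p n s 0) s = 0" if "0 < s" for s
  proof -
    have "((\<lambda>s. p n s 0) has_real_derivative 0) (at s)"
    proof (rule has_field_derivative_transform_within_open[where S="{0<..}"])
      show "((\<lambda>_. if n = 0 then 1 else 0) has_real_derivative 0) (at s)" by simp
    qed (use that axis2 in auto)
    then show ?thesis by (rule DERIV_imp_deriv)
  qed
  then have "c n x 0 = frac_int (1 - \<alpha>\<^sub>1) (\<lambda>_. 0) x"
    unfolding c_def caputo_eq_frac_int[OF \<alpha>\<^sub>1] by (intro frac_int_cong)
  then show ?thesis by (simp add: frac_int_altdef)
qed

lemma c_eq:
  assumes "0 < x" "0 \<le> y"
  shows "c n x y = frac_int \<alpha>\<^sub>2 (\<lambda>s. rate lam (\<lambda>k. p k x s) n) y"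
proof -
  have "frac_int \<alpha>\<^sub>2 (\<lambda>s. rate lam (\<lambda>k. p k x s) n) y = frac_int \<alpha>\<^sub>2 (caputo \<alpha>\<^sub>2 (c n x)) y"
    using assms caputo2 by (intro frac_int_cong) auto
  also have "\<dots> = c n x y - c n x 0"
    using assms by (intro frac_int_caputo \<alpha>\<^sub>2 ac2)
  finally show ?thesis using c_axis[OF assms(1)] by simp
qed

lemma p_eq:
  assumes "0 \<le> x" "0 \<le> y"
  shows "p n x y - (if n = 0 then 1 else 0) = frac_int \<alpha>\<^sub>1 (\<lambda>s. c n s y) x"
  using frac_int_caputo[OF \<alpha>\<^sub>1 ac1[OF assms(2)] assms(1)] axis1[OF assms(2)]
  unfolding c_def by simp

text \<open>Uniform in \<open>x\<close>, which provides the majorant for passing to the limit in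
  \<open>y\<close> under the outer fractional integral.\<close>

lemma c_bound:
  assumes "0 < x" "0 \<le> y"
  shows "\<bar>c n x y\<bar> \<le> lam * (4 * real n + 2) * exp y"
  unfolding c_eq[OF assms]
proof (rule frac_int_bound)
  fix s :: real assume "0 < s"
  have "\<bar>p k x s\<bar> \<le> 1" for k
    using nonneg[of x s k] le_1[of x s k] assms \<open>0 < s\<close> by simp
  then show "\<bar>rate lam (\<lambda>k. p k x s) n\<bar> \<le> lam * (4 * real n + 2)"
    by (rule rate_bound[OF lam])
qed (use \<alpha>\<^sub>2 in auto)

lemma c_measurable: "0 \<le> y \<Longrightarrow> set_borel_measurable lborel {0..} (\<lambda>s. c n s y)"
  using caputo_measurable[OF \<alpha>\<^sub>1 ac1, of y n] unfolding c_def set_borel_measurable_def by auto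

lemma c_continuous: "0 < x \<Longrightarrow> continuous_on {0..} (c n x)"
  by (intro locally_abs_cont_continuous ac2)

text \<open>\<open>p\<close> is constrained at nonnegative times only; clipping gives a bounded
  function on the whole plane, ready for Borel measurability there.\<close>

definition u :: "nat \<Rightarrow> real \<Rightarrow> real \<Rightarrow> real" where
  "u n x y = p n (max 0 x) (max 0 y)"

lemma u_continuous1: "continuous_on UNIV (\<lambda>x. u n x y)"
proof -
  have "continuous_on UNIV ((\<lambda>s. p n s (max 0 y)) \<circ> (\<lambda>x. max 0 x))"
    by (intro continuous_on_compose continuous_intros
         continuous_on_subset[OF locally_abs_cont_continuous[OF ac1]]) auto
  then show ?thesis by (simp add: u_def o_def)
qed

lemma u_continuous2: "continuous_on UNIV (u n x)"
proof (rule continuous_on_sequentiallyI)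
  fix S :: "nat \<Rightarrow> real" and y assume S: "S \<longlonglongrightarrow> y"
  then have S': "(\<lambda>k. max 0 (S k)) \<longlonglongrightarrow> max 0 y" by (intro tendsto_intros)
  \<comment> \<open>A convergent sequence is bounded, so the factor \<open>exp y\<close> in
    \<open>c_bound\<close> is bounded along it.\<close>
  then obtain B where B: "\<And>k. max 0 (S k) \<le> B"
    using Bseq_bdd_above[OF convergent_imp_Bseq[OF convergentI]] unfolding bdd_above_def by blast
  have "(\<lambda>k. frac_int \<alpha>\<^sub>1 (\<lambda>s. c n s (max 0 (S k))) (max 0 x)) \<longlonglongrightarrow> frac_int \<alpha>\<^sub>1 (\<lambda>s. c n s (max 0 y)) (max 0 x)"
  proof (rule frac_int_tendsto[OF \<alpha>\<^sub>1(1)])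
    show "\<bar>c n s (max 0 (S k))\<bar> \<le> lam * (4 * real n + 2) * exp B" if "0 < s" for k s
      using lam B[of k]
      by (intro order.trans[OF c_bound[OF that]]) (auto intro!: mult_left_mono)
    show "(\<lambda>k. c n s (max 0 (S k))) \<longlonglongrightarrow> c n s (max 0 y)" if "0 < s" for s
      by (rule continuous_on_tendsto_compose[OF c_continuous[OF that] S']) auto
  qed (intro c_measurable; simp)+
  then have "(\<lambda>k. p n (max 0 x) (max 0 (S k)) - (if n = 0 then 1 else 0)) \<longlonglongrightarrow> p n (max 0 x) (max 0 y) - (if n = 0 then 1 else 0)"
    by (subst (1 2) p_eq) auto
  from tendsto_add[OF this tendsto_const[of "if n = 0 then 1 else 0"]]
  show "(\<lambda>k. u n x (S k)) \<longlonglongrightarrow> u n x y" by (simp add: u_def)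
qed

text \<open>
  The hypotheses give no joint regularity: continuity in the first variable is part of the Caputo condition,
  and continuity in the second is inherited from that of the inner derivative through \<open>p_eq\<close>.
\<close>

lemma u_measurable [measurable]: "case_prod (u n) \<in> borel_measurable (borel \<Otimes>\<^sub>M borel)"
  by (intro borel_measurable_Caratheodory u_continuous1
        borel_measurable_continuous_onI u_continuous2)

lemma u_bounds: "0 \<le> u n x y" "u n x y \<le> 1"
  unfolding u_def by (auto intro: nonneg le_1)

lemma u_equation:
  assumes "0 < x" "0 < y"
  shows "u n x y - (if n = 0 then 1 else 0) = frac_int \<alpha>\<^sub>1 (\<lambda>s. frac_int \<alpha>\<^sub>2 (\<lambda>r. rate lam (\<lambda>k. u k s r) n) y) x"
proof -
  have "u n x y - (if n = 0 then 1 else 0) = frac_int \<alpha>\<^sub>1 (\<lambda>s. c n s y) x"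
    using assms p_eq[of x y n] by (simp add: u_def max_absorb2)
  also have "\<dots> = frac_int \<alpha>\<^sub>1 (\<lambda>s. frac_int \<alpha>\<^sub>2 (\<lambda>r. rate lam (\<lambda>k. p k s r) n) y) x"
    using assms by (intro frac_int_cong c_eq) auto
  also have "\<dots> = frac_int \<alpha>\<^sub>1 (\<lambda>s. frac_int \<alpha>\<^sub>2 (\<lambda>r. rate lam (\<lambda>k. u k s r) n) y) x"
    by (intro frac_int_cong) (simp add: u_def max_absorb2)
  finally show ?thesis .
qed

section \<open>Identification with Poisson weights of random mean\<close>

definition F :: "nat \<Rightarrow> real \<Rightarrow> real \<Rightarrow> real" where
  "F n l m = pois n (lam * max 0 l * max 0 m)"

lemma F_measurable [measurable]: "case_prod (F n) \<in> borel_measurable (borel \<Otimes>\<^sub>M borel)"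
  unfolding F_def by measurable

lemma F_bounds: "0 \<le> F n l m" "F n l m \<le> 1"
  unfolding F_def using lam by (auto intro!: pois_nonneg pois_le_1)

lemma F_abs: "\<bar>F n l m\<bar> \<le> 1"
  using F_bounds[of n l m] by simp

lemma u_abs: "\<bar>u n x y\<bar> \<le> 1"
  using u_bounds[of n x y] by simp

lemma F_continuous: "continuous_on UNIV (F n l)" "continuous_on UNIV (\<lambda>l. F n l m)"
  unfolding F_def by (intro continuous_intros)+

lemma laplace_u_eq:
  assumes "0 < a" "0 < b"
  shows "(\<integral>y. (\<integral>x. u n x y \<partial>exp_measure a) \<partial>exp_measure b)
    = (\<integral>m. (\<integral>l. F n l m \<partial>exp_measure (a powr \<alpha>\<^sub>1)) \<partial>exp_measure (b powr \<alpha>\<^sub>2))"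
proof -
  let ?P = "\<lambda>n. \<integral>y. (\<integral>x. u n x y \<partial>exp_measure a) \<partial>exp_measure b"
  let ?Q = "\<lambda>n. \<integral>m. (\<integral>l. F n l m \<partial>exp_measure (a powr \<alpha>\<^sub>1)) \<partial>exp_measure (b powr \<alpha>\<^sub>2)"
  let ?\<mu> = "lam * (a powr (-\<alpha>\<^sub>1) * b powr (-\<alpha>\<^sub>2))"
  have "?P = ?Q"
  proof (rule rate_recurrence_unique[where \<mu>="?\<mu>" and c="\<lambda>n. if n = 0 then 1 else 0"])
    show "0 < ?\<mu>" using lam assms by simp
    have lim: "(\<lambda>n. u n x y) \<longlonglongrightarrow> 0" for x y
      unfolding u_def by (rule summable_LIMSEQ_zero[OF sums_summable[OF sums]]) auto
    note P = laplace_master_equation[of \<alpha>\<^sub>1 \<alpha>\<^sub>2 a b lam u, OF \<alpha>\<^sub>1(1) \<alpha>\<^sub>2(1) assms lam u_measurable u_bounds lim u_equation]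
    show "?P n - (if n = 0 then 1 else 0) = rate ?\<mu> ?P n" for n by (rule P(1))
    show "?P \<longlonglongrightarrow> 0" by (rule P(2))
    have lim': "(\<lambda>n. F n x y) \<longlonglongrightarrow> 0" for x y
      unfolding F_def by (rule pois_tendsto)
    have pos: "0 < a powr \<alpha>\<^sub>1" "0 < b powr \<alpha>\<^sub>2" using assms by auto
    have eqF: "F n x y - (if n = 0 then 1 else 0) = frac_int 1 (\<lambda>s. frac_int 1 (\<lambda>r. rate lam (\<lambda>k. F k s r) n) y) x"
      if "0 < x" "0 < y" for n x y
      unfolding F_def using pois_field_equation[OF lam that, of n] .
    note Q = laplace_master_equation[of 1 1 "a powr \<alpha>\<^sub>1" "b powr \<alpha>\<^sub>2" lam F, OF zero_less_one zero_less_one pos lam F_measurable F_bounds lim' eqF]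
    \<comment> \<open>Index 1 at the rate \<open>a powr \<alpha>\<^sub>1\<close> and index
      \<open>\<alpha>\<^sub>1\<close> at the rate \<open>a\<close> give the same power of
      \<open>a\<close>.\<close>
    have "lam * ((a powr \<alpha>\<^sub>1) powr (-1) * (b powr \<alpha>\<^sub>2) powr (-1)) = ?\<mu>"
      by (simp add: powr_powr powr_minus_divide)
    with Q(1) show "?Q n - (if n = 0 then 1 else 0) = rate ?\<mu> ?Q n" for n by simp
    show "?Q \<longlonglongrightarrow> 0" by (rule Q(2))
  qed
  then show ?thesis by (rule fun_cong)
qed

text \<open>The transform is inverted in the second time while the first is still averaged, then in
  the first. Each inversion brings its own expectation; independence later merges the two into
  one.\<close>

lemma subordinated_law:
  assumes "prob_space M" and L: "inverse_stable_subordinator M \<alpha>\<^sub>1 L\<^sub>1" "inverse_stable_subordinator M \<alpha>\<^sub>2 L\<^sub>2"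
    and t: "0 < t\<^sub>1" "0 < t\<^sub>2"
  shows "p n t\<^sub>1 t\<^sub>2 = (\<integral>\<omega>. (\<integral>\<omega>'. F n (L\<^sub>1 t\<^sub>1 \<omega>) (L\<^sub>2 t\<^sub>2 \<omega>') \<partial>M) \<partial>M)"
proof -
  interpret prob_space M by fact
  have [measurable]: "L\<^sub>1 t\<^sub>1 \<in> borel_measurable M" "L\<^sub>2 t\<^sub>2 \<in> borel_measurable M"
    using t by (auto intro!: inverse_stable_subordinator_measurable[OF L(1)] inverse_stable_subordinator_measurable[OF L(2)])
  have 1: "(\<integral>x. u n x t\<^sub>2 \<partial>exp_measure a) = (\<integral>\<omega>. (\<integral>l. F n l (L\<^sub>2 t\<^sub>2 \<omega>) \<partial>exp_measure (a powr \<alpha>\<^sub>1)) \<partial>M)"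
    if a: "0 < a" for a
  proof (rule laplace_determines_subordinated[OF L(2) assms(1), where f="\<lambda>y. \<integral>x. u n x y \<partial>exp_measure a"
      and \<psi>="\<lambda>m. \<integral>l. F n l m \<partial>exp_measure (a powr \<alpha>\<^sub>1)"])
    have E: "prob_space (exp_measure a)" "prob_space (exp_measure (a powr \<alpha>\<^sub>1))"
      using a by (auto intro!: prob_space_exponential_density)
    have cu: "continuous_on UNIV (\<lambda>y. \<integral>x. u n x y \<partial>exp_measure a)"
      by (rule continuous_on_integral_bounded[OF E(1) u_continuous2 u_abs]) measurable
    then show "(\<lambda>y. \<integral>x. u n x y \<partial>exp_measure a) \<in> borel_measurable borel"
      by (rule borel_measurable_continuous_onI)
    show "((\<lambda>y. \<integral>x. u n x y \<partial>exp_measure a) \<longlongrightarrow> (\<integral>x. u n x t \<partial>exp_measure a)) (at_left t)" for t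
      using cu by (auto simp: continuous_on_eq_continuous_within continuous_within intro: tendsto_within_subset)
    show "continuous_on UNIV (\<lambda>m. \<integral>l. F n l m \<partial>exp_measure (a powr \<alpha>\<^sub>1))"
      by (rule continuous_on_integral_bounded[OF E(2) F_continuous(1) F_abs]) measurable
    show "\<bar>\<integral>x. u n x t \<partial>exp_measure a\<bar> \<le> 1" for t by (rule abs_integral_le_1[OF E(1) u_abs])
    show "\<bar>\<integral>l. F n l m \<partial>exp_measure (a powr \<alpha>\<^sub>1)\<bar> \<le> 1" for m by (rule abs_integral_le_1[OF E(2) F_abs])
  qed (use laplace_u_eq a t in auto)
  have "u n t\<^sub>1 t\<^sub>2 = (\<integral>\<omega>. (\<integral>\<omega>'. F n (L\<^sub>1 t\<^sub>1 \<omega>) (L\<^sub>2 t\<^sub>2 \<omega>') \<partial>M) \<partial>M)"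
  proof (rule laplace_determines_subordinated[OF L(1) assms(1), where f="\<lambda>x. u n x t\<^sub>2"
      and \<psi>="\<lambda>l. \<integral>\<omega>'. F n l (L\<^sub>2 t\<^sub>2 \<omega>') \<partial>M"])
    have cu: "continuous_on UNIV (\<lambda>x. u n x t\<^sub>2)" by (rule u_continuous1)
    then show "(\<lambda>x. u n x t\<^sub>2) \<in> borel_measurable borel" by (rule borel_measurable_continuous_onI)
    show "((\<lambda>x. u n x t\<^sub>2) \<longlongrightarrow> u n t t\<^sub>2) (at_left t)" for t
      using cu by (auto simp: continuous_on_eq_continuous_within continuous_within intro: tendsto_within_subset)
    show "continuous_on UNIV (\<lambda>l. \<integral>\<omega>'. F n l (L\<^sub>2 t\<^sub>2 \<omega>') \<partial>M)"
      by (rule continuous_on_integral_bounded[OF assms(1) F_continuous(2) F_abs]) measurable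
    show "\<bar>\<integral>\<omega>'. F n l (L\<^sub>2 t\<^sub>2 \<omega>') \<partial>M\<bar> \<le> 1" for l by (rule abs_integral_le_1[OF assms(1) F_abs])
    show "(\<integral>x. u n x t\<^sub>2 \<partial>exp_measure a) = (\<integral>l. (\<integral>\<omega>'. F n l (L\<^sub>2 t\<^sub>2 \<omega>') \<partial>M) \<partial>exp_measure (a powr \<alpha>\<^sub>1))"
      if a: "0 < a" for a
    proof -
      interpret A: prob_space "exp_measure (a powr \<alpha>\<^sub>1)" using a by (auto intro!: prob_space_exponential_density)
      interpret P: pair_prob_space "exp_measure (a powr \<alpha>\<^sub>1)" M ..
      \<comment> \<open>Exchanging the integrals puts the exponential average outside, as the
        inversion in the first time requires.\<close>
      have "integrable (exp_measure (a powr \<alpha>\<^sub>1) \<Otimes>\<^sub>M M) (case_prod (\<lambda>l \<omega>. F n l (L\<^sub>2 t\<^sub>2 \<omega>)))"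
        by (rule P.integrable_const_bound[of _ 1]) (use F_abs in \<open>auto simp: case_prod_beta'\<close>)
      from P.Fubini_integral[OF this] show ?thesis unfolding 1[OF a] .
    qed
  qed (use u_abs t in auto)
  then show ?thesis using t by (simp add: u_def max_absorb2)
qed

end

section \<open>Characteristic functions with random indices\<close>

text \<open>Independence of set systems is passed to random variables: \<open>{E}\<close> and the
  events of \<open>Y\<close> are intersection-stable generators, and the indicator is complex-valued
  so that the product rule sees one value type.\<close>

lemma (in prob_space) indep_set_expectation:
  fixes Y :: "'a \<Rightarrow> complex"
  assumes indep: "indep_set A B" and E: "E \<in> A"
    and Y: "\<And>S. S \<in> sets borel \<Longrightarrow> Y -` S \<inter> space M \<in> B"
    and b: "\<And>\<omega>. norm (Y \<omega>) \<le> 1"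
  shows "expectation (\<lambda>\<omega>. indicator E \<omega> * Y \<omega>) = of_real (prob E) * expectation Y"
proof -
  have EM: "E \<in> events" using indep_setD_ev1[OF indep] E by auto
  have YM[measurable]: "Y \<in> borel_measurable M"
    using indep_setD_ev2[OF indep] Y by (intro measurableI) auto
  let ?G = "{Y -` S \<inter> space M | S. S \<in> sets borel}"
  have iEG: "indep_set {E} ?G"
    using indep E Y unfolding indep_sets2_eq by blast
  have "Int_stable ?G"
  proof (rule Int_stableI)
    fix a b assume "a \<in> ?G" "b \<in> ?G"
    then obtain S T where "a = Y -` S \<inter> space M" "b = Y -` T \<inter> space M" "S \<in> sets borel" "T \<in> sets borel" by blast
    then have "a \<inter> b = Y -` (S \<inter> T) \<inter> space M" "S \<inter> T \<in> sets borel" by auto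
    then show "a \<inter> b \<in> ?G" by blast
  qed
  moreover have "Int_stable {E}" by (simp add: Int_stable_def)
  ultimately have ind: "indep_set (sigma_sets (space M) {E}) (sigma_sets (space M) ?G)"
    by (intro indep_set_sigma_sets iEG)
  have sp: "E \<subseteq> space M" using EM by (rule sets.sets_into_space)
  have IM: "(indicator E :: 'a \<Rightarrow> complex) \<in> borel_measurable M" using EM by simp
  have "indep_var borel (indicator E :: 'a \<Rightarrow> complex) borel Y"
    unfolding indep_var_eq
  proof (intro conjI IM YM)
    have "{indicator E -` A \<inter> space M |A. A \<in> sets (borel :: complex measure)} \<subseteq> sigma_sets (space M) {E}"
    proof safe
      fix A :: "complex set"
      \<comment> \<open>The preimage depends only on whether \<open>A\<close> contains 0 and 1,
        which leaves four cases.\<close>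
      have "indicator E -` A \<inter> space M = (if 1 \<in> A then E else {}) \<union> (if 0 \<in> A then space M - E else {})"
      proof (rule set_eqI)
        fix x
        show "x \<in> indicator E -` A \<inter> space M \<longleftrightarrow> x \<in> (if 1 \<in> A then E else {}) \<union> (if 0 \<in> A then space M - E else {})"
          using sp by (cases "x \<in> E") auto
      qed
      moreover have "E \<in> sigma_sets (space M) {E}" "{} \<in> sigma_sets (space M) {E}"
        "space M - E \<in> sigma_sets (space M) {E}" "E \<union> (space M - E) \<in> sigma_sets (space M) {E}"
        using sigma_sets_top[of "space M" "{E}"] sp
        by (auto intro: sigma_sets.intros simp: Un_absorb1)
      ultimately show "indicator E -` A \<inter> space M \<in> sigma_sets (space M) {E}" by auto
    qed
    then have "sigma_sets (space M) {indicator E -` A \<inter> space M |A. A \<in> sets (borel :: complex measure)}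
        \<subseteq> sigma_sets (space M) {E}"
      using sp by (intro sigma_sets_subseteq sigma_sets_mono) auto
    then show "indep_set (sigma_sets (space M) {indicator E -` A \<inter> space M |A. A \<in> sets (borel :: complex measure)})
        (sigma_sets (space M) ?G)"
      using ind unfolding indep_sets2_eq by blast
  qed
  moreover have "integrable M (indicator E :: 'a \<Rightarrow> complex)" "integrable M Y"
    using EM b by (auto intro!: integrable_const_bound[of _ 1] simp: indicator_def)
  ultimately have "expectation (\<lambda>\<omega>. indicator E \<omega> * Y \<omega>) = expectation (indicator E :: 'a \<Rightarrow> complex) * expectation Y"
    by (rule indep_var_lebesgue_integral)
  moreover have "expectation (indicator E :: 'a \<Rightarrow> complex) = of_real (prob E)"
  proof -
    have "(indicator E :: 'a \<Rightarrow> complex) = (\<lambda>\<omega>. of_real (indicator E \<omega>))" by (auto simp: indicator_def)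
    then show ?thesis using EM by (simp add: integral_of_real)
  qed
  ultimately show ?thesis by simp
qed

text \<open>The partial sums over \<open>k < m\<close> equal \<open>e (N \<omega>) \<omega>\<close>
  where \<open>N \<omega> < m\<close> and 0 elsewhere: bounded by 1 and eventually constant in
  \<open>m\<close>.\<close>

lemma (in prob_space) expectation_random_index:
  fixes e :: "nat \<Rightarrow> 'a \<Rightarrow> complex"
  assumes N[measurable]: "N \<in> measurable M (count_space UNIV)"
    and e[measurable]: "\<And>k. e k \<in> borel_measurable M" and b: "\<And>k \<omega>. norm (e k \<omega>) \<le> 1"
  shows "(\<lambda>k. expectation (\<lambda>\<omega>. indicator {\<omega> \<in> space M. N \<omega> = k} \<omega> * e k \<omega>)) sums expectation (\<lambda>\<omega>. e (N \<omega>) \<omega>)"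
proof -
  let ?I = "\<lambda>k \<omega>. indicator {\<omega> \<in> space M. N \<omega> = k} \<omega> * e k \<omega>"
  have i: "integrable M (?I k)" for k
    by (rule integrable_const_bound[of _ 1]) (use b in \<open>auto simp: indicator_def\<close>)
  have s: "(\<Sum>k<m. ?I k \<omega>) = (if N \<omega> < m then e (N \<omega>) \<omega> else 0)" if "\<omega> \<in> space M" for m \<omega>
  proof -
    have "(\<Sum>k<m. ?I k \<omega>) = (\<Sum>k<m. if N \<omega> = k then e k \<omega> else 0)"
      using that by (intro sum.cong) (auto simp: indicator_def)
    then show ?thesis by simp
  qed
  have "(\<lambda>m. expectation (\<lambda>\<omega>. \<Sum>k<m. ?I k \<omega>)) \<longlonglongrightarrow> expectation (\<lambda>\<omega>. e (N \<omega>) \<omega>)"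
  proof (rule integral_dominated_convergence[where w="\<lambda>_. 1"])
    show "(\<lambda>\<omega>. e (N \<omega>) \<omega>) \<in> borel_measurable M"
      by (rule measurable_compose_countable[OF e N])
    show "AE \<omega> in M. (\<lambda>m. \<Sum>k<m. ?I k \<omega>) \<longlonglongrightarrow> e (N \<omega>) \<omega>"
    proof (rule AE_I2)
      fix \<omega> assume "\<omega> \<in> space M"
      show "(\<lambda>m. \<Sum>k<m. ?I k \<omega>) \<longlonglongrightarrow> e (N \<omega>) \<omega>"
      proof (rule tendsto_eventually)
        show "\<forall>\<^sub>F m in sequentially. (\<Sum>k<m. ?I k \<omega>) = e (N \<omega>) \<omega>"
          using eventually_gt_at_top[of "N \<omega>"]
          by eventually_elim (simp only: s[OF \<open>\<omega> \<in> space M\<close>] if_True)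
      qed
    qed
    show "AE \<omega> in M. norm (\<Sum>k<m. ?I k \<omega>) \<le> 1" for m
    proof (rule AE_I2)
      fix \<omega> assume "\<omega> \<in> space M"
      show "norm (\<Sum>k<m. ?I k \<omega>) \<le> 1"
        unfolding s[OF \<open>\<omega> \<in> space M\<close>] using b by simp
    qed
  qed auto
  moreover have "expectation (\<lambda>\<omega>. \<Sum>k<m. ?I k \<omega>) = (\<Sum>k<m. expectation (?I k))" for m
    by (rule Bochner_Integration.integral_sum[OF i])
  ultimately show ?thesis unfolding sums_def by (simp only:)
qed

lemma (in prob_space) expectation_index_sums:
  fixes \<phi> :: "nat \<Rightarrow> real"
  assumes N[measurable]: "N \<in> measurable M (count_space UNIV)" and b: "\<And>k. \<bar>\<phi> k\<bar> \<le> 1"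
  shows "(\<lambda>k. prob {\<omega> \<in> space M. N \<omega> = k} * \<phi> k) sums expectation (\<lambda>\<omega>. \<phi> (N \<omega>))"
proof -
  have c: "expectation (\<lambda>\<omega>. indicator {\<omega> \<in> space M. N \<omega> = k} \<omega> * complex_of_real (\<phi> k))
      = of_real (prob {\<omega> \<in> space M. N \<omega> = k} * \<phi> k)" for k
  proof -
    have "(\<lambda>\<omega>. indicator {\<omega> \<in> space M. N \<omega> = k} \<omega> * complex_of_real (\<phi> k))
      = (\<lambda>\<omega>. of_real (indicator {\<omega> \<in> space M. N \<omega> = k} \<omega> * \<phi> k))"
      by (auto simp: indicator_def)
    then show ?thesis by simp
  qed
  have "(\<lambda>k. complex_of_real (prob {\<omega> \<in> space M. N \<omega> = k} * \<phi> k)) sums of_real (expectation (\<lambda>\<omega>. \<phi> (N \<omega>)))"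
    using expectation_random_index[OF N, of "\<lambda>k _. complex_of_real (\<phi> k)"] b unfolding c by simp
  then show ?thesis by (simp only: sums_of_real_iff)
qed

text \<open>Conditioning on a countable index by summation: on each event \<open>N = k\<close>
  independence splits off \<open>expectation (e k)\<close>, and the series that results is the
  expectation of \<phi> at \<open>N\<close>.\<close>

lemma (in prob_space) expectation_independent_index:
  fixes e :: "nat \<Rightarrow> 'a \<Rightarrow> complex" and \<phi> :: "nat \<Rightarrow> real"
  assumes N[measurable]: "N \<in> measurable M (count_space UNIV)"
    and b: "\<And>k \<omega>. norm (e k \<omega>) \<le> 1"
    and indep: "indep_set A B" and NA: "\<And>k. {\<omega> \<in> space M. N \<omega> = k} \<in> A"
    and eB: "\<And>k S. S \<in> sets borel \<Longrightarrow> e k -` S \<inter> space M \<in> B"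
    and \<phi>: "\<And>k. expectation (e k) = of_real (\<phi> k)" and \<phi>1: "\<And>k. \<bar>\<phi> k\<bar> \<le> 1"
  shows "expectation (\<lambda>\<omega>. e (N \<omega>) \<omega>) = of_real (expectation (\<lambda>\<omega>. \<phi> (N \<omega>)))"
proof -
  have eM: "e k \<in> borel_measurable M" for k
    using indep_setD_ev2[OF indep] eB by (intro measurableI) auto
  have 1: "(\<lambda>k. of_real (prob {\<omega> \<in> space M. N \<omega> = k} * \<phi> k)) sums expectation (\<lambda>\<omega>. e (N \<omega>) \<omega>)"
    using expectation_random_index[OF N eM b] indep_set_expectation[OF indep NA eB b]
    by (simp add: \<phi>)
  have 2: "(\<lambda>k. complex_of_real (prob {\<omega> \<in> space M. N \<omega> = k} * \<phi> k)) sums of_real (expectation (\<lambda>\<omega>. \<phi> (N \<omega>)))"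
    using expectation_index_sums[OF N \<phi>1] by (rule sums_of_real)
  from sums_unique2[OF 1 2] show ?thesis by simp
qed

lemma process_events_generators:
  "{X i -` A \<inter> space M | i A. i \<in> I \<and> A \<in> sets S} \<subseteq> Pow (space M)"
  by auto

lemma process_events_measurable:
  assumes "i \<in> I" "space S = UNIV" "process_events M S I X \<subseteq> \<G>" "sigma_algebra (space M) \<G>"
  shows "X i \<in> measurable (sigma (space M) \<G>) S"
proof (rule measurableI)
  fix A assume A: "A \<in> sets S"
  have "X i -` A \<inter> space M \<in> process_events M S I X"
    unfolding process_events_def using assms(1) A by (intro sigma_sets.Basic) blast
  then show "X i -` A \<inter> space (sigma (space M) \<G>) \<in> sets (sigma (space M) \<G>)"
    using assms(3,4) by (auto simp: sigma_algebra.sets_measure_of_eq sigma_algebra.space_measure_of_eq)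
qed (use assms in auto)

lemma sigma_algebra_process_events: "sigma_algebra (space M) (process_events M S I X)"
  unfolding process_events_def by (intro sigma_algebra_sigma_sets process_events_generators)

lemma (in prob_space) iexp_expectation_normal:
  assumes "distributed M lborel X (normal_density 0 \<sigma>)" "0 < \<sigma>"
  shows "expectation (\<lambda>\<omega>. iexp (u * X \<omega>)) = complex_of_real (exp (- (u * \<sigma>)\<^sup>2 / 2))"
proof -
  have Xm[measurable]: "X \<in> borel_measurable M"
    using distributed_measurable[OF assms(1)] by simp
  have D: "distributed M lborel (\<lambda>x. X x / \<sigma>) std_normal_density"
    using normal_standard_normal_convert[OF assms(2), of X 0] assms(1) by simp
  have "distr M borel (\<lambda>x. X x / \<sigma>) = distr M lborel (\<lambda>x. X x / \<sigma>)" by (rule distr_cong) auto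
  also have "\<dots> = std_normal_distribution" using distributed_distr_eq_density[OF D] by simp
  finally have d: "distr M borel (\<lambda>x. X x / \<sigma>) = std_normal_distribution" .
  have "char (distr M borel (\<lambda>x. X x / \<sigma>)) (u * \<sigma>) = expectation (\<lambda>\<omega>. iexp ((u * \<sigma>) * (X \<omega> / \<sigma>)))"
    unfolding char_def by (subst integral_distr) auto
  then show ?thesis using assms(2) unfolding d char_std_normal_distribution by simp
qed

section \<open>The Brownian sheet at independent random times\<close>

lemma brownian_sheetD:
  assumes "brownian_sheet M W"
  shows "prob_space M"
    and "\<forall>t\<^sub>1\<ge>0. \<forall>t\<^sub>2\<ge>0. W t\<^sub>1 t\<^sub>2 \<in> borel_measurable M"
    and "\<forall>t\<ge>0. (AE \<omega> in M. W 0 t \<omega> = 0) \<and> (AE \<omega> in M. W t 0 \<omega> = 0)"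
    and "\<forall>s\<^sub>1\<ge>0. \<forall>s\<^sub>2\<ge>0. \<forall>t\<^sub>1>s\<^sub>1. \<forall>t\<^sub>2>s\<^sub>2.
        distributed M lborel (rect_increment W ((s\<^sub>1, s\<^sub>2), (t\<^sub>1, t\<^sub>2)))
          (normal_density 0 (sqrt ((t\<^sub>1 - s\<^sub>1) * (t\<^sub>2 - s\<^sub>2))))"
    and "AE \<omega> in M. continuous_on ({0..} \<times> {0..}) (\<lambda>(t\<^sub>1, t\<^sub>2). W t\<^sub>1 t\<^sub>2 \<omega>)"
  using assms unfolding brownian_sheet_def by - (elim conjE; assumption)+

text \<open>The sheet vanishes almost surely on the axes, so its value at a point is the increment
  over the rectangle spanned with the origin.\<close>

lemma brownian_sheet_char:
  assumes W: "brownian_sheet M W" and t: "0 \<le> s" "0 \<le> t"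
  shows "(\<integral>\<omega>. iexp (u * W s t \<omega>) \<partial>M) = complex_of_real (exp (- (u\<^sup>2 / 2 * (s * t))))"
proof -
  interpret prob_space M by (rule brownian_sheetD(1)[OF W])
  have m: "W x y \<in> borel_measurable M" if "0 \<le> x" "0 \<le> y" for x y
    using brownian_sheetD(2)[OF W] that by blast
  have z: "AE \<omega> in M. W 0 x \<omega> = 0" "AE \<omega> in M. W x 0 \<omega> = 0" if "0 \<le> x" for x
    using brownian_sheetD(3)[OF W] that by blast+
  have [measurable]: "W s t \<in> borel_measurable M" using m t by simp
  show ?thesis
  proof (cases "s = 0 \<or> t = 0")
    \<comment> \<open>The normal law is given for rectangles with positive sides only; a degenerate
      one has no density.\<close>
    case True
    then have "AE \<omega> in M. W s t \<omega> = 0" using z t by auto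
    then have "AE \<omega> in M. iexp (u * W s t \<omega>) = 1" by eventually_elim simp
    then have "(\<integral>\<omega>. iexp (u * W s t \<omega>) \<partial>M) = (\<integral>\<omega>. 1 \<partial>M)" by (intro integral_cong_AE) auto
    then show ?thesis using True prob_space by auto
  next
    case False
    then have pos: "0 < s" "0 < t" using t by auto
    let ?R = "rect_increment W ((0, 0), (s, t))"
    have "distributed M lborel ?R (normal_density 0 (sqrt ((s - 0) * (t - 0))))"
      using brownian_sheetD(4)[OF W] pos by blast
    then have D: "distributed M lborel ?R (normal_density 0 (sqrt (s * t)))" by simp
    have [measurable]: "?R \<in> borel_measurable M" using distributed_measurable[OF D] by simp
    have "AE \<omega> in M. W s t \<omega> = ?R \<omega>"
      using z(1)[OF t(2)] z(2)[OF t(1)] z(1)[OF order_refl]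
      by eventually_elim (simp add: rect_increment_def)
    then have "AE \<omega> in M. iexp (u * W s t \<omega>) = iexp (u * ?R \<omega>)" by eventually_elim simp
    then have "(\<integral>\<omega>. iexp (u * W s t \<omega>) \<partial>M) = (\<integral>\<omega>. iexp (u * ?R \<omega>) \<partial>M)"
      by (intro integral_cong_AE) auto
    also have "\<dots> = complex_of_real (exp (- (u * sqrt (s * t))\<^sup>2 / 2))"
      using pos by (intro iexp_expectation_normal D) simp
    finally show ?thesis using pos by (simp add: power_mult_distrib)
  qed
qed

lemma tendsto_grid_approximation:
  assumes "0 \<le> (x::real)"
  shows "(\<lambda>k. real (nat \<lceil>real (Suc k) * x\<rceil>) / real (Suc k)) \<longlonglongrightarrow> x"
proof (rule tendsto_sandwich)
  have e: "real (nat \<lceil>real (Suc k) * x\<rceil>) = real_of_int \<lceil>real (Suc k) * x\<rceil>" for k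
    using assms by (intro of_nat_nat) (simp add: less_le_trans[of "-1" 0])
  show "\<forall>\<^sub>F k in sequentially. x \<le> real (nat \<lceil>real (Suc k) * x\<rceil>) / real (Suc k)"
  proof (rule always_eventually, rule allI)
    fix k
    have "(real (Suc k) * x) / real (Suc k) \<le> real (nat \<lceil>real (Suc k) * x\<rceil>) / real (Suc k)"
      unfolding e by (intro divide_right_mono) auto
    then show "x \<le> real (nat \<lceil>real (Suc k) * x\<rceil>) / real (Suc k)" by (simp del: of_nat_Suc)
  qed
  show "\<forall>\<^sub>F k in sequentially. real (nat \<lceil>real (Suc k) * x\<rceil>) / real (Suc k) \<le> x + 1 / real (Suc k)"
  proof (rule always_eventually, rule allI)
    fix k
    have "real (nat \<lceil>real (Suc k) * x\<rceil>) / real (Suc k) \<le> (real (Suc k) * x + 1) / real (Suc k)"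
      unfolding e by (intro divide_right_mono) (auto simp del: of_nat_Suc)
    then show "real (nat \<lceil>real (Suc k) * x\<rceil>) / real (Suc k) \<le> x + 1 / real (Suc k)"
      by (simp add: add_divide_distrib del: of_nat_Suc)
  qed
  show "(\<lambda>k. x + 1 / real (Suc k)) \<longlonglongrightarrow> x"
    using tendsto_add[OF tendsto_const[of x] LIMSEQ_Suc[OF lim_1_over_n[where 'a=real]]] by simp
qed auto

text \<open>At grid-valued times the identity is a countable sum over fixed times, where
  independence applies; path continuity carries it over to \<open>T\<^sub>1\<close> and
  \<open>T\<^sub>2\<close>.\<close>

lemma subordinated_sheet_char:
  assumes W: "brownian_sheet M W"
    and T: "T\<^sub>1 \<in> borel_measurable M" "T\<^sub>2 \<in> borel_measurable M"
    and nn: "AE \<omega> in M. 0 \<le> T\<^sub>1 \<omega> \<and> 0 \<le> T\<^sub>2 \<omega>"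
    and indep: "prob_space.indep_set M \<G> (process_events M borel ({0..} \<times> {0..}) (\<lambda>(t\<^sub>1, t\<^sub>2). W t\<^sub>1 t\<^sub>2))"
    and \<G>: "sigma_algebra (space M) \<G>" "T\<^sub>1 \<in> measurable (sigma (space M) \<G>) borel" "T\<^sub>2 \<in> measurable (sigma (space M) \<G>) borel"
    and rv[measurable]: "(\<lambda>\<omega>. W (T\<^sub>1 \<omega>) (T\<^sub>2 \<omega>) \<omega>) \<in> borel_measurable M"
  shows "(\<integral>\<omega>. iexp (u * W (T\<^sub>1 \<omega>) (T\<^sub>2 \<omega>) \<omega>) \<partial>M)
    = complex_of_real (\<integral>\<omega>. exp (- (u\<^sup>2 / 2 * (max 0 (T\<^sub>1 \<omega>) * max 0 (T\<^sub>2 \<omega>)))) \<partial>M)"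
proof -
  interpret prob_space M by (rule brownian_sheetD(1)[OF W])
  note [measurable] = T
  have Wm: "W x y \<in> borel_measurable M" if "0 \<le> x" "0 \<le> y" for x y
    using brownian_sheetD(2)[OF W] that by blast
  have cont: "AE \<omega> in M. continuous_on ({0..} \<times> {0..}) (\<lambda>(t\<^sub>1, t\<^sub>2). W t\<^sub>1 t\<^sub>2 \<omega>)"
    by (rule brownian_sheetD(5)[OF W])
  \<comment> \<open>Round both random times up to the grid of mesh \<open>1 / (k + 1)\<close>; \<open>N k\<close> encodes the pair of grid indices.\<close>
  define A where "A = (\<lambda>k \<omega>. (nat \<lceil>real (Suc k) * max 0 (T\<^sub>1 \<omega>)\<rceil>, nat \<lceil>real (Suc k) * max 0 (T\<^sub>2 \<omega>)\<rceil>))"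
  define R\<^sub>1 where "R\<^sub>1 = (\<lambda>k (q::nat). real (fst (prod_decode q)) / real (Suc k))"
  define R\<^sub>2 where "R\<^sub>2 = (\<lambda>k (q::nat). real (snd (prod_decode q)) / real (Suc k))"
  define N where "N = (\<lambda>k \<omega>. prod_encode (A k \<omega>))"
  have Rnn: "0 \<le> R\<^sub>1 k q" "0 \<le> R\<^sub>2 k q" for k q by (auto simp: R\<^sub>1_def R\<^sub>2_def)
  have NM: "N k \<in> measurable \<M> (count_space UNIV)"
    if [measurable]: "T\<^sub>1 \<in> borel_measurable \<M>" "T\<^sub>2 \<in> borel_measurable \<M>" for k \<M>
  proof -
    have "(\<lambda>\<omega>. (\<lambda>i j. prod_encode (i, j)) (nat \<lceil>real (Suc k) * max 0 (T\<^sub>1 \<omega>)\<rceil>) (nat \<lceil>real (Suc k) * max 0 (T\<^sub>2 \<omega>)\<rceil>))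
       \<in> measurable \<M> (count_space UNIV)" by measurable
    then show ?thesis by (simp add: N_def A_def)
  qed
  have lim1: "(\<lambda>k. R\<^sub>1 k (N k \<omega>)) \<longlonglongrightarrow> max 0 (T\<^sub>1 \<omega>)" for \<omega>
    using tendsto_grid_approximation[of "max 0 (T\<^sub>1 \<omega>)"]
    unfolding R\<^sub>1_def N_def A_def by (simp del: of_nat_Suc)
  have lim2: "(\<lambda>k. R\<^sub>2 k (N k \<omega>)) \<longlonglongrightarrow> max 0 (T\<^sub>2 \<omega>)" for \<omega>
    using tendsto_grid_approximation[of "max 0 (T\<^sub>2 \<omega>)"]
    unfolding R\<^sub>2_def N_def A_def by (simp del: of_nat_Suc)
  let ?P = "process_events M borel ({0..} \<times> {0..}) (\<lambda>(t\<^sub>1, t\<^sub>2). W t\<^sub>1 t\<^sub>2)"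
  have step: "expectation (\<lambda>\<omega>. iexp (u * W (R\<^sub>1 k (N k \<omega>)) (R\<^sub>2 k (N k \<omega>)) \<omega>))
     = of_real (expectation (\<lambda>\<omega>. exp (- (u\<^sup>2 / 2 * (R\<^sub>1 k (N k \<omega>) * R\<^sub>2 k (N k \<omega>))))))" for k
  proof (rule expectation_independent_index[where e="\<lambda>q \<omega>. iexp (u * W (R\<^sub>1 k q) (R\<^sub>2 k q) \<omega>)"
       and \<phi>="\<lambda>q. exp (- (u\<^sup>2 / 2 * (R\<^sub>1 k q * R\<^sub>2 k q)))", OF NM[OF T] _ indep])
    show "{\<omega> \<in> space M. N k \<omega> = q} \<in> \<G>" for q
    proof -
      have "N k -` {q} \<inter> space M \<in> \<G>"
        using measurable_sets[OF NM[OF \<G>(2,3)], of "{q}" k] \<G>(1)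
        by (simp add: sigma_algebra.sets_measure_of_eq sigma_algebra.space_measure_of_eq)
      moreover have "{\<omega> \<in> space M. N k \<omega> = q} = N k -` {q} \<inter> space M" by auto
      ultimately show ?thesis by simp
    qed
    show "(\<lambda>\<omega>. iexp (u * W (R\<^sub>1 k q) (R\<^sub>2 k q) \<omega>)) -` S \<inter> space M \<in> ?P" if "S \<in> sets borel" for q S
    proof -
      have [measurable]: "W (R\<^sub>1 k q) (R\<^sub>2 k q) \<in> measurable (sigma (space M) ?P) borel"
      proof -
        have "(\<lambda>(t\<^sub>1, t\<^sub>2). W t\<^sub>1 t\<^sub>2) (R\<^sub>1 k q, R\<^sub>2 k q) \<in> measurable (sigma (space M) ?P) borel"
          by (rule process_events_measurable[OF _ _ order_refl sigma_algebra_process_events]) (use Rnn in auto)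
        then show ?thesis by simp
      qed
      have "(\<lambda>\<omega>. iexp (u * W (R\<^sub>1 k q) (R\<^sub>2 k q) \<omega>)) \<in> measurable (sigma (space M) ?P) borel" by measurable
      from measurable_sets[OF this that] show ?thesis
        using sigma_algebra_process_events[of M borel "{0..} \<times> {0..}" "\<lambda>(t\<^sub>1, t\<^sub>2). W t\<^sub>1 t\<^sub>2"]
        by (simp add: sigma_algebra.sets_measure_of_eq sigma_algebra.space_measure_of_eq)
    qed
    show "expectation (\<lambda>\<omega>. iexp (u * W (R\<^sub>1 k q) (R\<^sub>2 k q) \<omega>)) = complex_of_real (exp (- (u\<^sup>2 / 2 * (R\<^sub>1 k q * R\<^sub>2 k q))))" for q
      by (rule brownian_sheet_char[OF W Rnn])
    show "\<bar>exp (- (u\<^sup>2 / 2 * (R\<^sub>1 k q * R\<^sub>2 k q)))\<bar> \<le> 1" for q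
      using Rnn[of k q] by simp
  qed simp
  have L: "(\<lambda>k. expectation (\<lambda>\<omega>. iexp (u * W (R\<^sub>1 k (N k \<omega>)) (R\<^sub>2 k (N k \<omega>)) \<omega>)))
      \<longlonglongrightarrow> expectation (\<lambda>\<omega>. iexp (u * W (T\<^sub>1 \<omega>) (T\<^sub>2 \<omega>) \<omega>))"
  proof (rule integral_dominated_convergence[where w="\<lambda>_. 1"])
    \<comment> \<open>Path continuity holds on the closed quadrant, where both random times lie
      almost surely.\<close>
    show "AE \<omega> in M. (\<lambda>k. iexp (u * W (R\<^sub>1 k (N k \<omega>)) (R\<^sub>2 k (N k \<omega>)) \<omega>)) \<longlonglongrightarrow> iexp (u * W (T\<^sub>1 \<omega>) (T\<^sub>2 \<omega>) \<omega>)"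
      using cont nn
    proof eventually_elim
      case (elim \<omega>)
      have "(\<lambda>k. (\<lambda>(t\<^sub>1, t\<^sub>2). W t\<^sub>1 t\<^sub>2 \<omega>) (R\<^sub>1 k (N k \<omega>), R\<^sub>2 k (N k \<omega>))) \<longlonglongrightarrow> (\<lambda>(t\<^sub>1, t\<^sub>2). W t\<^sub>1 t\<^sub>2 \<omega>) (T\<^sub>1 \<omega>, T\<^sub>2 \<omega>)"
      proof (rule continuous_on_tendsto_compose[OF elim(1)])
        show "(\<lambda>k. (R\<^sub>1 k (N k \<omega>), R\<^sub>2 k (N k \<omega>))) \<longlonglongrightarrow> (T\<^sub>1 \<omega>, T\<^sub>2 \<omega>)"
          using lim1[of \<omega>] lim2[of \<omega>] elim(2) by (intro tendsto_Pair) (auto simp: max_absorb2)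
      qed (use elim(2) Rnn in auto)
      then show ?case by (intro tendsto_intros) simp
    qed
    show "(\<lambda>\<omega>. iexp (u * W (R\<^sub>1 k (N k \<omega>)) (R\<^sub>2 k (N k \<omega>)) \<omega>)) \<in> borel_measurable M" for k
    proof (rule measurable_compose_countable[OF _ NM[OF T]])
      fix q
      have [measurable]: "W (R\<^sub>1 k q) (R\<^sub>2 k q) \<in> borel_measurable M" by (rule Wm[OF Rnn])
      show "(\<lambda>\<omega>. iexp (u * W (R\<^sub>1 k q) (R\<^sub>2 k q) \<omega>)) \<in> borel_measurable M" by measurable
    qed
  qed auto
  have R: "(\<lambda>k. expectation (\<lambda>\<omega>. exp (- (u\<^sup>2 / 2 * (R\<^sub>1 k (N k \<omega>) * R\<^sub>2 k (N k \<omega>))))))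
      \<longlonglongrightarrow> expectation (\<lambda>\<omega>. exp (- (u\<^sup>2 / 2 * (max 0 (T\<^sub>1 \<omega>) * max 0 (T\<^sub>2 \<omega>)))))"
  proof (rule integral_dominated_convergence[where w="\<lambda>_. 1"])
    show "(\<lambda>\<omega>. exp (- (u\<^sup>2 / 2 * (R\<^sub>1 k (N k \<omega>) * R\<^sub>2 k (N k \<omega>))))) \<in> borel_measurable M" for k
      by (rule measurable_compose_countable[OF _ NM[OF T]]) simp
    show "AE \<omega> in M. (\<lambda>k. exp (- (u\<^sup>2 / 2 * (R\<^sub>1 k (N k \<omega>) * R\<^sub>2 k (N k \<omega>)))))
       \<longlonglongrightarrow> exp (- (u\<^sup>2 / 2 * (max 0 (T\<^sub>1 \<omega>) * max 0 (T\<^sub>2 \<omega>))))"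
      by (intro AE_I2 tendsto_intros lim1 lim2)
    show "AE \<omega> in M. norm (exp (- (u\<^sup>2 / 2 * (R\<^sub>1 k (N k \<omega>) * R\<^sub>2 k (N k \<omega>))))) \<le> 1" for k
      using Rnn by (intro AE_I2) simp
  qed auto
  have "(\<lambda>k. expectation (\<lambda>\<omega>. iexp (u * W (R\<^sub>1 k (N k \<omega>)) (R\<^sub>2 k (N k \<omega>)) \<omega>)))
      \<longlonglongrightarrow> of_real (expectation (\<lambda>\<omega>. exp (- (u\<^sup>2 / 2 * (max 0 (T\<^sub>1 \<omega>) * max 0 (T\<^sub>2 \<omega>))))))"
    unfolding step by (intro tendsto_of_real R)
  from LIMSEQ_unique[OF L this] show ?thesis .
qed

section \<open>Convergence\<close>

text \<open>Given \<open>N = k\<close>, the sum has \<open>k\<close> independent standard normal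
  terms, so its characteristic function is a \<open>k\<close>-th power.\<close>

lemma compound_normal_char:
  assumes "prob_space M" and Z_indep: "prob_space.indep_vars M (\<lambda>_. borel) Z {1..}"
    and Z_normal: "\<And>j. j \<ge> 1 \<Longrightarrow> distributed M lborel (Z j) std_normal_density"
    and N: "N \<in> measurable M (count_space UNIV)"
    and indep: "prob_space.indep_set M A (process_events M borel {1..} Z)"
    and NA: "\<And>k. {\<omega> \<in> space M. N \<omega> = k} \<in> A"
  shows "(\<integral>\<omega>. iexp (v * (\<Sum>j = 1..N \<omega>. Z j \<omega>)) \<partial>M) = complex_of_real (\<integral>\<omega>. exp (- v\<^sup>2 / 2) ^ N \<omega> \<partial>M)"
proof -
  interpret prob_space M by fact
  let ?P = "process_events M borel {1..} Z"
  have Zm: "Z j \<in> borel_measurable M" if "j \<ge> 1" for j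
    using distributed_measurable[OF Z_normal[OF that]] by simp
  show ?thesis
  proof (rule expectation_independent_index[where e="\<lambda>k \<omega>. iexp (v * (\<Sum>j = 1..k. Z j \<omega>))"
       and \<phi>="\<lambda>k. exp (- v\<^sup>2 / 2) ^ k", OF N _ indep NA])
    show "(\<lambda>\<omega>. iexp (v * (\<Sum>j = 1..k. Z j \<omega>))) -` S \<inter> space M \<in> ?P" if "S \<in> sets borel" for k S
    proof -
      have "Z j \<in> measurable (sigma (space M) ?P) borel" if "j \<in> {1..k}" for j
        by (rule process_events_measurable[OF _ _ order_refl sigma_algebra_process_events]) (use that in auto)
      then have [measurable]: "(\<lambda>\<omega>. \<Sum>j = 1..k. Z j \<omega>) \<in> measurable (sigma (space M) ?P) borel"
        by (rule borel_measurable_sum)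
      have "(\<lambda>\<omega>. iexp (v * (\<Sum>j = 1..k. Z j \<omega>))) \<in> measurable (sigma (space M) ?P) borel" by measurable
      from measurable_sets[OF this that] show ?thesis
        using sigma_algebra_process_events[of M borel "{1..}" Z]
        by (simp add: sigma_algebra.sets_measure_of_eq sigma_algebra.space_measure_of_eq)
    qed
    show "expectation (\<lambda>\<omega>. iexp (v * (\<Sum>j = 1..k. Z j \<omega>))) = complex_of_real (exp (- v\<^sup>2 / 2) ^ k)" for k
    proof -
      have m: "(\<lambda>\<omega>. \<Sum>j = 1..k. Z j \<omega>) \<in> borel_measurable M"
        using Zm by (intro borel_measurable_sum) auto
      have "expectation (\<lambda>\<omega>. iexp (v * (\<Sum>j = 1..k. Z j \<omega>))) = char (distr M borel (\<lambda>\<omega>. \<Sum>j = 1..k. Z j \<omega>)) v"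
        unfolding char_def using m by (subst integral_distr) auto
      also have "\<dots> = (\<Prod>j = 1..k. char (distr M borel (Z j)) v)"
        by (rule char_distr_sum[OF indep_vars_subset[OF Z_indep]]) auto
      also have "\<dots> = (\<Prod>j = 1..k. complex_of_real (exp (- v\<^sup>2 / 2)))"
      proof (rule prod.cong[OF refl])
        fix j assume "j \<in> {1..k}"
        then have j: "j \<ge> 1" by simp
        have "distr M borel (Z j) = distr M lborel (Z j)" by (rule distr_cong) auto
        also have "\<dots> = std_normal_distribution" using distributed_distr_eq_density[OF Z_normal[OF j]] by simp
        finally show "char (distr M borel (Z j)) v = complex_of_real (exp (- v\<^sup>2 / 2))"
          by (simp add: char_std_normal_distribution)
      qed
      finally show ?thesis by simp
    qed
    show "\<bar>exp (- v\<^sup>2 / 2) ^ k\<bar> \<le> 1" for k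
      by (simp add: power_le_one)
  qed simp
qed

text \<open>Only the law of \<open>N\<close> is tied to \<open>G\<close>, so the two variables may
  live on different spaces; dominated convergence exchanges the Poisson generating series with the
  expectation over \<open>G\<close>.\<close>

lemma poisson_mixture_pgf:
  assumes "prob_space M" "prob_space M'"
    and N: "N \<in> measurable M (count_space UNIV)"
    and G[measurable]: "G \<in> borel_measurable M'" and nn: "\<And>\<omega>. 0 \<le> G \<omega>"
    and law: "\<And>k. measure M {\<omega> \<in> space M. N \<omega> = k} = (\<integral>\<omega>. pois k (G \<omega>) \<partial>M')"
    and z: "0 \<le> z" "z \<le> 1"
  shows "(\<integral>\<omega>. z ^ N \<omega> \<partial>M) = (\<integral>\<omega>. exp (- G \<omega> * (1 - z)) \<partial>M')"
proof -
  interpret prob_space M by fact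
  interpret M': prob_space M' by fact
  have zk: "\<bar>z ^ k\<bar> \<le> 1" for k using z by (simp add: power_le_one)
  have 1: "(\<lambda>k. (\<integral>\<omega>. pois k (G \<omega>) \<partial>M') * z ^ k) sums (\<integral>\<omega>. z ^ N \<omega> \<partial>M)"
    using expectation_index_sums[OF N zk] unfolding law .
  have i: "integrable M' (\<lambda>\<omega>. pois k (G \<omega>) * z ^ k)" for k
    using mult_mono[OF pois_le_1 zk] nn pois_nonneg z
    by (intro M'.integrable_const_bound[of _ 1] AE_I2) (auto simp: abs_mult)
  have b: "norm (\<Sum>k<m. pois k (G \<omega>) * z ^ k) \<le> 1" for m \<omega>
  proof -
    have t: "0 \<le> pois k (G \<omega>) * z ^ k" for k using nn pois_nonneg z by auto
    have "(\<Sum>k<m. pois k (G \<omega>) * z ^ k) \<le> (\<Sum>k<m. pois k (G \<omega>))"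
      using nn pois_nonneg z by (intro sum_mono mult_left_le) (auto simp: power_le_one)
    also have "\<dots> \<le> (\<Sum>k. pois k (G \<omega>))"
      using nn pois_nonneg by (intro sum_le_suminf sums_summable[OF pois_sums_1]) auto
    also have "\<dots> = 1" using pois_sums_1 by (rule sums_unique[symmetric])
    finally show ?thesis using t by (simp add: sum_nonneg)
  qed
  have "(\<lambda>m. \<integral>\<omega>. (\<Sum>k<m. pois k (G \<omega>) * z ^ k) \<partial>M') \<longlonglongrightarrow> (\<integral>\<omega>. exp (- G \<omega> * (1 - z)) \<partial>M')"
  proof (rule integral_dominated_convergence[where w="\<lambda>_. 1"])
    show "AE \<omega> in M'. (\<lambda>m. \<Sum>k<m. pois k (G \<omega>) * z ^ k) \<longlonglongrightarrow> exp (- G \<omega> * (1 - z))"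
      using pois_sums unfolding sums_def by (intro AE_I2)
  qed (use b in auto)
  moreover have "(\<integral>\<omega>. (\<Sum>k<m. pois k (G \<omega>) * z ^ k) \<partial>M') = (\<Sum>k<m. (\<integral>\<omega>. pois k (G \<omega>) \<partial>M') * z ^ k)" for m
    using i by (subst Bochner_Integration.integral_sum) auto
  ultimately have 2: "(\<lambda>k. (\<integral>\<omega>. pois k (G \<omega>) \<partial>M') * z ^ k) sums (\<integral>\<omega>. exp (- G \<omega> * (1 - z)) \<partial>M')"
    unfolding sums_def by (simp only:)
  from sums_unique2[OF 1 2] show ?thesis .
qed

lemma (in prob_space) indep_var_process_events:
  assumes indep: "indep_set (process_events M borel I X) (process_events M borel J Y)"
    and ij: "i \<in> I" "j \<in> J" and m: "X i \<in> borel_measurable M" "Y j \<in> borel_measurable M"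
  shows "indep_var borel (X i) borel (Y j)"
  unfolding indep_var_eq
proof (intro conjI m)
  have "sigma_sets (space M) {X i -` A \<inter> space M |A. A \<in> sets borel} \<subseteq> process_events M borel I X"
    "sigma_sets (space M) {Y j -` A \<inter> space M |A. A \<in> sets borel} \<subseteq> process_events M borel J Y"
    unfolding process_events_def using ij by (intro sigma_sets_subseteq; blast)+
  then show "indep_set (sigma_sets (space M) {X i -` A \<inter> space M |A. A \<in> sets borel})
      (sigma_sets (space M) {Y j -` A \<inter> space M |A. A \<in> sets borel})"
    using indep unfolding indep_sets2_eq by blast
qed

text \<open>The joint law is the product of the marginals; this merges the iterated integral left by
  the two Laplace inversions into one expectation.\<close>

lemma (in prob_space) indep_var_iterated_integral:
  fixes F :: "real \<Rightarrow> real \<Rightarrow> real"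
  assumes indep: "indep_var borel X borel Y" and F[measurable]: "case_prod F \<in> borel_measurable (borel \<Otimes>\<^sub>M borel)"
    and b: "\<And>x y. \<bar>F x y\<bar> \<le> 1"
  shows "(\<integral>\<omega>. (\<integral>\<omega>'. F (X \<omega>) (Y \<omega>') \<partial>M) \<partial>M) = (\<integral>\<omega>. F (X \<omega>) (Y \<omega>) \<partial>M)"
proof -
  have [measurable]: "X \<in> borel_measurable M" "Y \<in> borel_measurable M"
    and d: "distr M borel X \<Otimes>\<^sub>M distr M borel Y = distr M (borel \<Otimes>\<^sub>M borel) (\<lambda>x. (X x, Y x))"
    using indep unfolding indep_var_distribution_eq by auto
  interpret X: prob_space "distr M borel X" by (rule prob_space_distr) simp
  interpret Y: prob_space "distr M borel Y" by (rule prob_space_distr) simp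
  interpret P: pair_prob_space "distr M borel X" "distr M borel Y" ..
  have Fx: "F x \<in> borel_measurable borel" for x
    by measurable
  have "(\<integral>\<omega>. F (X \<omega>) (Y \<omega>) \<partial>M) = (\<integral>z. case_prod F z \<partial>distr M (borel \<Otimes>\<^sub>M borel) (\<lambda>x. (X x, Y x)))"
    by (subst integral_distr) auto
  also have "\<dots> = (\<integral>z. case_prod F z \<partial>(distr M borel X \<Otimes>\<^sub>M distr M borel Y))" by (simp only: d)
  also have "\<dots> = (\<integral>x. (\<integral>y. F x y \<partial>distr M borel Y) \<partial>distr M borel X)"
    by (rule P.integral_fst[symmetric]) (rule P.integrable_const_bound[of _ 1], use b in \<open>auto simp: case_prod_beta'\<close>)
  also have "\<dots> = (\<integral>x. (\<integral>\<omega>'. F x (Y \<omega>') \<partial>M) \<partial>distr M borel X)"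
    using Fx by (subst integral_distr) auto
  also have "\<dots> = (\<integral>\<omega>. (\<integral>\<omega>'. F (X \<omega>) (Y \<omega>') \<partial>M) \<partial>M)"
    by (subst integral_distr) auto
  finally show ?thesis ..
qed

lemma fractional_poisson_field_law:
  assumes field: "fractional_poisson_field M \<alpha>\<^sub>1 \<alpha>\<^sub>2 lam N" and \<alpha>: "\<alpha>\<^sub>1 < 1" "\<alpha>\<^sub>2 < 1"
    and "prob_space M'"
    and L1: "inverse_stable_subordinator M' \<alpha>\<^sub>1 L\<^sub>1" and L2: "inverse_stable_subordinator M' \<alpha>\<^sub>2 L\<^sub>2"
    and indep: "prob_space.indep_set M' (process_events M' borel {0..} L\<^sub>1) (process_events M' borel {0..} L\<^sub>2)"
    and t: "0 \<le> t\<^sub>1" "0 \<le> t\<^sub>2"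
  shows "measure M {\<omega> \<in> space M. N t\<^sub>1 t\<^sub>2 \<omega> = k}
    = (\<integral>\<omega>. pois k (lam * max 0 (L\<^sub>1 t\<^sub>1 \<omega>) * max 0 (L\<^sub>2 t\<^sub>2 \<omega>)) \<partial>M')"
proof -
  interpret prob_space M using field unfolding fractional_poisson_field_def by (elim conjE)
  interpret M': prob_space M' by fact
  have lam: "0 < lam" and \<alpha>0: "0 < \<alpha>\<^sub>1" "0 < \<alpha>\<^sub>2"
    and Nm: "\<forall>t\<^sub>1\<ge>0. \<forall>t\<^sub>2\<ge>0. N t\<^sub>1 t\<^sub>2 \<in> measurable M (count_space UNIV)"
    and sys: "fractional_poisson_system \<alpha>\<^sub>1 \<alpha>\<^sub>2 lam (\<lambda>n t\<^sub>1 t\<^sub>2. measure M {\<omega> \<in> space M. N t\<^sub>1 t\<^sub>2 \<omega> = n})"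
    using field unfolding fractional_poisson_field_def by simp_all
  interpret S: fractional_poisson_solution \<alpha>\<^sub>1 \<alpha>\<^sub>2 lam "\<lambda>n t\<^sub>1 t\<^sub>2. measure M {\<omega> \<in> space M. N t\<^sub>1 t\<^sub>2 \<omega> = n}"
  proof
    show "(\<lambda>n. prob {\<omega> \<in> space M. N x y \<omega> = n}) sums 1" if "0 \<le> x" "0 \<le> y" for x y
      using expectation_index_sums[of "N x y" "\<lambda>_. 1"] Nm that by (simp add: prob_space)
  qed (use lam \<alpha>0 \<alpha> sys in auto)
  have [measurable]: "L\<^sub>1 t\<^sub>1 \<in> borel_measurable M'" "L\<^sub>2 t\<^sub>2 \<in> borel_measurable M'"
    by (intro inverse_stable_subordinator_measurable[OF L1] inverse_stable_subordinator_measurable[OF L2] t)+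
  show ?thesis
  proof (cases "t\<^sub>1 = 0 \<or> t\<^sub>2 = 0")
    \<comment> \<open>On the axes both sides are a point mass at 0, because an inverse subordinator
      starts at 0 almost surely.\<close>
    case True
    have "AE \<omega> in M'. lam * max 0 (L\<^sub>1 t\<^sub>1 \<omega>) * max 0 (L\<^sub>2 t\<^sub>2 \<omega>) = 0"
      using inverse_stable_subordinator_0[OF L1] inverse_stable_subordinator_0[OF L2]
      by eventually_elim (use True in auto)
    then have "AE \<omega> in M'. pois k (lam * max 0 (L\<^sub>1 t\<^sub>1 \<omega>) * max 0 (L\<^sub>2 t\<^sub>2 \<omega>)) = (if k = 0 then 1 else 0)"
      by eventually_elim (simp only: pois_0)
    then have "(\<integral>\<omega>. pois k (lam * max 0 (L\<^sub>1 t\<^sub>1 \<omega>) * max 0 (L\<^sub>2 t\<^sub>2 \<omega>)) \<partial>M') = (\<integral>\<omega>. (if k = 0 then 1 else 0) \<partial>M')"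
      by (intro integral_cong_AE) auto
    then show ?thesis using True S.axis1[OF t(2), of k] S.axis2[OF t(1), of k] M'.prob_space by auto
  next
    case False
    then have pos: "0 < t\<^sub>1" "0 < t\<^sub>2" using t by auto
    have "M'.indep_var borel (L\<^sub>1 t\<^sub>1) borel (L\<^sub>2 t\<^sub>2)"
      using t by (intro M'.indep_var_process_events[OF indep]) auto
    from M'.indep_var_iterated_integral[OF this S.F_measurable S.F_abs]
      S.subordinated_law[OF \<open>prob_space M'\<close> L1 L2 pos, of k]
    show ?thesis by (simp add: S.F_def)
  qed
qed

theorem mainTheorem11:
  fixes M :: "'a measure" and M' :: "'b measure"
    and \<alpha>\<^sub>1 \<alpha>\<^sub>2 :: real
    and N :: "nat \<Rightarrow> real \<Rightarrow> real \<Rightarrow> 'a \<Rightarrow> nat"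
    and Z :: "nat \<Rightarrow> 'a \<Rightarrow> real"
    and X :: "nat \<Rightarrow> real \<Rightarrow> real \<Rightarrow> 'a \<Rightarrow> real"
    and L\<^sub>1 L\<^sub>2 :: "real \<Rightarrow> 'b \<Rightarrow> real"
    and W :: "real \<Rightarrow> real \<Rightarrow> 'b \<Rightarrow> real"
  assumes "prob_space M" and "prob_space M'"
    and "0 < \<alpha>\<^sub>1" "\<alpha>\<^sub>1 < 1" "0 < \<alpha>\<^sub>2" "\<alpha>\<^sub>2 < 1"
    and field: "\<And>n. n \<ge> 1 \<Longrightarrow> fractional_poisson_field M \<alpha>\<^sub>1 \<alpha>\<^sub>2 ((real n)\<^sup>2) (N n)"
    and Z_indep: "prob_space.indep_vars M (\<lambda>_. borel) Z {1..}"
    and Z_normal: "\<And>j. j \<ge> 1 \<Longrightarrow> distributed M lborel (Z j) std_normal_density"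
    and field_Z_indep: "\<And>n. n \<ge> 1 \<Longrightarrow> prob_space.indep_set M
           (process_events M (count_space UNIV) ({0..} \<times> {0..}) (\<lambda>(t\<^sub>1, t\<^sub>2). N n t\<^sub>1 t\<^sub>2))
           (process_events M borel {1..} Z)"
    and X_def: "\<And>n t\<^sub>1 t\<^sub>2 \<omega>. X n t\<^sub>1 t\<^sub>2 \<omega> = 1 / real n * (\<Sum>j = 1..N n t\<^sub>1 t\<^sub>2 \<omega>. Z j \<omega>)"
    and L1: "inverse_stable_subordinator M' \<alpha>\<^sub>1 L\<^sub>1"
    and L2: "inverse_stable_subordinator M' \<alpha>\<^sub>2 L\<^sub>2"
    and W: "brownian_sheet M' W"
    and L1_L2_indep: "prob_space.indep_set M'
           (process_events M' borel {0..} L\<^sub>1) (process_events M' borel {0..} L\<^sub>2)"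
    and L_W_indep: "prob_space.indep_set M'
           (sigma_sets (space M')
              (process_events M' borel {0..} L\<^sub>1 \<union> process_events M' borel {0..} L\<^sub>2))
           (process_events M' borel ({0..} \<times> {0..}) (\<lambda>(t\<^sub>1, t\<^sub>2). W t\<^sub>1 t\<^sub>2))"
    and limit_rv: "\<And>t\<^sub>1 t\<^sub>2. 0 \<le> t\<^sub>1 \<Longrightarrow> 0 \<le> t\<^sub>2 \<Longrightarrow>
           (\<lambda>\<omega>. W (L\<^sub>1 t\<^sub>1 \<omega>) (L\<^sub>2 t\<^sub>2 \<omega>) \<omega>) \<in> borel_measurable M'"
  shows "\<forall>t\<^sub>1\<ge>0. \<forall>t\<^sub>2\<ge>0.
           weak_conv_m (\<lambda>n. distr M borel (X n t\<^sub>1 t\<^sub>2))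
                       (distr M' borel (\<lambda>\<omega>. W (L\<^sub>1 t\<^sub>1 \<omega>) (L\<^sub>2 t\<^sub>2 \<omega>) \<omega>))"
proof (intro allI impI)
  fix t\<^sub>1 t\<^sub>2 :: real assume t: "0 \<le> t\<^sub>1" "0 \<le> t\<^sub>2"
  interpret prob_space M by fact
  interpret M': prob_space M' by fact
  have L1m[measurable]: "L\<^sub>1 t\<^sub>1 \<in> borel_measurable M'" and L2m[measurable]: "L\<^sub>2 t\<^sub>2 \<in> borel_measurable M'"
    by (intro inverse_stable_subordinator_measurable[OF L1] inverse_stable_subordinator_measurable[OF L2] t)+
  \<comment> \<open>Clipping changes nothing almost surely and makes \<open>G\<close> nonnegative at
    every outcome.\<close>
  define G where "G = (\<lambda>\<omega>. max 0 (L\<^sub>1 t\<^sub>1 \<omega>) * max 0 (L\<^sub>2 t\<^sub>2 \<omega>))"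
  have Gm[measurable]: "G \<in> borel_measurable M'" unfolding G_def by measurable
  have Gnn: "0 \<le> G \<omega>" for \<omega> by (simp add: G_def)
  have Nm: "N n t\<^sub>1 t\<^sub>2 \<in> measurable M (count_space UNIV)" if "n \<ge> 1" for n
    using field[OF that] t unfolding fractional_poisson_field_def by simp
  have Zm: "Z j \<in> borel_measurable M" if "j \<ge> 1" for j
    using distributed_measurable[OF Z_normal[OF that]] by simp
  have Xm: "X n t\<^sub>1 t\<^sub>2 \<in> borel_measurable M" for n
  proof (cases "n \<ge> 1")
    case True
    have "(\<lambda>\<omega>. 1 / real n * (\<Sum>j = 1..N n t\<^sub>1 t\<^sub>2 \<omega>. Z j \<omega>)) \<in> borel_measurable M"
      by (rule measurable_compose_countable[OF _ Nm[OF True]])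
         (intro borel_measurable_times borel_measurable_const borel_measurable_sum Zm, simp)
    then show ?thesis by (simp add: X_def[abs_def])
  next
    \<comment> \<open>No field is assumed for \<open>n = 0\<close>; there
      \<open>1 / real 0 = 0\<close> makes \<open>X\<close> vanish.\<close>
    case False
    then have "X n t\<^sub>1 t\<^sub>2 = (\<lambda>_. 0)" by (intro ext) (simp add: X_def)
    then show ?thesis by simp
  qed
  have char_X: "char (distr M borel (X n t\<^sub>1 t\<^sub>2)) u
      = complex_of_real (\<integral>\<omega>. exp (- ((real n)\<^sup>2 * G \<omega>) * (1 - exp (- (u / real n)\<^sup>2 / 2))) \<partial>M')" if n: "n \<ge> 1" for n u
  proof -
    have "char (distr M borel (X n t\<^sub>1 t\<^sub>2)) u = (\<integral>\<omega>. iexp (u * X n t\<^sub>1 t\<^sub>2 \<omega>) \<partial>M)"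
      unfolding char_def using Xm[of n] by (subst integral_distr) auto
    also have "\<dots> = (\<integral>\<omega>. iexp (u / real n * (\<Sum>j = 1..N n t\<^sub>1 t\<^sub>2 \<omega>. Z j \<omega>)) \<partial>M)"
      by (simp add: X_def)
    also have "\<dots> = complex_of_real (\<integral>\<omega>. exp (- (u / real n)\<^sup>2 / 2) ^ N n t\<^sub>1 t\<^sub>2 \<omega> \<partial>M)"
    proof (rule compound_normal_char[OF \<open>prob_space M\<close> Z_indep Z_normal Nm[OF n] field_Z_indep[OF n]])
      fix k
      have "N n t\<^sub>1 t\<^sub>2 -` {k} \<inter> space M \<in> process_events M (count_space UNIV) ({0..} \<times> {0..}) (\<lambda>(t\<^sub>1, t\<^sub>2). N n t\<^sub>1 t\<^sub>2)"
        unfolding process_events_def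
      proof (rule sigma_sets.Basic, rule CollectI, intro exI conjI)
        show "N n t\<^sub>1 t\<^sub>2 -` {k} \<inter> space M = (case (t\<^sub>1, t\<^sub>2) of (t\<^sub>1, t\<^sub>2) \<Rightarrow> N n t\<^sub>1 t\<^sub>2) -` {k} \<inter> space M"
          by simp
      qed (use t in auto)
      moreover have "{\<omega> \<in> space M. N n t\<^sub>1 t\<^sub>2 \<omega> = k} = N n t\<^sub>1 t\<^sub>2 -` {k} \<inter> space M" by auto
      ultimately show "{\<omega> \<in> space M. N n t\<^sub>1 t\<^sub>2 \<omega> = k}
          \<in> process_events M (count_space UNIV) ({0..} \<times> {0..}) (\<lambda>(t\<^sub>1, t\<^sub>2). N n t\<^sub>1 t\<^sub>2)" by simp
    qed
    also have "(\<integral>\<omega>. exp (- (u / real n)\<^sup>2 / 2) ^ N n t\<^sub>1 t\<^sub>2 \<omega> \<partial>M)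
      = (\<integral>\<omega>. exp (- ((real n)\<^sup>2 * G \<omega>) * (1 - exp (- (u / real n)\<^sup>2 / 2))) \<partial>M')"
    proof (rule poisson_mixture_pgf[OF \<open>prob_space M\<close> \<open>prob_space M'\<close> Nm[OF n]])
      show "prob {\<omega> \<in> space M. N n t\<^sub>1 t\<^sub>2 \<omega> = k} = (\<integral>\<omega>. pois k ((real n)\<^sup>2 * G \<omega>) \<partial>M')" for k
        using fractional_poisson_field_law[OF field[OF n] \<open>\<alpha>\<^sub>1 < 1\<close> \<open>\<alpha>\<^sub>2 < 1\<close> \<open>prob_space M'\<close> L1 L2 L1_L2_indep t, of k]
        by (simp add: G_def mult.assoc)
    qed (use Gnn in auto)
    finally show ?thesis .
  qed
  have char_W: "char (distr M' borel (\<lambda>\<omega>. W (L\<^sub>1 t\<^sub>1 \<omega>) (L\<^sub>2 t\<^sub>2 \<omega>) \<omega>)) u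
      = complex_of_real (\<integral>\<omega>. exp (- (u\<^sup>2 / 2 * G \<omega>)) \<partial>M')" for u
  proof -
    let ?P1 = "process_events M' borel {0..} L\<^sub>1" and ?P2 = "process_events M' borel {0..} L\<^sub>2"
    let ?\<G> = "sigma_sets (space M') (?P1 \<union> ?P2)"
    have sub: "?P1 \<union> ?P2 \<subseteq> Pow (space M')"
      using sets.sets_into_space M'.indep_setD_ev1[OF L1_L2_indep] M'.indep_setD_ev2[OF L1_L2_indep] by blast
    have \<G>: "sigma_algebra (space M') ?\<G>" using sub by (rule sigma_algebra_sigma_sets)
    have P\<G>: "?P1 \<subseteq> ?\<G>" "?P2 \<subseteq> ?\<G>" by (auto intro: sigma_sets.Basic)
    have "char (distr M' borel (\<lambda>\<omega>. W (L\<^sub>1 t\<^sub>1 \<omega>) (L\<^sub>2 t\<^sub>2 \<omega>) \<omega>)) u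
        = (\<integral>\<omega>. iexp (u * W (L\<^sub>1 t\<^sub>1 \<omega>) (L\<^sub>2 t\<^sub>2 \<omega>) \<omega>) \<partial>M')"
      unfolding char_def using limit_rv[OF t] by (subst integral_distr) auto
    also have "\<dots> = complex_of_real (\<integral>\<omega>. exp (- (u\<^sup>2 / 2 * (max 0 (L\<^sub>1 t\<^sub>1 \<omega>) * max 0 (L\<^sub>2 t\<^sub>2 \<omega>)))) \<partial>M')"
    proof (rule subordinated_sheet_char[OF W L1m L2m _ L_W_indep \<G> _ _ limit_rv[OF t]])
      show "AE \<omega> in M'. 0 \<le> L\<^sub>1 t\<^sub>1 \<omega> \<and> 0 \<le> L\<^sub>2 t\<^sub>2 \<omega>"
        using inverse_stable_subordinator_nonneg[OF L1] inverse_stable_subordinator_nonneg[OF L2]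
        by eventually_elim (use t in auto)
      show "L\<^sub>1 t\<^sub>1 \<in> borel_measurable (sigma (space M') ?\<G>)"
        by (rule process_events_measurable[OF _ _ P\<G>(1) \<G>]) (use t in auto)
      show "L\<^sub>2 t\<^sub>2 \<in> borel_measurable (sigma (space M') ?\<G>)"
        by (rule process_events_measurable[OF _ _ P\<G>(2) \<G>]) (use t in auto)
    qed
    finally show ?thesis by (simp add: G_def)
  qed
  have lim: "(\<lambda>n. (\<integral>\<omega>. exp (- ((real n)\<^sup>2 * G \<omega>) * (1 - exp (- (u / real n)\<^sup>2 / 2))) \<partial>M'))
      \<longlonglongrightarrow> (\<integral>\<omega>. exp (- (u\<^sup>2 / 2 * G \<omega>)) \<partial>M')" for u
  proof (rule integral_dominated_convergence[where w="\<lambda>_. 1"])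
    have c: "(\<lambda>n. (real n)\<^sup>2 * (1 - exp (- (u / real n)\<^sup>2 / 2))) \<longlonglongrightarrow> u\<^sup>2 / 2"
    proof -
      \<comment> \<open>The Caratheodory form of the derivative yields a continuous factor
        \<open>g\<close> with \<open>g 0 = 1\<close>; a difference quotient would divide by
        \<open>u\<close>, which may be 0.\<close>
      have "((\<lambda>h::real. - exp (- h)) has_real_derivative 1) (at 0)"
        by (auto intro!: derivative_eq_intros)
      then obtain g :: "real \<Rightarrow> real" where g: "\<And>h. - exp (- h) - (- exp (- 0)) = g h * (h - 0)" "isCont g 0" "g 0 = 1"
        unfolding CARAT_DERIV by blast
      have "(\<lambda>n. (u * (1 / real n))\<^sup>2 / 2) \<longlonglongrightarrow> (u * 0)\<^sup>2 / 2"
        by (intro tendsto_intros lim_1_over_n) simp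
      then have "(\<lambda>n. g ((u / real n)\<^sup>2 / 2)) \<longlonglongrightarrow> g 0"
        by (intro isCont_tendsto_compose[OF g(2)]) simp
      from tendsto_mult[OF tendsto_const[of "u\<^sup>2 / 2"] this]
      have *: "(\<lambda>n. u\<^sup>2 / 2 * g ((u / real n)\<^sup>2 / 2)) \<longlonglongrightarrow> u\<^sup>2 / 2" by (simp add: g(3))
      have **: "u\<^sup>2 / 2 * g ((u / real n)\<^sup>2 / 2) = (real n)\<^sup>2 * (1 - exp (- (u / real n)\<^sup>2 / 2))" if "n \<ge> 1" for n
        using g(1)[of "(u / real n)\<^sup>2 / 2"] that by (simp add: power_divide field_simps)
      show ?thesis
      proof (rule Lim_transform_eventually[OF *])
        show "\<forall>\<^sub>F n in sequentially. u\<^sup>2 / 2 * g ((u / real n)\<^sup>2 / 2) = (real n)\<^sup>2 * (1 - exp (- (u / real n)\<^sup>2 / 2))"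
          using eventually_ge_at_top[of 1] by eventually_elim (rule **)
      qed
    qed
    show "AE \<omega> in M'. (\<lambda>n. exp (- ((real n)\<^sup>2 * G \<omega>) * (1 - exp (- (u / real n)\<^sup>2 / 2)))) \<longlonglongrightarrow> exp (- (u\<^sup>2 / 2 * G \<omega>))"
    proof (rule AE_I2)
      fix \<omega>
      have "(\<lambda>n. exp (- ((real n)\<^sup>2 * (1 - exp (- (u / real n)\<^sup>2 / 2)) * G \<omega>))) \<longlonglongrightarrow> exp (- (u\<^sup>2 / 2 * G \<omega>))"
        by (intro tendsto_intros c)
      then show "(\<lambda>n. exp (- ((real n)\<^sup>2 * G \<omega>) * (1 - exp (- (u / real n)\<^sup>2 / 2)))) \<longlonglongrightarrow> exp (- (u\<^sup>2 / 2 * G \<omega>))"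
        by (simp add: mult_ac)
    qed
    show "AE \<omega> in M'. norm (exp (- ((real n)\<^sup>2 * G \<omega>) * (1 - exp (- (u / real n)\<^sup>2 / 2)))) \<le> 1" for n
      using Gnn by (intro AE_I2) simp
  qed auto
  show "weak_conv_m (\<lambda>n. distr M borel (X n t\<^sub>1 t\<^sub>2)) (distr M' borel (\<lambda>\<omega>. W (L\<^sub>1 t\<^sub>1 \<omega>) (L\<^sub>2 t\<^sub>2 \<omega>) \<omega>))"
  proof (rule levy_continuity)
    show "real_distribution (distr M borel (X n t\<^sub>1 t\<^sub>2))" for n by (rule real_distribution_distr[OF Xm])
    show "real_distribution (distr M' borel (\<lambda>\<omega>. W (L\<^sub>1 t\<^sub>1 \<omega>) (L\<^sub>2 t\<^sub>2 \<omega>) \<omega>))"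
      by (rule M'.real_distribution_distr[OF limit_rv[OF t]])
    show "(\<lambda>n. char (distr M borel (X n t\<^sub>1 t\<^sub>2)) u)
        \<longlonglongrightarrow> char (distr M' borel (\<lambda>\<omega>. W (L\<^sub>1 t\<^sub>1 \<omega>) (L\<^sub>2 t\<^sub>2 \<omega>) \<omega>)) u" for u
      unfolding char_W
    \<comment> \<open>The formula \<open>char_X\<close> holds from \<open>n = 1\<close> on, which is
      enough for the limit.\<close>
    proof (rule Lim_transform_eventually[OF tendsto_of_real[OF lim]])
      show "\<forall>\<^sub>F n in sequentially. complex_of_real (\<integral>\<omega>. exp (- ((real n)\<^sup>2 * G \<omega>) * (1 - exp (- (u / real n)\<^sup>2 / 2))) \<partial>M')
          = char (distr M borel (X n t\<^sub>1 t\<^sub>2)) u"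
        using eventually_ge_at_top[of 1] by eventually_elim (rule char_X[symmetric])
    qed
  qed
qed

end
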